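(* The adjoint functors $\lambda\colon\omega\text{-}\mathbf{cat}\to\mathbf{ADC}$ and $\nu\colon\mathbf{ADC}\to\omega\text{-}\mathbf{cat}$ restrict to adjoint equivalences between the full subcategory of $\omega\text{-}\mathbf{cat}$ consisting of $\omega$-categories with loop-free atomic bases and the full subcategory of $\mathbf{ADC}$ consisting of augmented directed complexes with loop-free unital bases. Under these equivalences, $\omega$-categories with strongly loop-free atomic bases correspond to augmented directed complexes with strongly loop-free unital bases.
   Context: Signs $\alpha,\beta$ range over $\{-,+\}$; $m,n$ are nonnegative integers. $\omega$-categories. An $\omega$-category is a set with unary operators $d^-_n,d^+_n$ and partially defined binary composition operators $(x,y)\mapsto x\#_n y$ ($n\ge 0$) such that: (i) $x\#_n y$ is defined iff $d^+_n x=d^-_n y$; (ii) for every $x$ there is $n$ with $d^-_n x=d^+_n x=x$; (iii) $d^\beta_m d^\alpha_n x=d^\beta_m x$ if $m<n$, and $=d^\alpha_n x$ if $m\ge n$; (iv) $d^-_n x\#_n x=x\#_n d^+_n x=x$; (v) if $x\#_n y$ is defined then $d^\alpha_m(x\#_n y)=d^\alpha_m x=d^\alpha_m y=d^\alpha_m x\#_n d^\alpha_m y$ for $m<n$, $d^-_n(x\#_n y)=d^-_n x$, $d^+_n(x\#_n y)=d^+_n y$, and $d^\alpha_m(x\#_n y)=d^\alpha_m x\#_n d^\alpha_m y$ for $m>n$; (vi) $(x\#_n y)\#_n z=x\#_n(y\#_n z)$ if either side is defined; (vii) if $m<n$ then $(x\#_n y)\#_m(x'\#_n y')=(x\#_m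 x')\#_n(y\#_m y')$ when the left side is defined. A morphism is a function commuting with all these operators; the category is $\omega\text{-}\mathbf{cat}$. For an $\omega$-category $C$, $C_n=\{x\in C: d^-_n x=x\}=\{x\in C:d^+_n x=x\}$, a sub-$\omega$-category. Augmented directed complexes. An augmented directed complex $K$ is an augmented chain complex $(K_n,\partial,\epsilon)$ of abelian groups concentrated in nonnegative dimensions together with a submonoid $K^*_n\subset K_n$ for each $n$. A morphism $K\to L$ is an augmentation-preserving chain map $f$ with $f(K^*_n)\subset L^*_n$ for all $n$. The category is $\mathbf{ADC}$. The functor $\lambda$. For an $\omega$-category $C$, $(\lambda C)_n$ is the abelian group generated by elements $[x]_n$ for $x\in C_n$ subject to relations $[x\#_m y]_n=[x]_n+[y]_n$ for $m<n$; $\partial[x]_{n+1}=[d^+_n x]_n-[d^-_n x]_n$; $\epsilon[x]_0=1$; and $(\lambda C)^*_n$ is the submonoid generated by the elements $[x]_n$. The functor $\nu$. For a chain complex $K$ of abelian groups, $\mu K$ is the abelian group of double sequences $x=(x^-_0,x^+_0,x^-_1,x^+_1,\ldots)$ with $x^\alpha_n\in K_n$, $x^-_n=x^+_n=0$ for all but finitely many $n$, and $x^+_n-x^-_n=\partial x^-_{n+1}=\partial x^+_{n+1}$ for $n\ge0$; it is an $\omega$-category with $d^\alpha_n x=(x^-_0,x^+_0,\ldots,x^-_{n-1},x^+_{n-1},x^\alpha_n,x^\alpha_n,0,0,\ldots)$ and, if $d^+_n x=d^-_n y=z$, $x\#_n y=x-z+y$. For an augmented directed complex $K$, $\nu K$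 is the sub-$\omega$-category of $\mu K$ consisting of the $x$ with $x^-_n,x^+_n\in K^*_n$ for all $n$ and $\epsilon x^-_0=\epsilon x^+_0=1$. Adjunction. $\lambda$ is left adjoint to $\nu$, with unit $\eta x=([d^-_0 x]_0,[d^+_0 x]_0,[d^-_1 x]_1,[d^+_1 x]_1,\ldots)$ and counit $\pi[x]_n=x^-_n=x^+_n$ (for $x\in(\nu K)_n$). Bases for augmented directed complexes. A basis for $K$ is a set $B\subset\bigsqcup_n K_n$ such that each $K_n$ is free abelian with basis $B\cap K_n$ and $K^*_n$ is the submonoid generated by $B\cap K_n$ (such a basis is unique if it exists). Then $K_n$ is partially ordered by $x\le y\iff y-x\in K^*_n$, and is a lattice with greatest lower bound $\wedge$. For $x\in K_{n+1}$, $\partial^-x,\partial^+x\in K_n$ are the unique elements with $\partial x=\partial^+x-\partial^-x$ and $\partial^-x\wedge\partial^+x=0$. For $b\in B$ write $|b|$ for its dimension ($b\in K_{|b|}$). The atom $\langle b\rangle\in\mu K$ is given by $\langle b\rangle^\alpha_n=0$ for $n>|b|$, $\langle b\rangle^\alpha_{|b|}=b$, $\langle b\rangle^\alpha_n=\partial^\alpha\langle b\rangle^\alpha_{n+1}$ for $n<|b|$. The basis $B$ is unital if $\epsilon\langle b\rangle^-_0=\epsilon\langle b\rangle^+_0=1$ for all $b\in B$. It is loop-free if there are partial orderings $\le_0,\le_1,\ldots$ on $B$ such that $a<_n b$ whenever $\langle a\rangle^+_n\wedge\langle b\rangle^-_n>0$ and $|a|,|b|>n$. It is strongly loop-free if there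 is a partial ordering $\le_{\mathbf N}$ on $B$ such that $a<_{\mathbf N}b$ whenever $a\le\partial^-b$ or $\partial^+a\ge b$. Bases for $\omega$-categories. An $\omega$-category $C$ is composition-generated by a subset $E$ if each $e\in E$ is assigned a nonnegative integer dimension $|e|$ and, for each $n\ge0$, $C_n$ is generated under the composition operations $\#_m$ (all $m$, without using the $d^\alpha_m$) by the elements of $E$ of dimension at most $n$. A basis for $C$ is a set $E$ of composition-generators such that $\lambda C$ has a basis and $e\mapsto[e]_{|e|}$ maps $E$ bijectively onto the basis for $\lambda C$. The basis $E$ is atomic if $[d^-_n e]_n\wedge[d^+_n e]_n=0$ in $(\lambda C)_n$ for $e\in E$ and $n<|e|$; it is loop-free (respectively strongly loop-free) if the basis for $\lambda C$ is loop-free (respectively strongly loop-free). *)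

theory Defs
  imports "HOL-Algebra.Free_Abelian_Groups" "HOL-Algebra.Lattice" "HOL-Algebra.Generated_Groups"
begin

datatype sign = Neg | Pos

section \<open>\<open>\<omega>\<close>-categories\<close>

text \<open>
  Composition is a total function of HOL; its value is meaningful only on \<open>composable\<close> pairs, and
  every occurrence of a composite in the axioms is guarded accordingly. Where an axiom says that a
  composite is defined, this is either assumed or follows from axioms (iii) and (v).
\<close>

record 'a omega_cat = "'a partial_object" +
  face :: "sign \<Rightarrow> nat \<Rightarrow> 'a \<Rightarrow> 'a"
  cmp  :: "nat \<Rightarrow> 'a \<Rightarrow> 'a \<Rightarrow> 'a"

definition composable :: "'a omega_cat \<Rightarrow> nat \<Rightarrow> 'a \<Rightarrow> 'a \<Rightarrow> bool" where
  "composable C n x y \<longleftrightarrow>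
     x \<in> carrier C \<and> y \<in> carrier C \<and> face C Pos n x = face C Neg n y"

locale omega_category =
  fixes C :: "'a omega_cat"
  assumes face_closed: "x \<in> carrier C \<Longrightarrow> face C \<alpha> n x \<in> carrier C"
    and cmp_closed: "composable C n x y \<Longrightarrow> cmp C n x y \<in> carrier C"
    and finite_dim: "x \<in> carrier C \<Longrightarrow> \<exists>n. face C Neg n x = x \<and> face C Pos n x = x"
    and face_face: "x \<in> carrier C \<Longrightarrow>
          face C \<beta> m (face C \<alpha> n x) = (if m < n then face C \<beta> m x else face C \<alpha> n x)"
    and cmp_unit_left: "x \<in> carrier C \<Longrightarrow> cmp C n (face C Neg n x) x = x"
    and cmp_unit_right: "x \<in> carrier C \<Longrightarrow> cmp C n x (face C Pos n x) = x"
    and face_cmp_less: "composable C n x y \<Longrightarrow> m < n \<Longrightarrow>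
          face C \<alpha> m (cmp C n x y) = face C \<alpha> m x \<and>
          face C \<alpha> m x = face C \<alpha> m y \<and>
          face C \<alpha> m y = cmp C n (face C \<alpha> m x) (face C \<alpha> m y)"
    and face_cmp_Neg: "composable C n x y \<Longrightarrow> face C Neg n (cmp C n x y) = face C Neg n x"
    and face_cmp_Pos: "composable C n x y \<Longrightarrow> face C Pos n (cmp C n x y) = face C Pos n y"
    and face_cmp_greater: "composable C n x y \<Longrightarrow> n < m \<Longrightarrow>
          face C \<alpha> m (cmp C n x y) = cmp C n (face C \<alpha> m x) (face C \<alpha> m y)"
    and cmp_assoc: "composable C n x y \<and> composable C n (cmp C n x y) z \<or>
                    composable C n y z \<and> composable C n x (cmp C n y z) \<Longrightarrow>
          cmp C n (cmp C n x y) z = cmp C n x (cmp C n y z)"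
    and interchange: "m < n \<Longrightarrow> composable C n x y \<Longrightarrow> composable C n x' y' \<Longrightarrow>
          composable C m (cmp C n x y) (cmp C n x' y') \<Longrightarrow>
          cmp C m (cmp C n x y) (cmp C n x' y') = cmp C n (cmp C m x x') (cmp C m y y')"

text \<open>
  Morphisms are extensional functions, so that equality of morphisms is equality in HOL. Source and
  target may be carried by different types.
\<close>

definition omega_hom :: "'a omega_cat \<Rightarrow> 'b omega_cat \<Rightarrow> ('a \<Rightarrow> 'b) set" where
  "omega_hom C D = {f \<in> carrier C \<rightarrow>\<^sub>E carrier D.
     (\<forall>x\<in>carrier C. \<forall>\<alpha> n. f (face C \<alpha> n x) = face D \<alpha> n (f x)) \<and>
     (\<forall>n x y. composable C n x y \<longrightarrow> f (cmp C n x y) = cmp D n (f x) (f y))}"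

definition omega_id :: "'a omega_cat \<Rightarrow> 'a \<Rightarrow> 'a" where
  "omega_id C = (\<lambda>x\<in>carrier C. x)"

definition omega_comp :: "'a omega_cat \<Rightarrow> ('b \<Rightarrow> 'c) \<Rightarrow> ('a \<Rightarrow> 'b) \<Rightarrow> 'a \<Rightarrow> 'c" where
  "omega_comp C g f = compose (carrier C) g f"

definition omega_iso :: "'a omega_cat \<Rightarrow> 'b omega_cat \<Rightarrow> ('a \<Rightarrow> 'b) \<Rightarrow> bool" where
  "omega_iso C D f \<longleftrightarrow> f \<in> omega_hom C D \<and>
     (\<exists>g\<in>omega_hom D C. omega_comp C g f = omega_id C \<and> omega_comp D f g = omega_id D)"

definition cells :: "'a omega_cat \<Rightarrow> nat \<Rightarrow> 'a set" where
  "cells C n = {x \<in> carrier C. face C Neg n x = x}"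


section \<open>Augmented directed complexes\<close>

text \<open>
  The chain groups are commutative groups of HOL-Algebra and are therefore written
  multiplicatively: \<open>\<otimes>\<close> is addition, \<open>\<one>\<close> is zero and \<open>x \<otimes> inv y\<close> is the difference \<open>x - y\<close>.
  The boundary \<open>bdry K n\<close> goes from dimension \<open>n + 1\<close> to dimension \<open>n\<close>.
\<close>

record 'k adc_data =
  chains :: "nat \<Rightarrow> 'k monoid"
  bdry   :: "nat \<Rightarrow> 'k \<Rightarrow> 'k"
  aug    :: "'k \<Rightarrow> int"
  posit  :: "nat \<Rightarrow> 'k set"

locale adc =
  fixes K :: "'k adc_data"
  assumes chains_comm_group: "comm_group (chains K n)"
    and bdry_hom: "bdry K n \<in> hom (chains K (Suc n)) (chains K n)"
    and bdry_bdry: "x \<in> carrier (chains K (Suc (Suc n))) \<Longrightarrow>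
          bdry K n (bdry K (Suc n) x) = \<one>\<^bsub>chains K n\<^esub>"
    and aug_hom: "aug K \<in> hom (chains K 0) integer_group"
    and aug_bdry: "x \<in> carrier (chains K (Suc 0)) \<Longrightarrow> aug K (bdry K 0 x) = 0"
    and posit_submonoid: "submonoid (posit K n) (chains K n)"

definition adc_hom :: "'k adc_data \<Rightarrow> 'l adc_data \<Rightarrow> (nat \<Rightarrow> 'k \<Rightarrow> 'l) set" where
  "adc_hom K L = {f.
     (\<forall>n. f n \<in> carrier (chains K n) \<rightarrow>\<^sub>E carrier (chains L n)) \<and>
     (\<forall>n. f n \<in> hom (chains K n) (chains L n)) \<and>
     (\<forall>n. \<forall>x\<in>carrier (chains K (Suc n)). f n (bdry K n x) = bdry L n (f (Suc n) x)) \<and>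
     (\<forall>x\<in>carrier (chains K 0). aug L (f 0 x) = aug K x) \<and>
     (\<forall>n. f n ` posit K n \<subseteq> posit L n)}"

definition adc_id :: "'k adc_data \<Rightarrow> nat \<Rightarrow> 'k \<Rightarrow> 'k" where
  "adc_id K = (\<lambda>n. \<lambda>x\<in>carrier (chains K n). x)"

definition adc_comp ::
    "'k adc_data \<Rightarrow> (nat \<Rightarrow> 'l \<Rightarrow> 'm) \<Rightarrow> (nat \<Rightarrow> 'k \<Rightarrow> 'l) \<Rightarrow> nat \<Rightarrow> 'k \<Rightarrow> 'm" where
  "adc_comp K g f = (\<lambda>n. compose (carrier (chains K n)) (g n) (f n))"

definition adc_iso :: "'k adc_data \<Rightarrow> 'l adc_data \<Rightarrow> (nat \<Rightarrow> 'k \<Rightarrow> 'l) \<Rightarrow> bool" where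
  "adc_iso K L f \<longleftrightarrow> f \<in> adc_hom K L \<and>
     (\<exists>g\<in>adc_hom L K. adc_comp K g f = adc_id K \<and> adc_comp L f g = adc_id L)"

inductive_set submonoid_generated :: "('a, 'b) monoid_scheme \<Rightarrow> 'a set \<Rightarrow> 'a set"
  for G and S where
    one:  "\<one>\<^bsub>G\<^esub> \<in> submonoid_generated G S"
  | incl: "s \<in> S \<Longrightarrow> s \<in> submonoid_generated G S"
  | mult: "x \<in> submonoid_generated G S \<Longrightarrow> y \<in> submonoid_generated G S \<Longrightarrow>
             x \<otimes>\<^bsub>G\<^esub> y \<in> submonoid_generated G S"

text \<open>The homomorphism from a free abelian group to \<open>G\<close> that extends \<open>f\<close> on generators.\<close>

definition free_ext :: "('g, 'r) monoid_scheme \<Rightarrow> ('a \<Rightarrow> 'g) \<Rightarrow> ('a \<Rightarrow>\<^sub>0 int) \<Rightarrow> 'g" where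
  "free_ext G f c =
     finprod G (\<lambda>x. f x [^]\<^bsub>G\<^esub> Poly_Mapping.lookup c x) (Poly_Mapping.keys c)"


section \<open>The functor \<open>\<lambda>\<close>\<close>

text \<open>
  Chains of \<open>lam C\<close> are cosets in the free abelian group on the \<open>n\<close>-cells, modulo the subgroup
  generated by the relators. A homomorphism out of \<open>lam C\<close> is specified by its effect on the
  generators \<open>[x]\<^sub>n\<close>. When the target is again a quotient, its value on a coset is
  obtained as the union of the (equal) cosets of the images of all representatives; otherwise it is
  the common value of all representatives.
\<close>

definition lam_relators :: "'a omega_cat \<Rightarrow> nat \<Rightarrow> ('a \<Rightarrow>\<^sub>0 int) set" where
  "lam_relators C n = {frag_of (cmp C m x y) - (frag_of x + frag_of y) | m x y.
     m < n \<and> x \<in> cells C n \<and> y \<in> cells C n \<and> composable C m x y}"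

definition lam_rel :: "'a omega_cat \<Rightarrow> nat \<Rightarrow> ('a \<Rightarrow>\<^sub>0 int) set" where
  "lam_rel C n = generate (free_Abelian_group (cells C n)) (lam_relators C n)"

definition lam_coset :: "'a omega_cat \<Rightarrow> nat \<Rightarrow> ('a \<Rightarrow>\<^sub>0 int) \<Rightarrow> ('a \<Rightarrow>\<^sub>0 int) set" where
  "lam_coset C n c = lam_rel C n #>\<^bsub>free_Abelian_group (cells C n)\<^esub> c"

definition lam_class :: "'a omega_cat \<Rightarrow> nat \<Rightarrow> 'a \<Rightarrow> ('a \<Rightarrow>\<^sub>0 int) set" where
  "lam_class C n x = lam_coset C n (frag_of x)"

definition lam_chains :: "'a omega_cat \<Rightarrow> nat \<Rightarrow> ('a \<Rightarrow>\<^sub>0 int) set monoid" where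
  "lam_chains C n = free_Abelian_group (cells C n) Mod lam_rel C n"

definition lam :: "'a omega_cat \<Rightarrow> ('a \<Rightarrow>\<^sub>0 int) set adc_data" where
  "lam C = \<lparr>
     chains = lam_chains C,
     bdry = (\<lambda>n X. \<Union>c\<in>X. lam_coset C n
               (frag_extend (\<lambda>x. frag_of (face C Pos n x) - frag_of (face C Neg n x)) c)),
     aug = (\<lambda>X. the_elem (free_ext integer_group (\<lambda>x. 1) ` X)),
     posit = (\<lambda>n. submonoid_generated (lam_chains C n) (lam_class C n ` cells C n))\<rparr>"

definition lam_map :: "'a omega_cat \<Rightarrow> 'b omega_cat \<Rightarrow> ('a \<Rightarrow> 'b) \<Rightarrow>
    nat \<Rightarrow> ('a \<Rightarrow>\<^sub>0 int) set \<Rightarrow> ('b \<Rightarrow>\<^sub>0 int) set" where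
  "lam_map C D f = (\<lambda>n. \<lambda>X\<in>carrier (chains (lam C) n).
     \<Union>c\<in>X. lam_coset D n (frag_extend (\<lambda>x. frag_of (f x)) c))"


section \<open>The functor \<open>\<nu>\<close>\<close>

text \<open>\<open>mu\<close> uses only the chain complex underlying its argument.\<close>

definition mu :: "'k adc_data \<Rightarrow> (sign \<Rightarrow> nat \<Rightarrow> 'k) omega_cat" where
  "mu K = \<lparr>
     carrier = {x. (\<forall>\<alpha> n. x \<alpha> n \<in> carrier (chains K n)) \<and>
                   finite {n. \<exists>\<alpha>. x \<alpha> n \<noteq> \<one>\<^bsub>chains K n\<^esub>} \<and>
                   (\<forall>n \<alpha>. x Pos n \<otimes>\<^bsub>chains K n\<^esub> inv\<^bsub>chains K n\<^esub> (x Neg n) =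
                           bdry K n (x \<alpha> (Suc n)))},
     face = (\<lambda>\<alpha> n x \<beta> i. if i < n then x \<beta> i else if i = n then x \<alpha> n else \<one>\<^bsub>chains K i\<^esub>),
     cmp = (\<lambda>n x y \<beta> i.
              let z = (\<lambda>\<beta> i. if i < n then x \<beta> i
                               else if i = n then x Pos n else \<one>\<^bsub>chains K i\<^esub>)
              in x \<beta> i \<otimes>\<^bsub>chains K i\<^esub> inv\<^bsub>chains K i\<^esub> (z \<beta> i) \<otimes>\<^bsub>chains K i\<^esub> y \<beta> i)\<rparr>"

definition nu :: "'k adc_data \<Rightarrow> (sign \<Rightarrow> nat \<Rightarrow> 'k) omega_cat" where
  "nu K = (mu K)\<lparr>carrier :=
     {x \<in> carrier (mu K). (\<forall>\<alpha> n. x \<alpha> n \<in> posit K n) \<and> (\<forall>\<alpha>. aug K (x \<alpha> 0) = 1)}\<rparr>"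

definition nu_map :: "'k adc_data \<Rightarrow> (nat \<Rightarrow> 'k \<Rightarrow> 'l) \<Rightarrow>
    (sign \<Rightarrow> nat \<Rightarrow> 'k) \<Rightarrow> (sign \<Rightarrow> nat \<Rightarrow> 'l)" where
  "nu_map K f = (\<lambda>x\<in>carrier (nu K). \<lambda>\<alpha> n. f n (x \<alpha> n))"


section \<open>Unit and counit\<close>

definition unit_eta :: "'a omega_cat \<Rightarrow> 'a \<Rightarrow> sign \<Rightarrow> nat \<Rightarrow> ('a \<Rightarrow>\<^sub>0 int) set" where
  "unit_eta C = (\<lambda>x\<in>carrier C. \<lambda>\<alpha> n. lam_class C n (face C \<alpha> n x))"

definition counit_pi ::
    "'k adc_data \<Rightarrow> nat \<Rightarrow> ((sign \<Rightarrow> nat \<Rightarrow> 'k) \<Rightarrow>\<^sub>0 int) set \<Rightarrow> 'k" where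
  "counit_pi K = (\<lambda>n. \<lambda>X\<in>carrier (chains (lam (nu K)) n).
     the_elem (free_ext (chains K n) (\<lambda>x. x Neg n) ` X))"


section \<open>Bases for augmented directed complexes\<close>

text \<open>A graded subset of the chains is a set of pairs (dimension, chain).\<close>

definition in_dim :: "(nat \<times> 'k) set \<Rightarrow> nat \<Rightarrow> 'k set" where
  "in_dim B n = {b. (n, b) \<in> B}"

definition free_abelian_on :: "('g, 'r) monoid_scheme \<Rightarrow> 'g set \<Rightarrow> bool" where
  "free_abelian_on G S \<longleftrightarrow> comm_group G \<and> S \<subseteq> carrier G \<and>
     free_ext G (\<lambda>b. b) \<in> iso (free_Abelian_group S) G"

definition adc_basis :: "'k adc_data \<Rightarrow> (nat \<times> 'k) set \<Rightarrow> bool" where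
  "adc_basis K B \<longleftrightarrow> (\<forall>n. free_abelian_on (chains K n) (in_dim B n) \<and>
     posit K n = submonoid_generated (chains K n) (in_dim B n))"

definition chain_order :: "'k adc_data \<Rightarrow> nat \<Rightarrow> 'k gorder" where
  "chain_order K n = \<lparr>carrier = carrier (chains K n), eq = (=),
     le = (\<lambda>x y. y \<otimes>\<^bsub>chains K n\<^esub> inv\<^bsub>chains K n\<^esub> x \<in> posit K n)\<rparr>"

text \<open>For a chain \<open>x\<close> of dimension \<open>n + 1\<close>, the pair \<open>(\<partial>\<^sup>- x, \<partial>\<^sup>+ x)\<close> in dimension \<open>n\<close>.\<close>

definition bdry_parts :: "'k adc_data \<Rightarrow> nat \<Rightarrow> 'k \<Rightarrow> 'k \<times> 'k" where
  "bdry_parts K n x = (THE (p, q).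
     p \<in> carrier (chains K n) \<and> q \<in> carrier (chains K n) \<and>
     bdry K n x = q \<otimes>\<^bsub>chains K n\<^esub> inv\<^bsub>chains K n\<^esub> p \<and>
     p \<sqinter>\<^bsub>chain_order K n\<^esub> q = \<one>\<^bsub>chains K n\<^esub>)"

definition sbdry :: "'k adc_data \<Rightarrow> sign \<Rightarrow> nat \<Rightarrow> 'k \<Rightarrow> 'k" where
  "sbdry K \<alpha> n x = (case \<alpha> of Neg \<Rightarrow> fst (bdry_parts K n x) | Pos \<Rightarrow> snd (bdry_parts K n x))"

function atom :: "'k adc_data \<Rightarrow> nat \<times> 'k \<Rightarrow> sign \<Rightarrow> nat \<Rightarrow> 'k" where
  "atom K (p, b) \<alpha> n =
     (if n > p then \<one>\<^bsub>chains K n\<^esub> else if n = p then b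
      else sbdry K \<alpha> n (atom K (p, b) \<alpha> (Suc n)))"
  by pat_completeness auto
termination by (relation "measure (\<lambda>(K, (p, b), \<alpha>, n). p - n)") auto
declare atom.simps [simp del]

definition unital :: "'k adc_data \<Rightarrow> (nat \<times> 'k) set \<Rightarrow> bool" where
  "unital K B \<longleftrightarrow> (\<forall>b\<in>B. \<forall>\<alpha>. aug K (atom K b \<alpha> 0) = 1)"

definition loop_free :: "'k adc_data \<Rightarrow> (nat \<times> 'k) set \<Rightarrow> bool" where
  "loop_free K B \<longleftrightarrow> (\<exists>R :: nat \<Rightarrow> (nat \<times> 'k) rel. \<forall>n. partial_order_on B (R n) \<and>
     (\<forall>a\<in>B. \<forall>b\<in>B. fst a > n \<and> fst b > n \<and>
        \<one>\<^bsub>chains K n\<^esub> \<sqsubset>\<^bsub>chain_order K n\<^esub>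
          (atom K a Pos n \<sqinter>\<^bsub>chain_order K n\<^esub> atom K b Neg n)
        \<longrightarrow> (a, b) \<in> R n \<and> a \<noteq> b))"

text \<open>
  The comparison \<open>a \<le> \<partial>\<^sup>- b\<close> presupposes \<open>|b| = |a| + 1\<close>, and \<open>\<partial>\<^sup>+ a \<ge> b\<close> presupposes
  \<open>|a| = |b| + 1\<close>.
\<close>

definition strongly_loop_free :: "'k adc_data \<Rightarrow> (nat \<times> 'k) set \<Rightarrow> bool" where
  "strongly_loop_free K B \<longleftrightarrow> (\<exists>R :: (nat \<times> 'k) rel. partial_order_on B R \<and>
     (\<forall>p a q b. (p, a) \<in> B \<and> (q, b) \<in> B \<and>
        (q = Suc p \<and> a \<sqsubseteq>\<^bsub>chain_order K p\<^esub> sbdry K Neg p b \<or>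
         p = Suc q \<and> b \<sqsubseteq>\<^bsub>chain_order K q\<^esub> sbdry K Pos q a)
        \<longrightarrow> ((p, a), (q, b)) \<in> R \<and> (p, a) \<noteq> (q, b)))"

definition adc_loop_free_unital :: "'k adc_data \<Rightarrow> bool" where
  "adc_loop_free_unital K \<longleftrightarrow>
     adc K \<and> (\<exists>B. adc_basis K B \<and> unital K B \<and> loop_free K B)"

definition adc_strongly_loop_free_unital :: "'k adc_data \<Rightarrow> bool" where
  "adc_strongly_loop_free_unital K \<longleftrightarrow>
     adc K \<and> (\<exists>B. adc_basis K B \<and> unital K B \<and> strongly_loop_free K B)"


section \<open>Bases for \<open>\<omega>\<close>-categories\<close>

inductive_set cmp_closure :: "'a omega_cat \<Rightarrow> 'a set \<Rightarrow> 'a set"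
  for C and S where
    incl: "x \<in> S \<Longrightarrow> x \<in> cmp_closure C S"
  | cmp: "x \<in> cmp_closure C S \<Longrightarrow> y \<in> cmp_closure C S \<Longrightarrow> composable C m x y \<Longrightarrow>
            cmp C m x y \<in> cmp_closure C S"

definition composition_generated :: "'a omega_cat \<Rightarrow> 'a set \<Rightarrow> ('a \<Rightarrow> nat) \<Rightarrow> bool" where
  "composition_generated C E dm \<longleftrightarrow> E \<subseteq> carrier C \<and>
     (\<forall>n. cells C n = cmp_closure C {e \<in> E. dm e \<le> n})"

definition basis_class :: "'a omega_cat \<Rightarrow> ('a \<Rightarrow> nat) \<Rightarrow> 'a \<Rightarrow> nat \<times> ('a \<Rightarrow>\<^sub>0 int) set" where
  "basis_class C dm e = (dm e, lam_class C (dm e) e)"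

text \<open>
  The assignment of dimensions \<open>dm\<close> is part of the data of a basis \<open>E\<close>, and \<open>B\<close> is the basis of
  \<open>lam C\<close> with which \<open>E\<close> is in bijection.
\<close>

definition omega_basis ::
    "'a omega_cat \<Rightarrow> 'a set \<Rightarrow> ('a \<Rightarrow> nat) \<Rightarrow> (nat \<times> ('a \<Rightarrow>\<^sub>0 int) set) set \<Rightarrow> bool" where
  "omega_basis C E dm B \<longleftrightarrow> composition_generated C E dm \<and>
     adc_basis (lam C) B \<and> bij_betw (basis_class C dm) E B"

definition atomic :: "'a omega_cat \<Rightarrow> 'a set \<Rightarrow> ('a \<Rightarrow> nat) \<Rightarrow> bool" where
  "atomic C E dm \<longleftrightarrow> (\<forall>e\<in>E. \<forall>n < dm e.
     lam_class C n (face C Neg n e) \<sqinter>\<^bsub>chain_order (lam C) n\<^esub> lam_class C n (face C Pos n e)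
       = \<one>\<^bsub>chains (lam C) n\<^esub>)"

definition omega_loop_free_atomic :: "'a omega_cat \<Rightarrow> bool" where
  "omega_loop_free_atomic C \<longleftrightarrow> omega_category C \<and>
     (\<exists>E dm B. omega_basis C E dm B \<and> atomic C E dm \<and> loop_free (lam C) B)"

definition omega_strongly_loop_free_atomic :: "'a omega_cat \<Rightarrow> bool" where
  "omega_strongly_loop_free_atomic C \<longleftrightarrow> omega_category C \<and>
     (\<exists>E dm B. omega_basis C E dm B \<and> atomic C E dm \<and> strongly_loop_free (lam C) B)"

end

theory Submission
  imports Defs
begin

text \<open>
  The adjunction is formal, so the content lies in the two statements about loop-free bases.

  Let \<open>K\<close> have a loop-free unital basis and write \<open>s \<rightarrow> t\<close> if \<open>\<langle>s\<rangle>\<^sup>+\<close> and \<open>\<langle>t\<rangle>\<^sup>-\<close> have a common basis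
  element in dimension \<open>r\<close>. If a cell \<open>x\<close> of \<open>\<nu> K\<close> is a sum of atoms \<open>\<langle>s\<rangle>\<close>, \<open>s \<in> S\<close>, above
  dimension \<open>r\<close>, then every subset of \<open>S\<close> that is closed under predecessors for \<open>\<rightarrow>\<close> is cut off by a
  factorisation \<open>x = u #\<^sub>r v\<close>. Cutting shows that no coordinate of a cell exceeds 1, and even that
  the coordinates of \<open>x\<^sup>-\<^sub>r\<close> plus the sum of the \<open>\<langle>s\<rangle>\<^sup>+\<^sub>r\<close> do not exceed 1. Hence, conversely,
  every factorisation of \<open>x\<close> in a dimension at most \<open>r\<close> distributes \<open>S\<close> over its factors. Lowering
  \<open>r\<close> step by step exhibits every cell of \<open>\<nu> K\<close> as a composite of atoms, and this makes the counit
  invertible.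

  Let \<open>C\<close> have a loop-free atomic basis. A cell whose image in \<open>\<nu> (\<lambda> C)\<close> has at most one
  atom above dimension \<open>r + 1\<close> is a composite \<open>#\<^sub>r\<close> of cells with at most one atom above
  dimension \<open>r\<close>. Consecutive factors belonging to \<open>s\<close> and \<open>t\<close> can be exchanged unless \<open>s \<rightarrow> t\<close>,
  because both orders arise by interchange from one composite \<open>#\<^bsub>r-1\<^esub>\<close>. So the factors can be brought
  into an order that depends only on the image of the cell, and induction on \<open>r\<close> shows that the unit is
  injective. It is surjective because \<open>\<nu> (\<lambda> C)\<close> is generated by atoms.
\<close>


section \<open>Homomorphisms out of free abelian groups\<close>

text \<open>The bound 1 on coordinates originates in dimension 0: every basis element there has
  augmentation 1, so the coordinates in dimension 0 of a cell add up to 1. Cutting carries the bound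
  upwards one dimension at a time. The restriction to at most one atom has a definite reason.
  Lowering \<open>r\<close> turns the coordinates of dimension \<open>r\<close> that the atoms do
  not explain into new atoms, and these coordinates are nonnegative once no two atoms are joined by
  an arrow. A single atom has no arrow to itself, since arrows are strict in the loop-free order;
  several atoms are first separated by cuts. The obstacle in \<open>C\<close> is that equality of
  cells is not visible in coordinates until the unit is injective, whereas exchanging two factors
  already requires recognising some cells as faces of others. So injectivity
  (\<open>inj_level\<close>) and exchange (\<open>swap_level\<close>) are proved together: both at
  \<open>k\<close> give injectivity at \<open>k + 1\<close>, and this with exchange at
  \<open>k\<close> gives exchange at \<open>k + 1\<close>. The cells to be recognised are
  \<open>(k + 1)\<close>-cells, which have no atoms above \<open>k + 1\<close>, so that injectivity
  at \<open>k + 1\<close> covers them.\<close>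

lemma free_ext_superset:
  assumes "comm_group G" "finite T" "Poly_Mapping.keys c \<subseteq> T" "f ` T \<subseteq> carrier G"
  shows "free_ext G f c = finprod G (\<lambda>x. f x [^]\<^bsub>G\<^esub> Poly_Mapping.lookup c x) T"
proof -
  interpret comm_group G by fact
  show ?thesis
    unfolding free_ext_def
    by (rule finprod_mono_neutral_cong_left)
      (use assms in \<open>auto simp: in_keys_iff\<close>)
qed

lemma free_ext_hom:
  assumes G: "comm_group G" and f: "f ` S \<subseteq> carrier G"
  shows "free_ext G f \<in> hom (free_Abelian_group S) G"
proof (rule homI)
  interpret comm_group G by fact
  fix a assume "a \<in> carrier (free_Abelian_group S)"
  then show "free_ext G f a \<in> carrier G"
    unfolding free_ext_def using f by (auto intro!: finprod_closed)
  fix b assume "b \<in> carrier (free_Abelian_group S)"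
  with \<open>a \<in> carrier (free_Abelian_group S)\<close>
  have a: "Poly_Mapping.keys a \<subseteq> S" and b: "Poly_Mapping.keys b \<subseteq> S" by auto
  \<comment> \<open>Cancellation can make the support of \<open>a + b\<close> smaller than those of
    \<open>a\<close> and \<open>b\<close>; all three products are therefore taken over the common
    index set \<open>T\<close>, where missing keys contribute a zeroth power.\<close>
  define T where "T = Poly_Mapping.keys a \<union> Poly_Mapping.keys b"
  have T: "finite T" "Poly_Mapping.keys a \<subseteq> T" "Poly_Mapping.keys b \<subseteq> T" "f ` T \<subseteq> carrier G"
    using a b f by (auto simp: T_def)
  have ab: "Poly_Mapping.keys (a + b) \<subseteq> T"
    unfolding T_def by (rule keys_add)
  have "free_ext G f (a + b) = (\<Otimes>\<^bsub>G\<^esub>x\<in>T. f x [^]\<^bsub>G\<^esub> Poly_Mapping.lookup (a + b) x)"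
    by (rule free_ext_superset[OF G T(1) ab T(4)])
  also have "\<dots> = (\<Otimes>\<^bsub>G\<^esub>x\<in>T. f x [^]\<^bsub>G\<^esub> Poly_Mapping.lookup a x \<otimes>\<^bsub>G\<^esub> f x [^]\<^bsub>G\<^esub> Poly_Mapping.lookup b x)"
    by (rule finprod_cong') (use T in \<open>auto simp: lookup_add int_pow_mult image_subset_iff\<close>)
  also have "\<dots> = free_ext G f a \<otimes>\<^bsub>G\<^esub> free_ext G f b"
    using T by (subst finprod_multf) (auto simp: free_ext_superset[OF G T(1) _ T(4)])
  finally show "free_ext G f (a \<otimes>\<^bsub>free_Abelian_group S\<^esub> b) = free_ext G f a \<otimes>\<^bsub>G\<^esub> free_ext G f b"
    by simp
qed

lemma free_ext_frag_of [simp]: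
  assumes "comm_group G" "f x \<in> carrier G"
  shows "free_ext G f (frag_of x) = f x"
proof -
  interpret comm_group G by fact
  show ?thesis using assms(2) by (simp add: free_ext_def)
qed

lemma hom_frag_eqI:
  assumes h: "h \<in> hom (free_Abelian_group S) G" and k: "k \<in> hom (free_Abelian_group S) G"
    and G: "group G" and eq: "\<And>x. x \<in> S \<Longrightarrow> h (frag_of x) = k (frag_of x)"
    and c: "Poly_Mapping.keys c \<subseteq> S"
  shows "h c = k c"
proof -
  interpret h: group_hom "free_Abelian_group S" G h
    using h G by (simp add: group_hom_def group_hom_axioms_def)
  interpret k: group_hom "free_Abelian_group S" G k
    using k G by (simp add: group_hom_def group_hom_axioms_def)
  have diff: "h (x - y) = h x \<otimes>\<^bsub>G\<^esub> inv\<^bsub>G\<^esub> h y" "k (x - y) = k x \<otimes>\<^bsub>G\<^esub> inv\<^bsub>G\<^esub> k y"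
    if "Poly_Mapping.keys x \<subseteq> S" "Poly_Mapping.keys y \<subseteq> S" for x y
    using that h.hom_mult[of x "-y"] h.hom_inv[of y] k.hom_mult[of x "-y"] k.hom_inv[of y] by auto
  show ?thesis
  proof (rule free_Abelian_group_induct[OF c])
    show "h 0 = k 0" using h.hom_one k.hom_one by simp
  qed (simp_all add: diff eq)
qed

lemma frag_extend_hom:
  assumes "\<And>x. x \<in> S \<Longrightarrow> Poly_Mapping.keys (h x) \<subseteq> T"
  shows "frag_extend h \<in> hom (free_Abelian_group S) (free_Abelian_group T)"
proof (rule homI)
  show "frag_extend h a \<in> carrier (free_Abelian_group T)" if "a \<in> carrier (free_Abelian_group S)" for a
    using that assms keys_frag_extend[of h a] by fastforce
qed (simp add: frag_extend_add)

lemma submonoid_generated_is_submonoid: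
  assumes "comm_group G" "S \<subseteq> carrier G"
  shows "submonoid (submonoid_generated G S) G"
proof -
  interpret comm_group G by fact
  have "x \<in> carrier G" if "x \<in> submonoid_generated G S" for x
    using that by induction (use assms(2) in auto)
  then show ?thesis
    by (auto simp: submonoid_def intro: submonoid_generated.intros)
qed

lemma submonoid_generated_image:
  assumes f: "f \<in> hom G H" and G: "group G" and H: "group H" and S: "S \<subseteq> carrier G"
  shows "f ` submonoid_generated G S = submonoid_generated H (f ` S)"
proof -
  interpret group_hom G H f
    using f G H by (simp add: group_hom_def group_hom_axioms_def)
  have mem: "x \<in> carrier G" if "x \<in> submonoid_generated G S" for x
    using that by induction (use S in auto)
  have "f x \<in> submonoid_generated H (f ` S)" if "x \<in> submonoid_generated G S" for x
    using that
  proof induction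
    case one then show ?case using submonoid_generated.one[of H] by simp
  next
    case (mult x y) then show ?case using mem by (simp add: submonoid_generated.mult)
  qed (auto intro: submonoid_generated.incl)
  moreover have "y \<in> f ` submonoid_generated G S" if "y \<in> submonoid_generated H (f ` S)" for y
    using that
  proof induction
    case one then show ?case using submonoid_generated.one[of G S] hom_one by (metis image_eqI)
  next
    case (mult x y) then show ?case using mem
      by (smt (verit) hom_mult image_iff submonoid_generated.mult)
  qed (auto intro: submonoid_generated.incl)
  ultimately show ?thesis by blast
qed


section \<open>Cells of an \<open>\<omega>\<close>-category\<close>

context omega_category
begin

lemma cells_carrier: "x \<in> cells C n \<Longrightarrow> x \<in> carrier C"
  by (simp add: cells_def)

lemma face_cells: "x \<in> carrier C \<Longrightarrow> face C \<alpha> n x \<in> cells C n"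
  by (simp add: cells_def face_closed face_face)

lemma face_of_cell: "x \<in> cells C n \<Longrightarrow> n \<le> m \<Longrightarrow> face C \<alpha> m x = x"
  using face_face[of x \<alpha> m Neg n] by (simp add: cells_def)

lemma cells_mono: "n \<le> m \<Longrightarrow> x \<in> cells C n \<Longrightarrow> x \<in> cells C m"
  using face_of_cell[of x n m Neg] by (simp add: cells_def)

lemma ex_cells: "x \<in> carrier C \<Longrightarrow> \<exists>n. x \<in> cells C n"
  using finite_dim by (auto simp: cells_def)

lemma composable_carrier:
  "composable C n x y \<Longrightarrow> x \<in> carrier C" "composable C n x y \<Longrightarrow> y \<in> carrier C"
  by (auto simp: composable_def)

lemma cmp_cell_right: "composable C m x y \<Longrightarrow> y \<in> cells C m \<Longrightarrow> cmp C m x y = x"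
  by (metis cmp_unit_right composable_def face_of_cell order_refl)

lemma cmp_cell_left: "composable C m x y \<Longrightarrow> x \<in> cells C m \<Longrightarrow> cmp C m x y = y"
  by (metis cmp_unit_left composable_def face_of_cell order_refl)

lemma cmp_cells:
  assumes "x \<in> cells C n" "y \<in> cells C n" "composable C m x y"
  shows "cmp C m x y \<in> cells C n"
proof (cases "m < n")
  case True
  then show ?thesis
    using assms cmp_closed[of m x y] face_cmp_greater[of m x y n Neg] by (simp add: cells_def)
next
  \<comment> \<open>For \<open>n \<le> m\<close> both cells are identities for \<open>#_m\<close>,
    so the composite is one of the factors.\<close>
  case False
  then show ?thesis
    using assms cells_mono[of n m] cmp_cell_right[of m x y] by simp
qed

lemma composable_face_less:
  assumes "composable C m x y" "m < n"
  shows "composable C m (face C \<alpha> n x) (face C \<alpha> n y)"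
  using assms by (auto simp: composable_def face_closed face_face)

end


section \<open>The groups of \<open>\<lambda>\<close>\<close>

context omega_category
begin

abbreviation free_cells :: "nat \<Rightarrow> ('a \<Rightarrow>\<^sub>0 int) monoid" where
  "free_cells n \<equiv> free_Abelian_group (cells C n)"

lemma lam_relators_carrier: "lam_relators C n \<subseteq> carrier (free_cells n)"
proof
  fix r assume "r \<in> lam_relators C n"
  then obtain m x y where r: "r = frag_of (cmp C m x y) - (frag_of x + frag_of y)"
    "m < n" "x \<in> cells C n" "y \<in> cells C n" "composable C m x y"
    by (auto simp: lam_relators_def)
  then show "r \<in> carrier (free_cells n)"
    using cmp_cells[of x n y m] keys_diff[of "frag_of (cmp C m x y)" "frag_of x + frag_of y"]
      keys_add[of "frag_of x" "frag_of y"]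
    by auto
qed

lemma lam_rel_normal: "lam_rel C n \<lhd> free_cells n"
  unfolding lam_rel_def
  using group.generate_is_subgroup[OF group_free_Abelian_group lam_relators_carrier]
    comm_group.subgroup_imp_normal abelian_free_Abelian_group by blast

lemma lam_rel_subgroup: "subgroup (lam_rel C n) (free_cells n)"
  using lam_rel_normal normal_imp_subgroup by blast

lemma lam_chains_comm_group: "comm_group (lam_chains C n)"
  unfolding lam_chains_def
  using comm_group.abelian_FactGroup[OF abelian_free_Abelian_group lam_rel_subgroup] .

lemma lam_coset_hom: "lam_coset C n \<in> hom (free_cells n) (lam_chains C n)"
  using normal.r_coset_hom_Mod[OF lam_rel_normal[of n]]
  unfolding lam_chains_def lam_coset_def[abs_def] .

lemma lam_coset_closed: "Poly_Mapping.keys c \<subseteq> cells C n \<Longrightarrow> lam_coset C n c \<in> carrier (lam_chains C n)"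
  using lam_coset_hom[of n] by (auto simp: hom_def)

lemma lam_chains_cases:
  assumes "X \<in> carrier (lam_chains C n)"
  obtains c where "Poly_Mapping.keys c \<subseteq> cells C n" "X = lam_coset C n c"
  using assms unfolding lam_chains_def carrier_FactGroup lam_coset_def by auto

lemma lam_coset_self: "Poly_Mapping.keys c \<subseteq> cells C n \<Longrightarrow> c \<in> lam_coset C n c"
  unfolding lam_coset_def
  using group.rcos_self[OF group_free_Abelian_group _ lam_rel_subgroup] by simp

lemma lam_class_closed: "x \<in> cells C n \<Longrightarrow> lam_class C n x \<in> carrier (lam_chains C n)"
  unfolding lam_class_def by (rule lam_coset_closed) simp

text \<open>The condition \<open>rel\<close> puts every relator into the kernel of \<open>h\<close>,
  hence also the subgroup generated by the relators.\<close>

lemma lam_coset_const: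
  assumes h: "h \<in> hom (free_cells n) G" and G: "group G"
    and rel: "\<And>m x y. m < n \<Longrightarrow> x \<in> cells C n \<Longrightarrow> y \<in> cells C n \<Longrightarrow> composable C m x y \<Longrightarrow>
        h (frag_of (cmp C m x y)) = h (frag_of x) \<otimes>\<^bsub>G\<^esub> h (frag_of y)"
    and c: "Poly_Mapping.keys c \<subseteq> cells C n" and c': "c' \<in> lam_coset C n c"
  shows "h c' = h c"
proof -
  interpret group_hom "free_cells n" G h
    using h G by (simp add: group_hom_def group_hom_axioms_def)
  have "h r = \<one>\<^bsub>G\<^esub>" if "r \<in> lam_relators C n" for r
  proof -
    from that obtain m x y where r: "r = frag_of (cmp C m x y) - (frag_of x + frag_of y)"
      "m < n" "x \<in> cells C n" "y \<in> cells C n" "composable C m x y"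
      by (auto simp: lam_relators_def)
    have "Poly_Mapping.keys r \<subseteq> cells C n"
      using subsetD[OF lam_relators_carrier that] by simp
    then have "h (r + (frag_of x + frag_of y)) = h r \<otimes>\<^bsub>G\<^esub> h (frag_of x + frag_of y)"
      using r hom_mult[of r "frag_of x + frag_of y"] keys_add[of "frag_of x" "frag_of y"] by force
    moreover have "h (frag_of x + frag_of y) = h (frag_of x) \<otimes>\<^bsub>G\<^esub> h (frag_of y)"
      using r hom_mult[of "frag_of x" "frag_of y"] by simp
    moreover have "r + (frag_of x + frag_of y) = frag_of (cmp C m x y)"
      by (simp add: r)
    moreover have "h (frag_of x) \<in> carrier G" "h (frag_of y) \<in> carrier G" "h r \<in> carrier G"
      using r \<open>Poly_Mapping.keys r \<subseteq> cells C n\<close> by auto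
    ultimately show ?thesis
      using rel[OF r(2-5)] H.r_cancel_one'[of "h (frag_of x) \<otimes>\<^bsub>G\<^esub> h (frag_of y)" "h r"] by simp
  qed
  then have "lam_relators C n \<subseteq> kernel (free_cells n) G h"
    using lam_relators_carrier[of n] unfolding kernel_def by blast
  then have "lam_rel C n \<subseteq> kernel (free_cells n) G h"
    unfolding lam_rel_def
    by (rule G.generate_subgroup_incl) (rule subgroup_kernel)
  then obtain r where r: "r \<in> kernel (free_cells n) G h" "c' = r + c"
    using c' by (auto simp: lam_coset_def r_coset_def)
  then show ?thesis
    using c hom_mult[of r c] by (auto simp: kernel_def)
qed

text \<open>The singleton form matches the definitions of \<open>lam\<close>, \<open>lam_map\<close>
  and \<open>counit_pi\<close>, which send a coset to the union or to \<open>the_elem\<close> of the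
  image of all its representatives.\<close>

lemma lam_image_coset:
  assumes h: "h \<in> hom (free_cells n) G" and G: "group G"
    and rel: "\<And>m x y. m < n \<Longrightarrow> x \<in> cells C n \<Longrightarrow> y \<in> cells C n \<Longrightarrow> composable C m x y \<Longrightarrow>
        h (frag_of (cmp C m x y)) = h (frag_of x) \<otimes>\<^bsub>G\<^esub> h (frag_of y)"
    and c: "Poly_Mapping.keys c \<subseteq> cells C n"
  shows "h ` lam_coset C n c = {h c}"
  using lam_coset_const[OF h G rel c] lam_coset_self[OF c] by blast

lemma lam_class_cmp:
  assumes "m < n" "x \<in> cells C n" "y \<in> cells C n" "composable C m x y"
  shows "lam_class C n (cmp C m x y) = lam_class C n x \<otimes>\<^bsub>lam_chains C n\<^esub> lam_class C n y"
proof -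
  interpret comm_group "lam_chains C n" by (rule lam_chains_comm_group)
  interpret group_hom "free_cells n" "lam_chains C n" "lam_coset C n"
    using lam_coset_hom is_group by (simp add: group_hom_def group_hom_axioms_def)
  define r where "r = frag_of (cmp C m x y) - (frag_of x + frag_of y)"
  have "r \<in> lam_relators C n"
    unfolding lam_relators_def r_def using assms by blast
  then have r: "r \<in> lam_rel C n" "r \<in> carrier (free_cells n)"
    unfolding lam_rel_def by (rule generate.incl, rule subsetD[OF lam_relators_carrier])
  have xy: "frag_of x + frag_of y \<in> carrier (free_cells n)"
    using assms keys_add[of "frag_of x" "frag_of y"] by auto
  have "lam_coset C n r = \<one>\<^bsub>lam_chains C n\<^esub>"
    unfolding lam_coset_def lam_chains_def one_FactGroup
    by (rule group.coset_join2[OF group_free_Abelian_group r(2) lam_rel_subgroup r(1)])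
  moreover have "lam_coset C n (r + (frag_of x + frag_of y)) =
      lam_coset C n r \<otimes>\<^bsub>lam_chains C n\<^esub> lam_coset C n (frag_of x + frag_of y)"
    using hom_mult[of r "frag_of x + frag_of y"] r xy by simp
  moreover have "lam_coset C n (frag_of x + frag_of y) =
      lam_coset C n (frag_of x) \<otimes>\<^bsub>lam_chains C n\<^esub> lam_coset C n (frag_of y)"
    using hom_mult[of "frag_of x" "frag_of y"] assms by simp
  moreover have "r + (frag_of x + frag_of y) = frag_of (cmp C m x y)"
    by (simp add: r_def)
  ultimately show ?thesis
    using assms lam_class_closed[of _ n] by (simp add: lam_class_def)
qed

lemma lam_hom_induced:
  assumes h: "h \<in> hom (free_cells n) G"
    and k: "\<And>c. Poly_Mapping.keys c \<subseteq> cells C n \<Longrightarrow> k (lam_coset C n c) = h c"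
  shows "k \<in> hom (lam_chains C n) G"
proof (rule homI)
  fix X assume "X \<in> carrier (lam_chains C n)"
  then obtain c where c: "Poly_Mapping.keys c \<subseteq> cells C n" "X = lam_coset C n c"
    by (rule lam_chains_cases)
  then show "k X \<in> carrier G" using k h by (auto simp: hom_def)
  fix Y assume "Y \<in> carrier (lam_chains C n)"
  then obtain d where d: "Poly_Mapping.keys d \<subseteq> cells C n" "Y = lam_coset C n d"
    by (rule lam_chains_cases)
  have "X \<otimes>\<^bsub>lam_chains C n\<^esub> Y = lam_coset C n (c + d)"
    using lam_coset_hom[of n] c d by (auto simp: hom_def)
  then show "k (X \<otimes>\<^bsub>lam_chains C n\<^esub> Y) = k X \<otimes>\<^bsub>G\<^esub> k Y"
    using k[of "c + d"] k[OF c(1)] k[OF d(1)] c d order_trans[OF keys_add[of c d]] hom_mult[OF h, of c d] by simp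
qed

lemma lam_hom_eqI:
  assumes h: "h \<in> hom (lam_chains C n) G" and k: "k \<in> hom (lam_chains C n) G" and G: "group G"
    and eq: "\<And>x. x \<in> cells C n \<Longrightarrow> h (lam_class C n x) = k (lam_class C n x)"
    and X: "X \<in> carrier (lam_chains C n)"
  shows "h X = k X"
proof -
  obtain c where c: "Poly_Mapping.keys c \<subseteq> cells C n" "X = lam_coset C n c"
    using X by (rule lam_chains_cases)
  have "(h \<circ> lam_coset C n) c = (k \<circ> lam_coset C n) c"
    using hom_compose[OF lam_coset_hom h] hom_compose[OF lam_coset_hom k] G _ c(1)
    by (rule hom_frag_eqI) (simp add: eq[unfolded lam_class_def])
  then show ?thesis by (simp add: c)
qed

end


section \<open>Morphisms\<close>

lemma omega_homD:
  assumes "f \<in> omega_hom C D"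
  shows "x \<in> carrier C \<Longrightarrow> f x \<in> carrier D"
    and "x \<in> carrier C \<Longrightarrow> f (face C \<alpha> n x) = face D \<alpha> n (f x)"
    and "composable C n x y \<Longrightarrow> f (cmp C n x y) = cmp D n (f x) (f y)"
    and "composable C n x y \<Longrightarrow> composable D n (f x) (f y)"
    and "x \<in> cells C n \<Longrightarrow> f x \<in> cells D n"
    and "f \<in> extensional (carrier C)"
proof -
  have f: "f \<in> extensional (carrier C)" "\<And>x. x \<in> carrier C \<Longrightarrow> f x \<in> carrier D"
    "\<And>x \<alpha> n. x \<in> carrier C \<Longrightarrow> f (face C \<alpha> n x) = face D \<alpha> n (f x)"
    "\<And>n x y. composable C n x y \<Longrightarrow> f (cmp C n x y) = cmp D n (f x) (f y)"
    using assms by (auto simp: omega_hom_def PiE_def)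
  show "x \<in> carrier C \<Longrightarrow> f x \<in> carrier D" "f \<in> extensional (carrier C)"
    "x \<in> carrier C \<Longrightarrow> f (face C \<alpha> n x) = face D \<alpha> n (f x)"
    "composable C n x y \<Longrightarrow> f (cmp C n x y) = cmp D n (f x) (f y)"
    by (fact f)+
  show "composable C n x y \<Longrightarrow> composable D n (f x) (f y)"
    unfolding composable_def by (metis f(2,3))
  show "x \<in> cells C n \<Longrightarrow> f x \<in> cells D n"
    unfolding cells_def mem_Collect_eq by (metis f(2,3))
qed

lemma omega_hom_comp:
  assumes C: "omega_category C" and f: "f \<in> omega_hom C D" and g: "g \<in> omega_hom D E"
  shows "omega_comp C g f \<in> omega_hom C E"
proof -
  interpret C: omega_category C by fact
  show ?thesis
    unfolding omega_hom_def omega_comp_def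
    using omega_homD(1-4)[OF f] omega_homD(1-4)[OF g]
    by (auto simp: compose_def composable_def C.face_closed C.cmp_closed)
qed

lemma adc_homD:
  assumes "f \<in> adc_hom K L"
  shows "f n \<in> hom (chains K n) (chains L n)"
    and "x \<in> carrier (chains K n) \<Longrightarrow> f n x \<in> carrier (chains L n)"
    and "x \<in> carrier (chains K (Suc n)) \<Longrightarrow> f n (bdry K n x) = bdry L n (f (Suc n) x)"
    and "x \<in> carrier (chains K 0) \<Longrightarrow> aug L (f 0 x) = aug K x"
    and "x \<in> posit K n \<Longrightarrow> f n x \<in> posit L n"
    and "f n \<in> extensional (carrier (chains K n))"
  using assms by (auto simp: adc_hom_def PiE_def image_subset_iff)
context adc
begin

sublocale G: comm_group "chains K n" for n
  by (rule chains_comm_group)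

sublocale D: group_hom "chains K (Suc n)" "chains K n" "bdry K n" for n
  using bdry_hom by (simp add: group_hom_def group_hom_axioms_def)

lemma posit_carrier: "x \<in> posit K n \<Longrightarrow> x \<in> carrier (chains K n)"
  using posit_submonoid[of n] by (auto simp: submonoid_def)

lemma posit_mult: "x \<in> posit K n \<Longrightarrow> y \<in> posit K n \<Longrightarrow> x \<otimes>\<^bsub>chains K n\<^esub> y \<in> posit K n"
  using posit_submonoid[of n] by (auto simp: submonoid_def)

lemma posit_one: "\<one>\<^bsub>chains K n\<^esub> \<in> posit K n"
  using posit_submonoid[of n] by (auto simp: submonoid_def)

end

lemma adc_hom_group_hom:
  assumes "adc K" "adc L" "f \<in> adc_hom K L"
  shows "group_hom (chains K n) (chains L n) (f n)"
proof -
  interpret K: adc K by fact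
  interpret L: adc L by fact
  show ?thesis
    using adc_homD(1)[OF assms(3)] K.G.is_group L.G.is_group
    by (simp add: group_hom_def group_hom_axioms_def)
qed

lemma adc_id_hom: "adc K \<Longrightarrow> adc_id K \<in> adc_hom K K"
proof -
  assume "adc K"
  then interpret adc K .
  show ?thesis
    unfolding adc_hom_def adc_id_def
    by (auto simp: posit_carrier hom_def)
qed

lemma adc_hom_comp:
  assumes K: "adc K" and f: "f \<in> adc_hom K L" and g: "g \<in> adc_hom L M"
  shows "adc_comp K g f \<in> adc_hom K M"
proof -
  interpret adc K by fact
  have "compose (carrier (chains K n)) (g n) (f n) \<in> hom (chains K n) (chains M n)" for n
    using adc_homD(1)[OF f, of n] adc_homD(1)[OF g, of n]
    by (auto simp: compose_def hom_in_carrier hom_mult intro!: homI)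
  then show ?thesis
    unfolding adc_hom_def adc_comp_def
    using adc_homD(2-5)[OF f] adc_homD(2-5)[OF g]
    by (auto simp: compose_def posit_carrier)
qed


section \<open>The functor \<open>\<lambda>\<close>\<close>

lemma lam_simps [simp]:
  "chains (lam C) = lam_chains C"
  "posit (lam C) n = submonoid_generated (lam_chains C n) (lam_class C n ` cells C n)"
  by (simp_all add: lam_def)

lemma (in comm_group) telescope:
  assumes "a \<in> carrier G" "b \<in> carrier G" "c \<in> carrier G"
  shows "(b \<otimes> inv a) \<otimes> (c \<otimes> inv b) = c \<otimes> inv a"
proof -
  have "(b \<otimes> inv a) \<otimes> (c \<otimes> inv b) = (c \<otimes> inv a) \<otimes> (b \<otimes> inv b)"
    using assms by (simp only: m_ac m_closed inv_closed)
  then show ?thesis using assms by simp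
qed

lemma comm_group_integer_group: "comm_group integer_group"
  by (rule group.group_comm_groupI) auto

context omega_category
begin

sublocale L: comm_group "lam_chains C n" for n
  by (rule lam_chains_comm_group)

sublocale Q: group_hom "free_cells n" "lam_chains C n" "lam_coset C n" for n
  using lam_coset_hom L.is_group by (simp add: group_hom_def group_hom_axioms_def)

lemma frag_extend_face_hom:
  "frag_extend (\<lambda>x. frag_of (face C Pos n x) - frag_of (face C Neg n x))
    \<in> hom (free_cells (Suc n)) (free_cells n)"
proof (rule frag_extend_hom)
  fix x assume "x \<in> cells C (Suc n)"
  then show "Poly_Mapping.keys (frag_of (face C Pos n x) - frag_of (face C Neg n x)) \<subseteq> cells C n"
    using keys_diff[of "frag_of (face C Pos n x)" "frag_of (face C Neg n x)"]
      face_cells[OF cells_carrier] by auto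
qed

lemma lam_coset_diff:
  assumes "x \<in> cells C n" "y \<in> cells C n"
  shows "lam_coset C n (frag_of x - frag_of y) =
    lam_class C n x \<otimes>\<^bsub>lam_chains C n\<^esub> inv\<^bsub>lam_chains C n\<^esub> lam_class C n y"
  using assms Q.hom_mult[of "frag_of x" n "- frag_of y"] Q.hom_inv[of "frag_of y" n]
  by (simp add: lam_class_def)

text \<open>For \<open>m < n\<close> both faces are additive. For \<open>m = n\<close> the faces of
  the composite are the outer ones, and the common inner face cancels by
  \<open>telescope\<close>.\<close>

lemma lam_class_Pos_Neg_cmp:
  assumes m: "m < Suc n" and x: "x \<in> cells C (Suc n)" and y: "y \<in> cells C (Suc n)"
    and xy: "composable C m x y"
  defines "d \<equiv> (\<lambda>x. lam_class C n (face C Pos n x) \<otimes>\<^bsub>lam_chains C n\<^esub>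
      inv\<^bsub>lam_chains C n\<^esub> lam_class C n (face C Neg n x))"
  shows "d (cmp C m x y) = d x \<otimes>\<^bsub>lam_chains C n\<^esub> d y"
proof -
  have x': "x \<in> carrier C" and y': "y \<in> carrier C" using x y cells_carrier by auto
  have cl: "lam_class C n (face C \<alpha> n x) \<in> carrier (lam_chains C n)"
    "lam_class C n (face C \<alpha> n y) \<in> carrier (lam_chains C n)" for \<alpha>
    using x' y' by (auto intro!: lam_class_closed face_cells)
  show ?thesis
  proof (cases "m < n")
    case True
    have "lam_class C n (face C \<alpha> n (cmp C m x y)) =
        lam_class C n (face C \<alpha> n x) \<otimes>\<^bsub>lam_chains C n\<^esub> lam_class C n (face C \<alpha> n y)" for \<alpha>
      using True x' y' xy
      by (simp add: face_cmp_greater lam_class_cmp face_cells composable_face_less)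
    then show ?thesis
      using cl by (simp add: d_def L.inv_mult L.m_ac)
  next
    case False
    with m have [simp]: "m = n" by simp
    have "face C Pos n x = face C Neg n y" using xy by (simp add: composable_def)
    then show ?thesis
      using cl[of Pos] cl[of Neg] xy L.telescope
      by (simp add: d_def face_cmp_Pos face_cmp_Neg)
  qed
qed

lemma lam_bdry_coset:
  assumes c: "Poly_Mapping.keys c \<subseteq> cells C (Suc n)"
  shows "bdry (lam C) n (lam_coset C (Suc n) c) = lam_coset C n
    (frag_extend (\<lambda>x. frag_of (face C Pos n x) - frag_of (face C Neg n x)) c)"
    (is "_ = lam_coset C n (?\<delta> c)")
proof -
  have h: "lam_coset C n \<circ> ?\<delta> \<in> hom (free_cells (Suc n)) (lam_chains C n)"
    using frag_extend_face_hom lam_coset_hom by (rule hom_compose)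
  have "(lam_coset C n \<circ> ?\<delta>) ` lam_coset C (Suc n) c = {(lam_coset C n \<circ> ?\<delta>) c}"
    by (rule lam_image_coset[OF h L.is_group _ c])
      (simp add: lam_coset_diff face_cells cells_carrier cmp_cells lam_class_Pos_Neg_cmp cmp_closed)
  then have "\<Union> ((lam_coset C n \<circ> ?\<delta>) ` lam_coset C (Suc n) c) = (lam_coset C n \<circ> ?\<delta>) c"
    by simp
  then show ?thesis by (simp add: lam_def)
qed

lemma lam_bdry_hom: "bdry (lam C) n \<in> hom (lam_chains C (Suc n)) (lam_chains C n)"
  by (rule lam_hom_induced[OF hom_compose[OF frag_extend_face_hom lam_coset_hom]])
    (simp add: lam_bdry_coset)

lemma lam_bdry_class:
  assumes "x \<in> cells C (Suc n)"
  shows "bdry (lam C) n (lam_class C (Suc n) x) =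
    lam_class C n (face C Pos n x) \<otimes>\<^bsub>lam_chains C n\<^esub>
      inv\<^bsub>lam_chains C n\<^esub> lam_class C n (face C Neg n x)"
  using lam_bdry_coset[of "frag_of x" n] assms
  by (simp add: lam_class_def[of C "Suc n"] lam_coset_diff face_cells cells_carrier)

lemma lam_aug_coset:
  assumes c: "Poly_Mapping.keys c \<subseteq> cells C 0"
  shows "aug (lam C) (lam_coset C 0 c) = free_ext integer_group (\<lambda>x. 1) c"
proof -

  have h: "free_ext integer_group (\<lambda>x. 1) \<in> hom (free_cells 0) integer_group"
    by (rule free_ext_hom[OF comm_group_integer_group]) auto
  have "free_ext integer_group (\<lambda>x. 1) ` lam_coset C 0 c = {free_ext integer_group (\<lambda>x. 1) c}"
    by (rule lam_image_coset[OF h group_integer_group _ c])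
      (simp add: free_ext_frag_of[OF comm_group_integer_group])
  then show ?thesis by (simp add: lam_def)
qed

lemma lam_aug_hom: "aug (lam C) \<in> hom (lam_chains C 0) integer_group"
  by (rule lam_hom_induced[OF free_ext_hom[OF comm_group_integer_group, of "\<lambda>_. 1"]])
    (simp_all add: lam_aug_coset)

lemma lam_aug_class: "x \<in> cells C 0 \<Longrightarrow> aug (lam C) (lam_class C 0 x) = 1"
  by (simp add: lam_class_def lam_aug_coset free_ext_frag_of[OF comm_group_integer_group])
lemma lam_posit_class: "x \<in> cells C n \<Longrightarrow> lam_class C n x \<in> posit (lam C) n"
  by (simp add: submonoid_generated.incl)

lemma adc_lam: "adc (lam C)"
proof (rule adc.intro)
  interpret bd: group_hom "lam_chains C (Suc n)" "lam_chains C n" "bdry (lam C) n" for n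
    using lam_bdry_hom L.is_group by (simp add: group_hom_def group_hom_axioms_def)
  show "comm_group (chains (lam C) n)" for n by (simp add: L.comm_group_axioms)
  show "bdry (lam C) n \<in> hom (chains (lam C) (Suc n)) (chains (lam C) n)" for n
    by (simp add: lam_bdry_hom)
  show "bdry (lam C) n (bdry (lam C) (Suc n) X) = \<one>\<^bsub>chains (lam C) n\<^esub>"
    if "X \<in> carrier (chains (lam C) (Suc (Suc n)))" for X n
  proof -
    have "(bdry (lam C) n \<circ> bdry (lam C) (Suc n)) X = \<one>\<^bsub>lam_chains C n\<^esub>"
    proof (rule lam_hom_eqI[where n = "Suc (Suc n)" and G = "lam_chains C n" and X = X
          and h = "bdry (lam C) n \<circ> bdry (lam C) (Suc n)" and k = "\<lambda>_. \<one>\<^bsub>lam_chains C n\<^esub>"])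
      show "bdry (lam C) n \<circ> bdry (lam C) (Suc n) \<in> hom (lam_chains C (Suc (Suc n))) (lam_chains C n)"
        using lam_bdry_hom lam_bdry_hom by (rule hom_compose)
      fix x assume x: "x \<in> cells C (Suc (Suc n))"
      then have "face C \<alpha> n x \<in> cells C n" for \<alpha> n by (simp add: face_cells cells_carrier)
      \<comment> \<open>The two \<open>(n + 1)\<close>-faces of \<open>x\<close> have the same
        \<open>n\<close>-faces, so the four terms cancel.\<close>
      then show "(bdry (lam C) n \<circ> bdry (lam C) (Suc n)) (lam_class C (Suc (Suc n)) x) = \<one>\<^bsub>lam_chains C n\<^esub>"
        using x by (simp add: lam_bdry_class lam_class_closed face_face cells_carrier)
    qed (use that in \<open>auto simp: hom_def L.is_group\<close>)
    then show ?thesis by simp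
  qed
  show "aug (lam C) \<in> hom (chains (lam C) 0) integer_group" by (simp add: lam_aug_hom)
  show "aug (lam C) (bdry (lam C) 0 X) = 0" if "X \<in> carrier (chains (lam C) (Suc 0))" for X
  proof -
    interpret au: group_hom "lam_chains C 0" integer_group "aug (lam C)"
      using lam_aug_hom by (simp add: group_hom_def group_hom_axioms_def L.is_group)
    have "(aug (lam C) \<circ> bdry (lam C) 0) X = 0"
    proof (rule lam_hom_eqI[where n = "Suc 0" and G = integer_group and X = X
          and h = "aug (lam C) \<circ> bdry (lam C) 0" and k = "\<lambda>_. 0"])
      show "aug (lam C) \<circ> bdry (lam C) 0 \<in> hom (lam_chains C (Suc 0)) integer_group"
        using lam_bdry_hom lam_aug_hom by (rule hom_compose)
      fix x assume x: "x \<in> cells C (Suc 0)"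
      then have "face C \<alpha> 0 x \<in> cells C 0" for \<alpha> by (simp add: face_cells cells_carrier)
      then show "(aug (lam C) \<circ> bdry (lam C) 0) (lam_class C (Suc 0) x) = 0"
        using x by (simp add: lam_bdry_class lam_aug_class lam_class_closed)
    qed (use that in \<open>auto simp: hom_def\<close>)
    then show ?thesis by simp
  qed
  show "submonoid (posit (lam C) n) (chains (lam C) n)" for n
    using submonoid_generated_is_submonoid[OF L.comm_group_axioms] lam_class_closed
    by (simp add: image_subset_iff)
qed

lemma lam_adc_hom_eqI:
  assumes "f \<in> adc_hom (lam C) L" "g \<in> adc_hom (lam C) L" "adc L"
    and eq: "\<And>n x. x \<in> cells C n \<Longrightarrow> f n (lam_class C n x) = g n (lam_class C n x)"
  shows "f = g"
proof -
  interpret L: adc L by fact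
  have "f n = g n" for n
  proof (rule extensionalityI)
    show "f n \<in> extensional (carrier (lam_chains C n))" "g n \<in> extensional (carrier (lam_chains C n))"
      using adc_homD(6)[OF assms(1)] adc_homD(6)[OF assms(2)] by auto
    show "f n X = g n X" if "X \<in> carrier (lam_chains C n)" for X
      using adc_homD(1)[OF assms(1), of n] adc_homD(1)[OF assms(2), of n] that eq
      lam_hom_eqI[of "f n" n "chains L n" "g n" X, OF _ _ L.G.is_group] by simp
  qed
  then show ?thesis by blast
qed

text \<open>All conditions on a morphism out of \<open>lam C\<close> are compatible with addition of
  chains, so they may be tested on the generators \<open>[x]_n\<close>. Here \<open>bd\<close> is
  the chain map condition with the boundary of a generator written out.\<close>

lemma lam_adc_homI:
  assumes L: "adc L"
    and hom: "\<And>n. f n \<in> hom (lam_chains C n) (chains L n)"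
    and ext: "\<And>n. f n \<in> extensional (carrier (lam_chains C n))"
    and pos: "\<And>n x. x \<in> cells C n \<Longrightarrow> f n (lam_class C n x) \<in> posit L n"
    and bd: "\<And>n x. x \<in> cells C (Suc n) \<Longrightarrow>
      f n (lam_class C n (face C Pos n x)) \<otimes>\<^bsub>chains L n\<^esub>
        inv\<^bsub>chains L n\<^esub> f n (lam_class C n (face C Neg n x)) =
      bdry L n (f (Suc n) (lam_class C (Suc n) x))"
    and au: "\<And>x. x \<in> cells C 0 \<Longrightarrow> aug L (f 0 (lam_class C 0 x)) = 1"
  shows "f \<in> adc_hom (lam C) L"
proof -
  interpret L: adc L by fact
  interpret f: group_hom "lam_chains C n" "chains L n" "f n" for n
    using hom L.G.is_group by (simp add: group_hom_def group_hom_axioms_def L.is_group)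
  have "f n (bdry (lam C) n X) = bdry L n (f (Suc n) X)" if "X \<in> carrier (lam_chains C (Suc n))" for n X
  proof -
    have "(f n \<circ> bdry (lam C) n) X = (bdry L n \<circ> f (Suc n)) X"
    proof (rule lam_hom_eqI[where n = "Suc n" and G = "chains L n"])
      show "f n \<circ> bdry (lam C) n \<in> hom (lam_chains C (Suc n)) (chains L n)"
        using lam_bdry_hom hom by (rule hom_compose)
      show "bdry L n \<circ> f (Suc n) \<in> hom (lam_chains C (Suc n)) (chains L n)"
        using hom L.bdry_hom by (rule hom_compose)
      fix x assume x: "x \<in> cells C (Suc n)"
      then have "face C \<alpha> n x \<in> cells C n" for \<alpha> by (simp add: face_cells cells_carrier)
      then show "(f n \<circ> bdry (lam C) n) (lam_class C (Suc n) x) = (bdry L n \<circ> f (Suc n)) (lam_class C (Suc n) x)"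
        using bd[OF x] x by (simp add: lam_bdry_class lam_class_closed)
    qed (use that L.G.is_group in auto)
    then show ?thesis by simp
  qed
  moreover have "aug L (f 0 X) = aug (lam C) X" if "X \<in> carrier (lam_chains C 0)" for X
  proof -
    have "(aug L \<circ> f 0) X = aug (lam C) X"
    proof (rule lam_hom_eqI[where n = 0 and G = "integer_group"])
      show "aug L \<circ> f 0 \<in> hom (lam_chains C 0) integer_group"
        using hom L.aug_hom by (rule hom_compose)
    qed (use that lam_aug_hom in \<open>auto simp: au lam_aug_class\<close>)
    then show ?thesis by simp
  qed
  moreover have "f n X \<in> posit L n" if "X \<in> posit (lam C) n" for n X
    using that unfolding lam_simps
  proof induction
    case one then show ?case by (simp add: L.posit_one)
  next
    case (incl s) then show ?case using pos by auto
  next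
    case (mult x y)
    interpret adc "lam C" by (rule adc_lam)
    show ?case using mult posit_carrier[of x n] posit_carrier[of y n] by (simp add: L.posit_mult)
  qed
  ultimately show ?thesis
    using hom ext f.hom_closed unfolding adc_hom_def PiE_def by auto
qed

end

lemma frag_extend_map_hom:
  assumes "f \<in> omega_hom C D"
  shows "frag_extend (\<lambda>x. frag_of (f x)) \<in> hom (free_Abelian_group (cells C n)) (free_Abelian_group (cells D n))"
  by (rule frag_extend_hom) (simp add: omega_homD(5)[OF assms])

lemma lam_map_coset:
  assumes C: "omega_category C" and D: "omega_category D" and f: "f \<in> omega_hom C D"
    and c: "Poly_Mapping.keys c \<subseteq> cells C n"
  shows "lam_map C D f n (lam_coset C n c) = lam_coset D n (frag_extend (\<lambda>x. frag_of (f x)) c)"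
proof -
  interpret C: omega_category C by fact
  interpret D: omega_category D by fact
  let ?h = "lam_coset D n \<circ> frag_extend (\<lambda>x. frag_of (f x))"
  have h: "?h \<in> hom (C.free_cells n) (lam_chains D n)"
    using frag_extend_map_hom[OF f] D.lam_coset_hom by (rule hom_compose)
  have "?h ` lam_coset C n c = {?h c}"
  proof (rule C.lam_image_coset[OF h D.L.is_group _ c])
    fix m x y assume "m < n" "x \<in> cells C n" "y \<in> cells C n" "composable C m x y"
    then show "?h (frag_of (cmp C m x y)) = ?h (frag_of x) \<otimes>\<^bsub>lam_chains D n\<^esub> ?h (frag_of y)"
      using D.lam_class_cmp[of m n "f x" "f y"] omega_homD[OF f] by (simp add: lam_class_def)
  qed
  then have "\<Union> (?h ` lam_coset C n c) = ?h c" by simp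
  then show ?thesis using C.lam_coset_closed[OF c] by (simp add: lam_map_def)
qed

lemma lam_map_class:
  assumes "omega_category C" "omega_category D" "f \<in> omega_hom C D" "x \<in> cells C n"
  shows "lam_map C D f n (lam_class C n x) = lam_class D n (f x)"
  using lam_map_coset[of C D f "frag_of x" n] assms by (simp add: lam_class_def)

lemma lam_map_hom:
  assumes C: "omega_category C" and D: "omega_category D" and f: "f \<in> omega_hom C D"
  shows "lam_map C D f \<in> adc_hom (lam C) (lam D)"
proof -
  interpret C: omega_category C by fact
  interpret D: omega_category D by fact
  show ?thesis
  proof (rule C.lam_adc_homI[OF D.adc_lam])
    fix n
    have "lam_map C D f n \<in> hom (lam_chains C n) (lam_chains D n)"
      by (rule C.lam_hom_induced[OF hom_compose[OF frag_extend_map_hom[OF f] D.lam_coset_hom]])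
        (simp add: lam_map_coset[OF C D f])
    then show "lam_map C D f n \<in> hom (lam_chains C n) (chains (lam D) n)" by simp
    show "lam_map C D f n \<in> extensional (carrier (lam_chains C n))"
      by (simp add: lam_map_def)
    fix x assume x: "x \<in> cells C n"
    show "lam_map C D f n (lam_class C n x) \<in> posit (lam D) n"
      using D.lam_posit_class omega_homD(5)[OF f x] by (simp add: lam_map_class[OF C D f x])
  next
    fix n x assume x: "x \<in> cells C (Suc n)"
    then show "lam_map C D f n (lam_class C n (face C Pos n x)) \<otimes>\<^bsub>chains (lam D) n\<^esub>
        inv\<^bsub>chains (lam D) n\<^esub> lam_map C D f n (lam_class C n (face C Neg n x)) =
        bdry (lam D) n (lam_map C D f (Suc n) (lam_class C (Suc n) x))"
      using omega_homD(5)[OF f x]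
      by (simp add: lam_map_class[OF C D f] D.lam_bdry_class C.face_cells C.cells_carrier omega_homD(2)[OF f])
  next
    fix x assume x: "x \<in> cells C 0"
    then show "aug (lam D) (lam_map C D f 0 (lam_class C 0 x)) = 1"
      using omega_homD(5)[OF f x] by (simp add: lam_map_class[OF C D f] D.lam_aug_class)
  qed
qed

lemma omega_id_hom: "omega_category C \<Longrightarrow> omega_id C \<in> omega_hom C C"
  by (auto simp: omega_hom_def omega_id_def composable_def omega_category.face_closed omega_category.cmp_closed)

lemma lam_map_id:
  assumes C: "omega_category C"
  shows "lam_map C C (omega_id C) = adc_id (lam C)"
proof -
  interpret omega_category C by fact
  show ?thesis
    by (rule lam_adc_hom_eqI[OF lam_map_hom adc_id_hom])
      (simp_all add: C omega_id_hom adc_lam lam_map_class adc_id_def lam_class_closed,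
        simp add: omega_id_def cells_carrier)
qed

lemma lam_map_comp:
  assumes C: "omega_category C" and D: "omega_category D" and E: "omega_category E"
    and f: "f \<in> omega_hom C D" and g: "g \<in> omega_hom D E"
  shows "lam_map C E (omega_comp C g f) = adc_comp (lam C) (lam_map D E g) (lam_map C D f)"
proof -
  interpret C: omega_category C by fact
  interpret E: omega_category E by fact
  note gf = omega_hom_comp[OF C f g]
  show ?thesis
  proof (rule C.lam_adc_hom_eqI[OF lam_map_hom[OF C E gf] adc_hom_comp E.adc_lam])
    fix n x assume x: "x \<in> cells C n"
    show "lam_map C E (omega_comp C g f) n (lam_class C n x) =
        adc_comp (lam C) (lam_map D E g) (lam_map C D f) n (lam_class C n x)"
      using x omega_homD(5)[OF f x]
      by (simp add: lam_map_class[OF C E gf] adc_comp_def compose_def C.lam_class_closed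
          lam_map_class[OF C D f] lam_map_class[OF D E g])
        (simp add: omega_comp_def compose_def C.cells_carrier)
  qed (use lam_map_hom[OF C D f] lam_map_hom[OF D E g] C.adc_lam in auto)
qed


section \<open>The functor \<open>\<nu>\<close>\<close>

context adc
begin

text \<open>Finite support is replaced by a bound \<open>N\<close>, which is easier to produce for
  faces and composites; membership in the chain groups is contained in positivity.\<close>

lemma nu_carrier_iff:
  "x \<in> carrier (nu K) \<longleftrightarrow> (\<forall>\<alpha> n. x \<alpha> n \<in> posit K n) \<and>
     (\<exists>N. \<forall>\<alpha>. \<forall>n\<ge>N. x \<alpha> n = \<one>\<^bsub>chains K n\<^esub>) \<and>
     (\<forall>n \<alpha>. x Pos n \<otimes>\<^bsub>chains K n\<^esub> inv\<^bsub>chains K n\<^esub> x Neg n = bdry K n (x \<alpha> (Suc n))) \<and>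
     (\<forall>\<alpha>. aug K (x \<alpha> 0) = 1)"
proof -
  have "finite {n. \<exists>\<alpha>. x \<alpha> n \<noteq> \<one>\<^bsub>chains K n\<^esub>} \<longleftrightarrow> (\<exists>N. \<forall>\<alpha>. \<forall>n\<ge>N. x \<alpha> n = \<one>\<^bsub>chains K n\<^esub>)"
    unfolding finite_nat_set_iff_bounded by (auto simp: not_less[symmetric])
  then show ?thesis
    using posit_carrier by (auto simp: nu_def mu_def)
qed

lemma nu_face:
  "face (nu K) \<alpha> n x = (\<lambda>\<beta> i. if i < n then x \<beta> i else if i = n then x \<alpha> n else \<one>\<^bsub>chains K i\<^esub>)"
  by (simp add: nu_def mu_def)

lemma nuD:
  assumes "x \<in> carrier (nu K)"
  shows "x \<alpha> n \<in> posit K n" and "x \<alpha> n \<in> carrier (chains K n)"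
    and "x Pos n \<otimes>\<^bsub>chains K n\<^esub> inv\<^bsub>chains K n\<^esub> x Neg n = bdry K n (x \<alpha> (Suc n))"
    and "aug K (x \<alpha> 0) = 1"
  using assms posit_carrier unfolding nu_carrier_iff by auto

lemma nu_bound:
  assumes "x \<in> carrier (nu K)"
  obtains N where "\<And>\<alpha> n. n \<ge> N \<Longrightarrow> x \<alpha> n = \<one>\<^bsub>chains K n\<^esub>"
  using assms unfolding nu_carrier_iff by auto

lemma nu_composable_iff:
  "composable (nu K) n x y \<longleftrightarrow> x \<in> carrier (nu K) \<and> y \<in> carrier (nu K) \<and>
     (\<forall>\<beta>. \<forall>i<n. x \<beta> i = y \<beta> i) \<and> x Pos n = y Neg n"
proof -
  have "face (nu K) Pos n x = face (nu K) Neg n y \<longleftrightarrow>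
      (\<forall>\<beta> i. i < n \<longrightarrow> x \<beta> i = y \<beta> i) \<and> x Pos n = y Neg n"
    unfolding nu_face fun_eq_iff by (auto split: if_splits)
  then show ?thesis
    unfolding composable_def by auto
qed

text \<open>The formula \<open>x - z + y\<close> with the common face \<open>z\<close> is evaluated
  by dimension: below \<open>n\<close> all three agree, in dimension \<open>n\<close> the inner part
  \<open>x Pos n = y Neg n\<close> cancels, and above \<open>n\<close> the face \<open>z\<close>
  vanishes.\<close>

lemma nu_cmp:
  assumes "composable (nu K) n x y"
  shows "cmp (nu K) n x y = (\<lambda>\<beta> i. if i < n then x \<beta> i
    else if i = n then (case \<beta> of Neg \<Rightarrow> x Neg n | Pos \<Rightarrow> y Pos n)
    else x \<beta> i \<otimes>\<^bsub>chains K i\<^esub> y \<beta> i)"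
proof (intro ext)
  fix \<beta> i
  have x: "x \<in> carrier (nu K)" and y: "y \<in> carrier (nu K)"
    and eq: "\<And>\<beta> i. i < n \<Longrightarrow> x \<beta> i = y \<beta> i" "x Pos n = y Neg n"
    using assms unfolding nu_composable_iff by auto
  have [simp]: "x \<beta> i \<in> carrier (chains K i)" "y \<beta> i \<in> carrier (chains K i)" for \<beta> i
    using nuD(2)[OF x] nuD(2)[OF y] by auto
  show "cmp (nu K) n x y \<beta> i = (if i < n then x \<beta> i
    else if i = n then (case \<beta> of Neg \<Rightarrow> x Neg n | Pos \<Rightarrow> y Pos n)
    else x \<beta> i \<otimes>\<^bsub>chains K i\<^esub> y \<beta> i)"
    using eq by (cases \<beta>) (auto simp: nu_def mu_def Let_def eq(1)[symmetric] eq(2), simp add: G.m_assoc)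
qed

lemma nu_face_closed:
  assumes x: "x \<in> carrier (nu K)"
  shows "face (nu K) \<alpha> n x \<in> carrier (nu K)"
proof -
  note [simp] = nuD(1,2,4)[OF x] posit_one
  have "face (nu K) \<alpha> n x Pos m \<otimes>\<^bsub>chains K m\<^esub> inv\<^bsub>chains K m\<^esub> face (nu K) \<alpha> n x Neg m =
      bdry K m (face (nu K) \<alpha> n x \<beta> (Suc m))" for m \<beta>
    using nuD(3)[OF x, of m] unfolding nu_face by auto
  moreover have "\<exists>N. \<forall>\<beta>. \<forall>i\<ge>N. face (nu K) \<alpha> n x \<beta> i = \<one>\<^bsub>chains K i\<^esub>"
    unfolding nu_face by (rule exI[of _ "Suc n"]) auto
  ultimately show ?thesis
    unfolding nu_carrier_iff by (auto simp: nu_face)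
qed

lemma nu_cmp_closed:
  assumes xy: "composable (nu K) n x y"
  shows "cmp (nu K) n x y \<in> carrier (nu K)"
proof -
  have x: "x \<in> carrier (nu K)" and y: "y \<in> carrier (nu K)"
    and eq: "\<And>\<beta> i. i < n \<Longrightarrow> y \<beta> i = x \<beta> i" "x Pos n = y Neg n"
    using xy unfolding nu_composable_iff by auto
  let ?z = "cmp (nu K) n x y"
  note [simp] = nuD(1,2,4)[OF x] nuD(1,2,4)[OF y] posit_one
  have "?z Pos m \<otimes>\<^bsub>chains K m\<^esub> inv\<^bsub>chains K m\<^esub> ?z Neg m = bdry K m (?z \<beta> (Suc m))" for m \<beta>
  proof -
    consider "Suc m < n" | "Suc m = n" | "m = n" | "m > n" by linarith
    then show ?thesis
    proof cases
      case 1 then show ?thesis using nuD(3)[OF x, of m] by (simp add: nu_cmp[OF xy])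
    next
      case 2 then show ?thesis
        using nuD(3)[OF x, of m \<beta>] nuD(3)[OF y, of m \<beta>] eq(1)[of m]
        by (cases \<beta>) (auto simp: nu_cmp[OF xy])
    next
      \<comment> \<open>The composite takes its source from \<open>x\<close> and its target from
        \<open>y\<close> here, while one dimension higher it is a sum; the inner part
        telescopes.\<close>
      case 3
      have "x Pos n \<in> carrier (chains K n)" by simp
      then show ?thesis
        using 3 nuD(3)[OF x, of m \<beta>, symmetric] nuD(3)[OF y, of m \<beta>, symmetric] eq(2)
          G.telescope[of "x Neg n" n "x Pos n" "y Pos n"]
        by (simp add: nu_cmp[OF xy])
    next
      case 4
      then show ?thesis
        using nuD(3)[OF x, of m \<beta>, symmetric] nuD(3)[OF y, of m \<beta>, symmetric]
        by (simp add: nu_cmp[OF xy] G.inv_mult G.m_ac)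
    qed
  qed
  moreover have "\<exists>N. \<forall>\<beta>. \<forall>i\<ge>N. ?z \<beta> i = \<one>\<^bsub>chains K i\<^esub>"
  proof -
    obtain N M where "\<And>\<alpha> n. n \<ge> N \<Longrightarrow> x \<alpha> n = \<one>\<^bsub>chains K n\<^esub>" "\<And>\<alpha> n. n \<ge> M \<Longrightarrow> y \<alpha> n = \<one>\<^bsub>chains K n\<^esub>"
      using nu_bound[OF x] nu_bound[OF y] by metis
    then show ?thesis
      by (intro exI[of _ "Suc (max n (max N M))"]) (auto simp: nu_cmp[OF xy])
  qed
  ultimately show ?thesis
    unfolding nu_carrier_iff by (auto simp: nu_cmp[OF xy] posit_mult split: sign.splits)
qed

lemma nu_face_composable:
  assumes "composable (nu K) n x y" "n < m"
  shows "composable (nu K) n (face (nu K) \<alpha> m x) (face (nu K) \<alpha> m y)"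
  using assms nu_face_closed[of x \<alpha> m] nu_face_closed[of y \<alpha> m] unfolding nu_composable_iff by (simp add: nu_face)

lemma nu_interchange:
  assumes mn: "m < n" and xy: "composable (nu K) n x y" and xy': "composable (nu K) n x' y'"
    and c: "composable (nu K) m (cmp (nu K) n x y) (cmp (nu K) n x' y')"
  shows "cmp (nu K) m (cmp (nu K) n x y) (cmp (nu K) n x' y') =
    cmp (nu K) n (cmp (nu K) m x x') (cmp (nu K) m y y')"
proof -
  have cl: "x \<in> carrier (nu K)" "y \<in> carrier (nu K)" "x' \<in> carrier (nu K)" "y' \<in> carrier (nu K)"
    using xy xy' unfolding nu_composable_iff by auto
  note [simp] = cl[THEN nuD(2)]
  have eq: "\<And>\<beta> i. i < n \<Longrightarrow> y \<beta> i = x \<beta> i" "x Pos n = y Neg n"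
    "\<And>\<beta> i. i < n \<Longrightarrow> y' \<beta> i = x' \<beta> i" "x' Pos n = y' Neg n"
    using xy xy' unfolding nu_composable_iff by auto
  have eq': "\<And>\<beta> i. i < m \<Longrightarrow> x' \<beta> i = x \<beta> i" "x Pos m = x' Neg m"
    using c mn unfolding nu_composable_iff nu_cmp[OF xy] nu_cmp[OF xy'] by auto
  have xx': "composable (nu K) m x x'" and yy': "composable (nu K) m y y'"
    unfolding nu_composable_iff using cl eq eq' mn by auto
  have c': "composable (nu K) n (cmp (nu K) m x x') (cmp (nu K) m y y')"
    unfolding nu_composable_iff
    using eq eq' mn nu_cmp_closed[OF xx'] nu_cmp_closed[OF yy']
    by (auto simp: nu_cmp[OF xx'] nu_cmp[OF yy'] split: sign.splits)
  show ?thesis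
    unfolding nu_cmp[OF c] unfolding nu_cmp[OF c']
    using mn eq eq'
    by (auto simp: nu_cmp[OF xx'] nu_cmp[OF yy'] nu_cmp[OF xy] nu_cmp[OF xy']
        fun_eq_iff G.m_ac split: sign.splits)
qed

lemma nu_assoc:
  assumes "composable (nu K) n x y" "composable (nu K) n (cmp (nu K) n x y) z"
  shows "cmp (nu K) n (cmp (nu K) n x y) z = cmp (nu K) n x (cmp (nu K) n y z)"
proof -
  have cl: "x \<in> carrier (nu K)" "y \<in> carrier (nu K)" "z \<in> carrier (nu K)"
    using assms unfolding nu_composable_iff by auto
  note [simp] = cl[THEN nuD(2)]
  have eq: "\<And>\<beta> i. i < n \<Longrightarrow> x \<beta> i = y \<beta> i" "x Pos n = y Neg n"
    using assms(1) unfolding nu_composable_iff by auto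
  have eq': "\<And>\<beta> i. i < n \<Longrightarrow> y \<beta> i = z \<beta> i" "y Pos n = z Neg n"
    using assms(2) eq unfolding nu_composable_iff nu_cmp[OF assms(1)] by auto
  have yz: "composable (nu K) n y z" unfolding nu_composable_iff using cl eq' by auto
  have x_yz: "composable (nu K) n x (cmp (nu K) n y z)"
    using nu_cmp_closed[OF yz] cl eq unfolding nu_composable_iff nu_cmp[OF yz] by auto
  show ?thesis
    unfolding nu_cmp[OF assms(2)] unfolding nu_cmp[OF x_yz]
    using eq eq'
    by (auto simp: nu_cmp[OF assms(1)] nu_cmp[OF yz]
        fun_eq_iff G.m_assoc split: sign.splits)
qed

lemma omega_category_nu: "omega_category (nu K)"
proof (rule omega_category.intro)
  fix x :: "sign \<Rightarrow> nat \<Rightarrow> 'k" and \<alpha> \<beta> :: sign and m n :: nat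
  assume x: "x \<in> carrier (nu K)"
  note [simp] = nuD(2)[OF x]
  show "face (nu K) \<alpha> n x \<in> carrier (nu K)" by (rule nu_face_closed[OF x])
  show "\<exists>n. face (nu K) Neg n x = x \<and> face (nu K) Pos n x = x"
  proof -
    obtain N where "\<And>\<alpha> n. n \<ge> N \<Longrightarrow> x \<alpha> n = \<one>\<^bsub>chains K n\<^esub>" using nu_bound[OF x] by blast
    then show ?thesis by (intro exI[of _ N]) (auto simp: nu_face fun_eq_iff)
  qed
  show "face (nu K) \<beta> m (face (nu K) \<alpha> n x) = (if m < n then face (nu K) \<beta> m x else face (nu K) \<alpha> n x)"
    by (auto simp: nu_face fun_eq_iff)
  have l: "composable (nu K) n (face (nu K) Neg n x) x" and r: "composable (nu K) n x (face (nu K) Pos n x)"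
    unfolding nu_composable_iff using x nu_face_closed[OF x] by (auto simp: nu_face)
  show "cmp (nu K) n (face (nu K) Neg n x) x = x"
    unfolding nu_cmp[OF l] by (auto simp: nu_face fun_eq_iff split: sign.splits)
  show "cmp (nu K) n x (face (nu K) Pos n x) = x"
    unfolding nu_cmp[OF r] by (auto simp: nu_face fun_eq_iff split: sign.splits)
next
  fix x y :: "sign \<Rightarrow> nat \<Rightarrow> 'k" and \<alpha> :: sign and m n :: nat
  assume xy: "composable (nu K) n x y"
  then have cl: "x \<in> carrier (nu K)" "y \<in> carrier (nu K)"
    and eq: "\<And>\<beta> i. i < n \<Longrightarrow> x \<beta> i = y \<beta> i" "x Pos n = y Neg n"
    unfolding nu_composable_iff by auto
  note [simp] = cl[THEN nuD(2)]
  show "cmp (nu K) n x y \<in> carrier (nu K)" by (rule nu_cmp_closed[OF xy])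
  show "face (nu K) Neg n (cmp (nu K) n x y) = face (nu K) Neg n x"
    by (auto simp: nu_face nu_cmp[OF xy] fun_eq_iff)
  show "face (nu K) Pos n (cmp (nu K) n x y) = face (nu K) Pos n y"
    using eq by (auto simp: nu_face nu_cmp[OF xy] fun_eq_iff)
  show "face (nu K) \<alpha> m (cmp (nu K) n x y) = cmp (nu K) n (face (nu K) \<alpha> m x) (face (nu K) \<alpha> m y)"
    if "n < m"
    unfolding nu_cmp[OF nu_face_composable[OF xy that]]
    using that by (auto simp: nu_face nu_cmp[OF xy] fun_eq_iff split: sign.splits)
  show "face (nu K) \<alpha> m (cmp (nu K) n x y) = face (nu K) \<alpha> m x \<and>
      face (nu K) \<alpha> m x = face (nu K) \<alpha> m y \<and>
      face (nu K) \<alpha> m y = cmp (nu K) n (face (nu K) \<alpha> m x) (face (nu K) \<alpha> m y)" if "m < n"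
  proof -
    have 1: "face (nu K) \<alpha> m x = face (nu K) \<alpha> m y"
      using eq that by (auto simp: nu_face fun_eq_iff)
    have 2: "composable (nu K) n (face (nu K) \<alpha> m x) (face (nu K) \<alpha> m y)"
      using that unfolding 1 nu_composable_iff using nu_face_closed[OF cl(2)] by (auto simp: nu_face)
    have 3: "face (nu K) \<alpha> m y = cmp (nu K) n (face (nu K) \<alpha> m x) (face (nu K) \<alpha> m y)"
      unfolding nu_cmp[OF 2] unfolding 1 using that by (auto simp: nu_face fun_eq_iff split: sign.splits)
    show ?thesis
    proof (intro conjI)
      show "face (nu K) \<alpha> m (cmp (nu K) n x y) = face (nu K) \<alpha> m x"
        using that by (auto simp: nu_face nu_cmp[OF xy] fun_eq_iff)
    qed (fact 1 3)+
  qed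
next
  fix x y z :: "sign \<Rightarrow> nat \<Rightarrow> 'k" and n :: nat
  assume a: "composable (nu K) n x y \<and> composable (nu K) n (cmp (nu K) n x y) z \<or>
       composable (nu K) n y z \<and> composable (nu K) n x (cmp (nu K) n y z)"
  show "cmp (nu K) n (cmp (nu K) n x y) z = cmp (nu K) n x (cmp (nu K) n y z)"
  proof (cases "composable (nu K) n x y \<and> composable (nu K) n (cmp (nu K) n x y) z")
    case False
    with a have yz: "composable (nu K) n y z" and c: "composable (nu K) n x (cmp (nu K) n y z)" by auto
    have xy: "composable (nu K) n x y"
      using yz c unfolding nu_composable_iff nu_cmp[OF yz] by auto
    have "composable (nu K) n (cmp (nu K) n x y) z"
      using nu_cmp_closed[OF xy] yz xy unfolding nu_composable_iff nu_cmp[OF xy] by auto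
    with xy show ?thesis by (rule nu_assoc)
  qed (auto intro: nu_assoc)
qed (rule nu_interchange)

sublocale N: omega_category "nu K"
  by (rule omega_category_nu)

text \<open>Vanishing above \<open>n\<close> suffices, because the boundary condition then makes
  \<open>x Pos n\<close> and \<open>x Neg n\<close> differ by the boundary of zero.\<close>

lemma nu_cells_iff:
  "x \<in> cells (nu K) n \<longleftrightarrow> x \<in> carrier (nu K) \<and> (\<forall>\<alpha>. \<forall>i>n. x \<alpha> i = \<one>\<^bsub>chains K i\<^esub>)"
proof
  assume "x \<in> cells (nu K) n"
  then have "x \<in> carrier (nu K)" "face (nu K) Neg n x = x" by (auto simp: cells_def)
  moreover have "face (nu K) Neg n x \<alpha> i = \<one>\<^bsub>chains K i\<^esub>" if "i > n" for \<alpha> i using that by (simp add: nu_face)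
  ultimately show "x \<in> carrier (nu K) \<and> (\<forall>\<alpha>. \<forall>i>n. x \<alpha> i = \<one>\<^bsub>chains K i\<^esub>)" by metis
next
  assume a: "x \<in> carrier (nu K) \<and> (\<forall>\<alpha>. \<forall>i>n. x \<alpha> i = \<one>\<^bsub>chains K i\<^esub>)"
  then have x: "x \<in> carrier (nu K)" by simp
  note [simp] = nuD(2)[OF x]
  have "x Pos n \<otimes>\<^bsub>chains K n\<^esub> inv\<^bsub>chains K n\<^esub> x Neg n = \<one>\<^bsub>chains K n\<^esub>"
    using nuD(3)[OF x, of n Neg] a by simp
  then have "x Pos n = x Neg n"
    using G.inv_solve_right'[of "\<one>\<^bsub>chains K n\<^esub>" n "x Pos n" "x Neg n"] by simp
  then have "x \<alpha> n = x Neg n" for \<alpha> by (cases \<alpha>) auto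
  then have "face (nu K) Neg n x \<alpha> i = x \<alpha> i" for \<alpha> i
    using a unfolding nu_face by (metis not_less_iff_gr_or_eq)
  then show "x \<in> cells (nu K) n"
    using x by (simp add: cells_def fun_eq_iff)
qed

lemma nu_cell_Neg: "x \<in> cells (nu K) n \<Longrightarrow> x \<alpha> n = x Neg n"
  by (metis N.cells_carrier N.face_of_cell nat_less_le nu_face order_refl)

end

lemma nu_map_hom:
  assumes K: "adc K" and L: "adc L" and f: "f \<in> adc_hom K L"
  shows "nu_map K f \<in> omega_hom (nu K) (nu L)"
proof -
  interpret K: adc K by fact
  interpret L: adc L by fact
  interpret f: group_hom "chains K n" "chains L n" "f n" for n
    by (rule adc_hom_group_hom[OF K L f])
  have cl: "(\<lambda>\<alpha> n. f n (x \<alpha> n)) \<in> carrier (nu L)" if x: "x \<in> carrier (nu K)" for x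
  proof -
    note [simp] = K.nuD(2)[OF x]
    have "f n (x Pos n) \<otimes>\<^bsub>chains L n\<^esub> inv\<^bsub>chains L n\<^esub> f n (x Neg n) = bdry L n (f (Suc n) (x \<alpha> (Suc n)))" for n \<alpha>
      using arg_cong[OF K.nuD(3)[OF x, of n \<alpha>], of "f n"] adc_homD(3)[OF f, of "x \<alpha> (Suc n)" n] by simp
    moreover obtain N where "\<And>\<alpha> n. n \<ge> N \<Longrightarrow> x \<alpha> n = \<one>\<^bsub>chains K n\<^esub>" using K.nu_bound[OF x] by blast
    then have "\<exists>N. \<forall>\<alpha>. \<forall>n\<ge>N. f n (x \<alpha> n) = \<one>\<^bsub>chains L n\<^esub>" by (intro exI[of _ N]) simp
    ultimately show ?thesis
      unfolding L.nu_carrier_iff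
      using K.nuD(1,4)[OF x] adc_homD(4,5)[OF f] by auto
  qed
  have fc: "nu_map K f (face (nu K) \<alpha> n x) = face (nu L) \<alpha> n (nu_map K f x)"
    if x: "x \<in> carrier (nu K)" for x \<alpha> n
    using K.nu_face_closed[OF x] x by (auto simp: nu_map_def K.nu_face L.nu_face fun_eq_iff)
  show ?thesis
    unfolding omega_hom_def
  proof (intro CollectI conjI ballI allI impI)
    show "nu_map K f \<in> carrier (nu K) \<rightarrow>\<^sub>E carrier (nu L)"
      using cl by (auto simp: nu_map_def)
    fix n x y assume xy: "composable (nu K) n x y"
    then have cxy: "x \<in> carrier (nu K)" "y \<in> carrier (nu K)" by (auto simp: composable_def)
    have "nu_map K f x \<in> carrier (nu L)" "nu_map K f y \<in> carrier (nu L)"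
      using cxy cl by (simp_all add: nu_map_def)
    then have "composable (nu L) n (nu_map K f x) (nu_map K f y)"
      using xy fc[OF cxy(1), of Pos n] fc[OF cxy(2), of Neg n] by (simp add: composable_def)
    from L.nu_cmp[OF this] show "nu_map K f (cmp (nu K) n x y) = cmp (nu L) n (nu_map K f x) (nu_map K f y)"
      using K.nu_cmp_closed[OF xy] cxy K.nuD(2)[OF cxy(1)] K.nuD(2)[OF cxy(2)]
      by (auto simp: nu_map_def K.nu_cmp[OF xy] fun_eq_iff split: sign.splits)
  qed (rule fc)
qed

lemma nu_map_id:
  assumes "adc K" shows "nu_map K (adc_id K) = omega_id (nu K)"
proof -
  interpret adc K by fact
  show ?thesis
    by (rule ext) (auto simp: nu_map_def adc_id_def omega_id_def nuD(2))
qed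

lemma nu_map_comp:
  assumes K: "adc K" and L: "adc L" and f: "f \<in> adc_hom K L"
  shows "nu_map K (adc_comp K g f) = omega_comp (nu K) (nu_map L g) (nu_map K f)"
proof -
  interpret adc K by fact
  have "(\<lambda>\<alpha> n. f n (x \<alpha> n)) \<in> carrier (nu L)" if "x \<in> carrier (nu K)" for x
    using omega_homD(1)[OF nu_map_hom[OF K L f] that] that by (simp add: nu_map_def)
  then show ?thesis
    by (intro ext) (auto simp: nu_map_def adc_comp_def omega_comp_def compose_def nuD(2))
qed


section \<open>Unit and counit\<close>

context omega_category
begin

interpretation lamK: adc "lam C"
  by (rule adc_lam)

text \<open>An \<open>m\<close>-cell is idempotent for \<open>#_m\<close>, so its class in dimension
  \<open>n\<close> satisfies \<open>[x] + [x] = [x]\<close>.\<close>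

lemma lam_class_low:
  assumes "x \<in> cells C m" "m < n"
  shows "lam_class C n x = \<one>\<^bsub>lam_chains C n\<^esub>"
proof -
  have xn: "x \<in> cells C n" using assms cells_mono[of m n] by simp
  have c: "composable C m x x"
    using assms by (simp add: composable_def cells_carrier face_of_cell)
  have "lam_class C n x \<otimes>\<^bsub>lam_chains C n\<^esub> lam_class C n x = lam_class C n x"
    using lam_class_cmp[OF assms(2) xn xn c] cmp_cell_right[OF c assms(1)] by simp
  then show ?thesis using lam_class_closed[OF xn] L.r_cancel_one' by metis
qed

lemma unit_eta_apply: "x \<in> carrier C \<Longrightarrow> unit_eta C x = (\<lambda>\<alpha> n. lam_class C n (face C \<alpha> n x))"
  by (simp add: unit_eta_def)

lemma unit_eta_closed:
  assumes x: "x \<in> carrier C"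
  shows "unit_eta C x \<in> carrier (nu (lam C))"
proof -
  obtain N where N: "x \<in> cells C N" using ex_cells[OF x] ..
  have "lam_class C n (face C \<alpha> n x) = \<one>\<^bsub>lam_chains C n\<^esub>" if "n \<ge> Suc N" for n \<alpha>
    using that N lam_class_low[OF N, of n] face_of_cell[OF N, of n] by simp
  then have "\<exists>N. \<forall>\<alpha>. \<forall>n\<ge>N. lam_class C n (face C \<alpha> n x) = \<one>\<^bsub>lam_chains C n\<^esub>" by blast
  moreover have "bdry (lam C) n (lam_class C (Suc n) (face C \<alpha> (Suc n) x)) =
      lam_class C n (face C Pos n x) \<otimes>\<^bsub>lam_chains C n\<^esub> inv\<^bsub>lam_chains C n\<^esub> lam_class C n (face C Neg n x)" for n \<alpha>
    using lam_bdry_class[OF face_cells[OF x]] x by (simp add: face_face)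
  ultimately show ?thesis
    unfolding lamK.nu_carrier_iff using x lam_posit_class[OF face_cells[OF x]] lam_aug_class[OF face_cells[OF x]]
    by (simp add: unit_eta_apply)
qed

lemma unit_eta_closed':
  "x \<in> carrier C \<Longrightarrow> (\<lambda>\<alpha> n. lam_class C n (face C \<alpha> n x)) \<in> carrier (nu (lam C))"
  using unit_eta_closed unit_eta_apply by metis

lemma unit_eta_hom: "unit_eta C \<in> omega_hom C (nu (lam C))"
proof -
  \<comment> \<open>Above dimension \<open>n\<close> the left side consists of classes of an
    \<open>n\<close>-cell, which are zero by \<open>lam_class_low\<close>.\<close>
  have fc: "unit_eta C (face C \<alpha> n x) = face (nu (lam C)) \<alpha> n (unit_eta C x)"
    if x: "x \<in> carrier C" for x \<alpha> n
    using x face_cells[OF x, of \<alpha> n] lam_class_low[of _ n]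
    by (auto simp: unit_eta_apply face_closed lamK.nu_face fun_eq_iff face_face)
  show ?thesis
    unfolding omega_hom_def
  proof (intro CollectI conjI ballI allI impI)
    show "unit_eta C \<in> carrier C \<rightarrow>\<^sub>E carrier (nu (lam C))"
      using unit_eta_closed by (auto simp: unit_eta_def[of C])
    fix n x y assume xy: "composable C n x y"
    then have x: "x \<in> carrier C" and y: "y \<in> carrier C" by (auto simp: composable_def)
    have c: "composable (nu (lam C)) n (unit_eta C x) (unit_eta C y)"
      using xy unit_eta_closed unfolding composable_def by (metis fc)
    have "lam_class C i (face C \<beta> i (cmp C n x y)) = lam_class C i (face C \<beta> i x) \<otimes>\<^bsub>lam_chains C i\<^esub> lam_class C i (face C \<beta> i y)"
      if "n < i" for i \<beta>
      using that x y xy by (simp add: face_cmp_greater lam_class_cmp face_cells composable_face_less)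
    then show "unit_eta C (cmp C n x y) = cmp (nu (lam C)) n (unit_eta C x) (unit_eta C y)"
      unfolding lamK.nu_cmp[OF c] using x y xy face_cmp_less[OF xy]
      by (auto simp: unit_eta_apply cmp_closed fun_eq_iff face_cmp_Neg face_cmp_Pos split: sign.splits)
  qed (rule fc)
qed

end

lemma unit_eta_natural:
  assumes C: "omega_category C" and D: "omega_category D" and f: "f \<in> omega_hom C D"
  shows "omega_comp C (nu_map (lam C) (lam_map C D f)) (unit_eta C) = omega_comp C (unit_eta D) f"
proof -
  interpret C: omega_category C by fact
  interpret D: omega_category D by fact
  show ?thesis
    by (rule ext)
      (auto simp: omega_comp_def compose_def nu_map_def C.unit_eta_closed' C.unit_eta_apply D.unit_eta_apply
        omega_homD(1,2)[OF f] lam_map_class[OF C D f] C.face_cells fun_eq_iff)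
qed

context adc
begin

lemma counit_pi_coset:
  assumes c: "Poly_Mapping.keys c \<subseteq> cells (nu K) n"
  shows "counit_pi K n (lam_coset (nu K) n c) = free_ext (chains K n) (\<lambda>x. x Neg n) c"
proof -
  have cl: "(\<lambda>x. x Neg n) ` cells (nu K) n \<subseteq> carrier (chains K n)"
    using nuD(2) N.cells_carrier by blast
  have h: "free_ext (chains K n) (\<lambda>x. x Neg n) \<in> hom (N.free_cells n) (chains K n)"
    by (rule free_ext_hom[OF G.comm_group_axioms cl])
  have "free_ext (chains K n) (\<lambda>x. x Neg n) ` lam_coset (nu K) n c = {free_ext (chains K n) (\<lambda>x. x Neg n) c}"
  proof (rule N.lam_image_coset[OF h G.is_group _ c])
    fix m x y assume a: "m < n" "x \<in> cells (nu K) n" "y \<in> cells (nu K) n" "composable (nu K) m x y"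
    then have "x Neg n \<in> carrier (chains K n)" "y Neg n \<in> carrier (chains K n)"
      using cl by auto
    then show "free_ext (chains K n) (\<lambda>x. x Neg n) (frag_of (cmp (nu K) m x y)) =
        free_ext (chains K n) (\<lambda>x. x Neg n) (frag_of x) \<otimes>\<^bsub>chains K n\<^esub> free_ext (chains K n) (\<lambda>x. x Neg n) (frag_of y)"
      using a by (simp add: G.comm_group_axioms nu_cmp)
  qed
  then show ?thesis using N.lam_coset_closed[OF c] by (simp add: counit_pi_def)
qed

lemma counit_pi_class: "x \<in> cells (nu K) n \<Longrightarrow> counit_pi K n (lam_class (nu K) n x) = x Neg n"
  unfolding lam_class_def using counit_pi_coset[of "frag_of x" n] nuD(2) N.cells_carrier
  by (simp add: G.comm_group_axioms)

lemma counit_pi_hom: "counit_pi K \<in> adc_hom (lam (nu K)) K"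
proof (rule N.lam_adc_homI)
  show "adc K" by (rule adc_axioms)
  fix n
  have "(\<lambda>x. x Neg n) ` cells (nu K) n \<subseteq> carrier (chains K n)"
    using nuD(2) N.cells_carrier by blast
  from free_ext_hom[OF G.comm_group_axioms this]
  show "counit_pi K n \<in> hom (lam_chains (nu K) n) (chains K n)"
    by (rule N.lam_hom_induced) (rule counit_pi_coset)
  show "counit_pi K n \<in> extensional (carrier (lam_chains (nu K) n))"
    by (simp add: counit_pi_def)
  fix x assume x: "x \<in> cells (nu K) n"
  show "counit_pi K n (lam_class (nu K) n x) \<in> posit K n"
    using nuD(1) N.cells_carrier x by (simp add: counit_pi_class)
next
  fix n x assume x: "x \<in> cells (nu K) (Suc n)"
  then have "x \<in> carrier (nu K)" by (rule N.cells_carrier)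
  then show "counit_pi K n (lam_class (nu K) n (face (nu K) Pos n x)) \<otimes>\<^bsub>chains K n\<^esub>
      inv\<^bsub>chains K n\<^esub> counit_pi K n (lam_class (nu K) n (face (nu K) Neg n x)) =
      bdry K n (counit_pi K (Suc n) (lam_class (nu K) (Suc n) x))"
    using x nuD(3) by (simp add: counit_pi_class N.face_cells) (simp add: nu_face)
next
  fix x assume x: "x \<in> cells (nu K) 0"
  show "aug K (counit_pi K 0 (lam_class (nu K) 0 x)) = 1"
    using nuD(4) N.cells_carrier x by (simp add: counit_pi_class)
qed

end

lemma counit_pi_natural:
  assumes K: "adc K" and L: "adc L" and f: "f \<in> adc_hom K L"
  shows "adc_comp (lam (nu K)) (counit_pi L) (lam_map (nu K) (nu L) (nu_map K f)) =
    adc_comp (lam (nu K)) f (counit_pi K)"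
proof -
  interpret K: adc K by fact
  interpret L: adc L by fact
  note nf = nu_map_hom[OF K L f]
  note lf = lam_map_hom[OF K.omega_category_nu L.omega_category_nu nf]
  show ?thesis
  proof (rule K.N.lam_adc_hom_eqI[OF _ _ L])
    show "adc_comp (lam (nu K)) (counit_pi L) (lam_map (nu K) (nu L) (nu_map K f)) \<in> adc_hom (lam (nu K)) L"
      by (rule adc_hom_comp[OF K.N.adc_lam lf L.counit_pi_hom])
    show "adc_comp (lam (nu K)) f (counit_pi K) \<in> adc_hom (lam (nu K)) L"
      by (rule adc_hom_comp[OF K.N.adc_lam K.counit_pi_hom f])
    fix n x assume x: "x \<in> cells (nu K) n"
    then show "adc_comp (lam (nu K)) (counit_pi L) (lam_map (nu K) (nu L) (nu_map K f)) n (lam_class (nu K) n x) =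
        adc_comp (lam (nu K)) f (counit_pi K) n (lam_class (nu K) n x)"
      using omega_homD(5)[OF nf x]
      by (simp add: adc_comp_def compose_def K.N.lam_class_closed K.counit_pi_class L.counit_pi_class
          lam_map_class[OF K.omega_category_nu L.omega_category_nu nf])
        (simp add: nu_map_def K.N.cells_carrier)
  qed
qed

lemma triangle_lam:
  assumes C: "omega_category C"
  shows "adc_comp (lam C) (counit_pi (lam C)) (lam_map C (nu (lam C)) (unit_eta C)) = adc_id (lam C)"
proof -
  interpret omega_category C by fact
  interpret lamK: adc "lam C" by (rule adc_lam)
  note l = lam_map_hom[OF C lamK.omega_category_nu unit_eta_hom]
  show ?thesis
  proof (rule lam_adc_hom_eqI[OF adc_hom_comp[OF adc_lam l lamK.counit_pi_hom] adc_id_hom[OF adc_lam] adc_lam])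
    fix n x assume x: "x \<in> cells C n"
    then show "adc_comp (lam C) (counit_pi (lam C)) (lam_map C (nu (lam C)) (unit_eta C)) n (lam_class C n x) =
        adc_id (lam C) n (lam_class C n x)"
      using omega_homD(5)[OF unit_eta_hom x]
      by (simp add: adc_comp_def compose_def lam_class_closed adc_id_def lamK.counit_pi_class
          lam_map_class[OF C lamK.omega_category_nu unit_eta_hom])
        (simp add: unit_eta_apply cells_carrier face_of_cell)
  qed
qed

lemma triangle_nu:
  assumes K: "adc K"
  shows "omega_comp (nu K) (nu_map (lam (nu K)) (counit_pi K)) (unit_eta (nu K)) = omega_id (nu K)"
proof -
  interpret adc K by fact
  show ?thesis
    by (rule ext) (auto simp: omega_comp_def compose_def omega_id_def nu_map_def N.unit_eta_closed' fun_eq_iff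
      N.unit_eta_apply counit_pi_class N.face_cells, simp add: nu_face)
qed


section \<open>Coordinates with respect to a basis\<close>

locale based_adc = adc K for K :: "'k adc_data" +
  fixes B :: "(nat \<times> 'k) set"
  assumes basis: "adc_basis K B"
begin

abbreviation "free_basis n \<equiv> free_Abelian_group (in_dim B n)"

abbreviation "eval_basis n \<equiv> free_ext (chains K n) (\<lambda>b. b)"

definition coords :: "nat \<Rightarrow> 'k \<Rightarrow> 'k \<Rightarrow>\<^sub>0 int" where
  "coords n = inv_into (carrier (free_basis n)) (eval_basis n)"

definition coef :: "nat \<Rightarrow> 'k \<Rightarrow> 'k \<Rightarrow> int" where
  "coef n x b = Poly_Mapping.lookup (coords n x) b"

lemma basis_carrier: "b \<in> in_dim B n \<Longrightarrow> b \<in> carrier (chains K n)"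
  using basis by (auto simp: adc_basis_def free_abelian_on_def)

lemma posit_generated: "posit K n = submonoid_generated (chains K n) (in_dim B n)"
  using basis by (auto simp: adc_basis_def)

lemma eval_iso: "eval_basis n \<in> iso (free_basis n) (chains K n)"
  using basis by (auto simp: adc_basis_def free_abelian_on_def)

lemma coords_hom: "coords n \<in> hom (chains K n) (free_basis n)"
  unfolding coords_def using group.iso_set_sym[OF group_free_Abelian_group eval_iso]
  by (simp add: iso_def)

lemma eval_coords: "x \<in> carrier (chains K n) \<Longrightarrow> eval_basis n (coords n x) = x"
  unfolding coords_def using eval_iso[of n] by (simp add: iso_def bij_betw_def f_inv_into_f)

lemma coords_eval: "Poly_Mapping.keys c \<subseteq> in_dim B n \<Longrightarrow> coords n (eval_basis n c) = c"
  unfolding coords_def using eval_iso[of n] by (simp add: iso_def bij_betw_def)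

lemma coords_keys: "x \<in> carrier (chains K n) \<Longrightarrow> Poly_Mapping.keys (coords n x) \<subseteq> in_dim B n"
  using hom_in_carrier[OF coords_hom] by simp

lemma coef_mult [simp]:
  "x \<in> carrier (chains K n) \<Longrightarrow> y \<in> carrier (chains K n) \<Longrightarrow>
    coef n (x \<otimes>\<^bsub>chains K n\<^esub> y) c = coef n x c + coef n y c"
  unfolding coef_def using hom_mult[OF coords_hom] by (simp add: lookup_add)

lemma coef_one [simp]: "coef n \<one>\<^bsub>chains K n\<^esub> c = 0"
  using coef_mult[of "\<one>\<^bsub>chains K n\<^esub>" n "\<one>\<^bsub>chains K n\<^esub>" c] by simp

lemma coef_inv [simp]:
  "x \<in> carrier (chains K n) \<Longrightarrow> coef n (inv\<^bsub>chains K n\<^esub> x) c = - coef n x c"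
  using coef_mult[of x n "inv\<^bsub>chains K n\<^esub> x" c] by simp

lemma coef_basis: "b \<in> in_dim B n \<Longrightarrow> coef n b c = (if c = b then 1 else 0)"
  using coords_eval[of "frag_of b" n] basis_carrier[of b n]
  by (auto simp: coef_def G.comm_group_axioms)

lemma coef_outside: "x \<in> carrier (chains K n) \<Longrightarrow> c \<notin> in_dim B n \<Longrightarrow> coef n x c = 0"
  using coords_keys[of x n] unfolding coef_def by (meson in_keys_iff subsetD)

lemma coef_nz: "x \<in> carrier (chains K n) \<Longrightarrow> coef n x c \<noteq> 0 \<Longrightarrow> c \<in> in_dim B n"
  using coef_outside by blast

lemma coef_finite: "finite {c. coef n x c \<noteq> 0}"
  unfolding coef_def by simp

lemma coef_eqI:
  assumes "x \<in> carrier (chains K n)" "y \<in> carrier (chains K n)" "\<And>c. coef n x c = coef n y c"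
  shows "x = y"
proof -
  have "coords n x = coords n y" using assms(3) by (auto simp: coef_def intro: poly_mapping_eqI)
  then show ?thesis using eval_coords assms(1,2) by metis
qed

lemma coef_ex:
  assumes "finite {c. g c \<noteq> 0}" "\<And>c. g c \<noteq> 0 \<Longrightarrow> c \<in> in_dim B n"
  obtains x where "x \<in> carrier (chains K n)" "\<And>c. coef n x c = g c"
proof -
  let ?g = "Abs_poly_mapping g"
  have l: "Poly_Mapping.lookup ?g = g" using assms(1) by (simp add: Abs_poly_mapping_inverse)
  have k: "Poly_Mapping.keys ?g \<subseteq> in_dim B n" using assms(2) by (auto simp: in_keys_iff l)
  show thesis
  proof
    show "eval_basis n ?g \<in> carrier (chains K n)"
      using eval_iso[of n] k by (auto simp: iso_def intro: hom_in_carrier)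
    show "coef n (eval_basis n ?g) c = g c" for c
      by (simp add: coef_def coords_eval[OF k] l)
  qed
qed

lemma coef_finprod:
  assumes "finite I" "\<And>i. i \<in> I \<Longrightarrow> f i \<in> carrier (chains K n)"
  shows "coef n (finprod (chains K n) f I) c = (\<Sum>i\<in>I. coef n (f i) c)"
  using assms
proof (induction I rule: finite_induct)
  case (insert i I)
  then have "f \<in> I \<rightarrow> carrier (chains K n)" "f i \<in> carrier (chains K n)" by auto
  with insert show ?case by simp
qed simp

lemma finprod_posit:
  assumes "finite I" "\<And>i. i \<in> I \<Longrightarrow> f i \<in> posit K n"
  shows "finprod (chains K n) f I \<in> posit K n"
  using assms
proof (induction I rule: finite_induct)
  case (insert i I)
  then have "f \<in> I \<rightarrow> carrier (chains K n)" "f i \<in> carrier (chains K n)" using posit_carrier by auto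
  with insert show ?case by (simp add: posit_mult)
qed (simp add: posit_one)

lemma coef_posit:
  assumes "x \<in> posit K n" shows "0 \<le> coef n x c"
  using assms unfolding posit_generated
proof induction
  case (mult x y)
  then have "x \<in> carrier (chains K n)" "y \<in> carrier (chains K n)"
    using posit_carrier posit_generated by auto
  then show ?case using mult by simp
qed (auto simp: coef_basis)

lemma basis_posit: "b \<in> in_dim B n \<Longrightarrow> b \<in> posit K n"
  unfolding posit_generated by (rule submonoid_generated.incl)

lemma basis_pow_posit: "b \<in> in_dim B n \<Longrightarrow> b [^]\<^bsub>chains K n\<^esub> (k::nat) \<in> posit K n"
  by (induction k) (auto simp: posit_one basis_posit intro: posit_mult)

lemma basis_expand:
  assumes "x \<in> carrier (chains K n)"
  shows "x = finprod (chains K n) (\<lambda>b. b [^]\<^bsub>chains K n\<^esub> coef n x b) {b. coef n x b \<noteq> 0}"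
proof -
  have "Poly_Mapping.keys (coords n x) = {b. coef n x b \<noteq> 0}"
    by (auto simp: coef_def in_keys_iff)
  then show ?thesis
    using eval_coords[OF assms] by (simp add: free_ext_def coef_def)
qed

lemma posit_iff:
  assumes "x \<in> carrier (chains K n)"
  shows "x \<in> posit K n \<longleftrightarrow> (\<forall>c. 0 \<le> coef n x c)"
proof
  assume a: "\<forall>c. 0 \<le> coef n x c"
  have "b [^]\<^bsub>chains K n\<^esub> coef n x b \<in> posit K n" if "coef n x b \<noteq> 0" for b
  proof -
    have "b [^]\<^bsub>chains K n\<^esub> int (nat (coef n x b)) \<in> posit K n"
      unfolding int_pow_int using basis_pow_posit coef_nz[OF assms that] .
    then show ?thesis using a by simp
  qed
  then show "x \<in> posit K n"
    by (subst basis_expand[OF assms]) (auto intro: finprod_posit coef_finite)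
qed (auto intro: coef_posit)

text \<open>Stated for a bare additive function into the integers so that it covers both a fixed
  coordinate of the boundary and the augmentation.\<close>

lemma additive_expand:
  assumes h: "\<And>x y. x \<in> carrier (chains K n) \<Longrightarrow> y \<in> carrier (chains K n) \<Longrightarrow>
      h (x \<otimes>\<^bsub>chains K n\<^esub> y) = h x + (h y :: int)"
    and x: "x \<in> carrier (chains K n)"
  shows "h x = (\<Sum>b | coef n x b \<noteq> 0. coef n x b * h b)"
proof -
  have one: "h \<one>\<^bsub>chains K n\<^esub> = 0" using h[of "\<one>\<^bsub>chains K n\<^esub>" "\<one>\<^bsub>chains K n\<^esub>"] by simp
  have inv: "h (inv\<^bsub>chains K n\<^esub> y) = - h y" if "y \<in> carrier (chains K n)" for y
    using h[of y "inv\<^bsub>chains K n\<^esub> y"] that one by simp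
  have npow: "h (y [^]\<^bsub>chains K n\<^esub> (k::nat)) = int k * h y" if "y \<in> carrier (chains K n)" for y k
    by (induction k) (use that in \<open>simp_all add: one h algebra_simps\<close>)
  have pow: "h (y [^]\<^bsub>chains K n\<^esub> (k::int)) = k * h y" if "y \<in> carrier (chains K n)" for y k
  proof (cases "0 \<le> k")
    case True then show ?thesis using npow[OF that, of "nat k"] int_pow_int[of "chains K n" y "nat k"] by simp
  next
    case False
    then have "k = - int (nat (- k))" by simp
    then have "y [^]\<^bsub>chains K n\<^esub> k = inv\<^bsub>chains K n\<^esub> (y [^]\<^bsub>chains K n\<^esub> nat (- k))"
      using G.int_pow_neg[OF that, of "int (nat (- k))"] int_pow_int[of "chains K n" y "nat (- k)"] by metis
    then have "h (y [^]\<^bsub>chains K n\<^esub> k) = - h (y [^]\<^bsub>chains K n\<^esub> nat (- k))"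
      using inv[OF G.nat_pow_closed[OF that]] by metis
    then show ?thesis unfolding npow[OF that] using False by simp
  qed
  have fin: "h (finprod (chains K n) f I) = (\<Sum>i\<in>I. h (f i))"
    if "finite I" "f \<in> I \<rightarrow> carrier (chains K n)" for f and I :: "'k set"
    using that by (induction I rule: finite_induct) (auto simp: one h)
  have c: "b \<in> carrier (chains K n)" if "coef n x b \<noteq> 0" for b
    using basis_carrier coef_nz[OF x that] .
  have "h x = h (finprod (chains K n) (\<lambda>b. b [^]\<^bsub>chains K n\<^esub> coef n x b) {b. coef n x b \<noteq> 0})"
    using basis_expand[OF x] by simp
  also have "\<dots> = (\<Sum>b | coef n x b \<noteq> 0. h (b [^]\<^bsub>chains K n\<^esub> coef n x b))"
    by (rule fin[OF coef_finite]) (use c in auto)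
  also have "\<dots> = (\<Sum>b | coef n x b \<noteq> 0. coef n x b * h b)"
    by (rule sum.cong) (use c pow in auto)
  finally show ?thesis .
qed

lemma coef_bdry_expand:
  assumes "x \<in> carrier (chains K (Suc n))"
  shows "coef n (bdry K n x) c = (\<Sum>b | coef (Suc n) x b \<noteq> 0. coef (Suc n) x b * coef n (bdry K n b) c)"
  by (rule additive_expand[OF _ assms]) simp

lemma aug_expand:
  assumes "x \<in> carrier (chains K 0)"
  shows "aug K x = (\<Sum>b | coef 0 x b \<noteq> 0. coef 0 x b * aug K b)"
  by (rule additive_expand[OF _ assms]) (simp add: hom_mult[OF aug_hom])


section \<open>The lattice order on chains\<close>

lemma le_iff:
  assumes "x \<in> carrier (chains K n)" "y \<in> carrier (chains K n)"
  shows "x \<sqsubseteq>\<^bsub>chain_order K n\<^esub> y \<longleftrightarrow> (\<forall>c. coef n x c \<le> coef n y c)"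
  using assms by (simp add: chain_order_def posit_iff)

lemma meet_coef:
  assumes x: "x \<in> carrier (chains K n)" and y: "y \<in> carrier (chains K n)"
  shows "x \<sqinter>\<^bsub>chain_order K n\<^esub> y \<in> carrier (chains K n)"
    and "coef n (x \<sqinter>\<^bsub>chain_order K n\<^esub> y) c = min (coef n x c) (coef n y c)"
proof -
  let ?L = "chain_order K n"
  have [simp]: "carrier ?L = carrier (chains K n)" by (simp add: chain_order_def)
  have "finite {c. min (coef n x c) (coef n y c) \<noteq> 0}"
    by (rule finite_subset[of _ "{c. coef n x c \<noteq> 0} \<union> {c. coef n y c \<noteq> 0}"])
      (auto simp: coef_finite min_def)
  then obtain m where m: "m \<in> carrier (chains K n)" "\<And>c. coef n m c = min (coef n x c) (coef n y c)"
    using coef_ex[of "\<lambda>c. min (coef n x c) (coef n y c)" n]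
    by (metis (no_types, lifting) coef_outside min.idem x y)
  have low: "l \<in> Lower ?L {x, y} \<longleftrightarrow> l \<in> carrier (chains K n) \<and> (\<forall>c. coef n l c \<le> coef n m c)" for l
  proof (cases "l \<in> carrier (chains K n)")
    case True
    then show ?thesis
      using x y le_iff[OF True x] le_iff[OF True y] by (auto simp: Lower_def m)
  qed (simp add: Lower_def)
  \<comment> \<open>The meet is only described as a greatest lower bound, so its value is known once
    \<open>m\<close> is shown to be the only one.\<close>
  have gr: "greatest ?L g (Lower ?L {x, y}) \<longleftrightarrow> g = m" for g
  proof
    assume g: "greatest ?L g (Lower ?L {x, y})"
    then have gl: "g \<in> Lower ?L {x, y}" and gg: "\<And>l. l \<in> Lower ?L {x, y} \<Longrightarrow> l \<sqsubseteq>\<^bsub>?L\<^esub> g"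
      by (simp_all add: greatest_def)
    have gc: "g \<in> carrier (chains K n)" and gm: "\<And>c. coef n g c \<le> coef n m c"
      using gl unfolding low by auto
    have "m \<in> Lower ?L {x, y}" unfolding low using m(1) by simp
    then have "m \<sqsubseteq>\<^bsub>?L\<^esub> g" by (rule gg)
    then have mg: "\<And>c. coef n m c \<le> coef n g c" using le_iff[OF m(1) gc] by simp
    show "g = m" by (rule coef_eqI[OF gc m(1) order_antisym[OF gm mg]])
  next
    assume "g = m"
    moreover have "m \<in> Lower ?L {x, y}" unfolding low using m(1) by simp
    moreover have "l \<sqsubseteq>\<^bsub>?L\<^esub> m" if "l \<in> Lower ?L {x, y}" for l
      using that le_iff[OF _ m(1)] unfolding low by blast
    ultimately show "greatest ?L g (Lower ?L {x, y})"
      unfolding greatest_def using Lower_closed[of ?L "{x, y}"] by simp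
  qed
  have "x \<sqinter>\<^bsub>?L\<^esub> y = m" unfolding meet_def inf_def gr by simp
  then show "x \<sqinter>\<^bsub>?L\<^esub> y \<in> carrier (chains K n)" "coef n (x \<sqinter>\<^bsub>?L\<^esub> y) c = min (coef n x c) (coef n y c)"
    using m by auto
qed

lemma meet_one_iff:
  assumes "x \<in> carrier (chains K n)" "y \<in> carrier (chains K n)"
  shows "x \<sqinter>\<^bsub>chain_order K n\<^esub> y = \<one>\<^bsub>chains K n\<^esub> \<longleftrightarrow> (\<forall>c. min (coef n x c) (coef n y c) = 0)"
  using meet_coef[OF assms] coef_eqI[of _ n "\<one>\<^bsub>chains K n\<^esub>"] by fastforce

lemma one_less_meet_iff:
  assumes "x \<in> posit K n" "y \<in> posit K n"
  shows "\<one>\<^bsub>chains K n\<^esub> \<sqsubset>\<^bsub>chain_order K n\<^esub> (x \<sqinter>\<^bsub>chain_order K n\<^esub> y) \<longleftrightarrow>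
    (\<exists>c. 0 < coef n x c \<and> 0 < coef n y c)"
proof -
  note xy = assms[THEN posit_carrier]
  have "\<one>\<^bsub>chains K n\<^esub> \<sqsubset>\<^bsub>chain_order K n\<^esub> (x \<sqinter>\<^bsub>chain_order K n\<^esub> y) \<longleftrightarrow>
      x \<sqinter>\<^bsub>chain_order K n\<^esub> y \<noteq> \<one>\<^bsub>chains K n\<^esub>"
    using le_iff[of "\<one>\<^bsub>chains K n\<^esub>" n "x \<sqinter>\<^bsub>chain_order K n\<^esub> y"] meet_coef[OF xy] coef_posit assms
    by (auto simp: lless_def chain_order_def)
  also have "\<dots> \<longleftrightarrow> (\<exists>c. min (coef n x c) (coef n y c) \<noteq> 0)"
    unfolding meet_one_iff[OF xy] by simp
  also have "\<dots> \<longleftrightarrow> (\<exists>c. 0 < coef n x c \<and> 0 < coef n y c)"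
  proof (rule arg_cong[where f = Ex], rule ext)
    show "(min (coef n x c) (coef n y c) \<noteq> 0) = (0 < coef n x c \<and> 0 < coef n y c)" for c
      using coef_posit[OF assms(1), of c] coef_posit[OF assms(2), of c] by (auto simp: min_def)
  qed
  finally show ?thesis .
qed

text \<open>The two parts are the positive and the negative part of the coordinates of the boundary.
  The last fact is the uniqueness half of the definite description; it is used to recognise the
  parts from a disjoint pair with the right difference.\<close>

lemma sbdry_coef:
  assumes x: "x \<in> carrier (chains K (Suc n))"
  shows "sbdry K \<alpha> n x \<in> carrier (chains K n)"
    and "coef n (sbdry K Pos n x) c = max 0 (coef n (bdry K n x) c)"
    and "coef n (sbdry K Neg n x) c = max 0 (- coef n (bdry K n x) c)"
    and "\<And>p q. p \<in> carrier (chains K n) \<Longrightarrow> q \<in> carrier (chains K n) \<Longrightarrow>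
      bdry K n x = q \<otimes>\<^bsub>chains K n\<^esub> inv\<^bsub>chains K n\<^esub> p \<Longrightarrow>
      p \<sqinter>\<^bsub>chain_order K n\<^esub> q = \<one>\<^bsub>chains K n\<^esub> \<Longrightarrow>
      sbdry K Neg n x = p \<and> sbdry K Pos n x = q"
proof -
  define d where "d = coef n (bdry K n x)"
  have dx: "bdry K n x \<in> carrier (chains K n)" using x by simp
  have fin: "finite {c. d c \<noteq> 0}" unfolding d_def by (rule coef_finite)
  have out: "c \<in> in_dim B n" if "d c \<noteq> 0" for c
    using that coef_nz[OF dx] unfolding d_def by blast
  have "finite {c. max 0 (d c) \<noteq> 0}" "finite {c. max 0 (- d c) \<noteq> 0}"
    by (rule finite_subset[OF _ fin], auto)+
  then obtain p q where p: "p \<in> carrier (chains K n)" "\<And>c. coef n p c = max 0 (- d c)"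
    and q: "q \<in> carrier (chains K n)" "\<And>c. coef n q c = max 0 (d c)"
    using coef_ex[of "\<lambda>c. max 0 (- d c)" n] coef_ex[of "\<lambda>c. max 0 (d c)" n] out
    by (metis (no_types, lifting) max.idem neg_equal_zero)
  have char: "(p' \<in> carrier (chains K n) \<and> q' \<in> carrier (chains K n) \<and>
      bdry K n x = q' \<otimes>\<^bsub>chains K n\<^esub> inv\<^bsub>chains K n\<^esub> p' \<and>
      p' \<sqinter>\<^bsub>chain_order K n\<^esub> q' = \<one>\<^bsub>chains K n\<^esub>) \<longleftrightarrow> p' = p \<and> q' = q" for p' q'
  proof
    assume a: "p' \<in> carrier (chains K n) \<and> q' \<in> carrier (chains K n) \<and>
      bdry K n x = q' \<otimes>\<^bsub>chains K n\<^esub> inv\<^bsub>chains K n\<^esub> p' \<and>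
      p' \<sqinter>\<^bsub>chain_order K n\<^esub> q' = \<one>\<^bsub>chains K n\<^esub>"
    then have dc: "d c = coef n q' c - coef n p' c" "min (coef n p' c) (coef n q' c) = 0" for c
      unfolding d_def by (auto simp: meet_one_iff)
    \<comment> \<open>As the minimum is zero, one of the two coordinates is zero and the difference
      determines the other.\<close>
    have "coef n p' c = coef n p c" "coef n q' c = coef n q c" for c
      unfolding p(2) q(2) using dc[of c] by linarith+

    then show "p' = p \<and> q' = q" using a p(1) q(1) coef_eqI by blast
  next
    assume "p' = p \<and> q' = q"
    moreover have "bdry K n x = q \<otimes>\<^bsub>chains K n\<^esub> inv\<^bsub>chains K n\<^esub> p"
      by (rule coef_eqI[OF dx]) (use p q in \<open>auto simp: d_def max_def\<close>)
    moreover have "p \<sqinter>\<^bsub>chain_order K n\<^esub> q = \<one>\<^bsub>chains K n\<^esub>"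
      using p q by (auto simp: meet_one_iff min_def max_def)
    ultimately show "p' \<in> carrier (chains K n) \<and> q' \<in> carrier (chains K n) \<and>
      bdry K n x = q' \<otimes>\<^bsub>chains K n\<^esub> inv\<^bsub>chains K n\<^esub> p' \<and>
      p' \<sqinter>\<^bsub>chain_order K n\<^esub> q' = \<one>\<^bsub>chains K n\<^esub>" using p q by simp
  qed
  have "bdry_parts K n x = (p, q)"
    unfolding bdry_parts_def char by auto
  then have eq: "sbdry K Neg n x = p" "sbdry K Pos n x = q" by (simp_all add: sbdry_def)
  show "sbdry K \<alpha> n x \<in> carrier (chains K n)" using eq p q by (cases \<alpha>) auto
  show "coef n (sbdry K Pos n x) c = max 0 (coef n (bdry K n x) c)"
    "coef n (sbdry K Neg n x) c = max 0 (- coef n (bdry K n x) c)"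
    using eq p q by (auto simp: d_def)
  show "sbdry K Neg n x = p' \<and> sbdry K Pos n x = q'"
    if "p' \<in> carrier (chains K n)" "q' \<in> carrier (chains K n)"
      "bdry K n x = q' \<otimes>\<^bsub>chains K n\<^esub> inv\<^bsub>chains K n\<^esub> p'"
      "p' \<sqinter>\<^bsub>chain_order K n\<^esub> q' = \<one>\<^bsub>chains K n\<^esub>" for p' q'
    using iffD1[OF char, of p' q'] that eq by simp
qed


section \<open>Atoms\<close>

lemma atom_above: "fst b < n \<Longrightarrow> atom K b \<alpha> n = \<one>\<^bsub>chains K n\<^esub>"
  by (cases b) (simp add: atom.simps)

lemma atom_top: "atom K b \<alpha> (fst b) = snd b"
  by (cases b) (simp add: atom.simps)

lemma atom_below: "n < fst b \<Longrightarrow> atom K b \<alpha> n = sbdry K \<alpha> n (atom K b \<alpha> (Suc n))"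
  using atom.simps[of K "fst b" "snd b" \<alpha> n] by simp

lemma in_dimI: "b \<in> B \<Longrightarrow> snd b \<in> in_dim B (fst b)"
  by (simp add: in_dim_def)

lemma atom_carrier:
  assumes b: "b \<in> B"
  shows "atom K b \<alpha> n \<in> carrier (chains K n)"
proof (cases "n \<le> fst b")
  case True
  then show ?thesis
  proof (induction rule: inc_induct)
    case base then show ?case using b basis_carrier in_dimI by (simp add: atom_top)
  next
    case (step n) then show ?case by (simp add: atom_below sbdry_coef(1))
  qed
qed (simp add: atom_above)

text \<open>The recursion for atoms treats the signs separately, so both signs must be shown to have
  the same boundary. This descends from the top, where the signs agree: if the two parts in one
  dimension differ by a boundary, applying the boundary again gives zero, so their own boundaries
  coincide.\<close>

lemma atom_bdry_eq:
  assumes b: "b \<in> B" and n: "n < fst b"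
  shows "atom K b Pos n \<otimes>\<^bsub>chains K n\<^esub> inv\<^bsub>chains K n\<^esub> atom K b Neg n = bdry K n (atom K b \<alpha> (Suc n))"
proof -
  have bstep: "bdry K n (atom K b Pos (Suc n)) = bdry K n (atom K b Neg (Suc n)) \<Longrightarrow>
      atom K b Pos n \<otimes>\<^bsub>chains K n\<^esub> inv\<^bsub>chains K n\<^esub> atom K b Neg n = bdry K n (atom K b \<alpha> (Suc n))"
    if "n < fst b" for n \<alpha>
  proof (rule coef_eqI)
    note [simp] = atom_carrier[OF b]
    assume eq: "bdry K n (atom K b Pos (Suc n)) = bdry K n (atom K b Neg (Suc n))"
    show "coef n (atom K b Pos n \<otimes>\<^bsub>chains K n\<^esub> inv\<^bsub>chains K n\<^esub> atom K b Neg n) c =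
        coef n (bdry K n (atom K b \<alpha> (Suc n))) c" for c
      using eq that by (cases \<alpha>) (simp_all add: atom_below[OF that] sbdry_coef max_def)
  qed (use atom_carrier[OF b] in auto)
  have "bdry K n (atom K b Pos (Suc n)) = bdry K n (atom K b Neg (Suc n))"
    using n
  proof (induction rule: strict_inc_induct)
    case (base i) then show ?case using atom_top[of b] by metis
  next
    case (step i)
    note [simp] = atom_carrier[OF b]
    have "bdry K i (atom K b Pos (Suc i) \<otimes>\<^bsub>chains K (Suc i)\<^esub> inv\<^bsub>chains K (Suc i)\<^esub> atom K b Neg (Suc i)) = \<one>\<^bsub>chains K i\<^esub>"
      using bstep[OF step(1) step(2), of Pos] bdry_bdry by simp
    then show ?case
      using G.inv_solve_right'[of "\<one>\<^bsub>chains K i\<^esub>" i "bdry K i (atom K b Pos (Suc i))" "bdry K i (atom K b Neg (Suc i))"]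
      by simp
  qed
  then show ?thesis by (rule bstep[OF n])
qed

lemma atom_disjoint:
  assumes "b \<in> B" "n < fst b"
  shows "coef n (atom K b Pos n) c = 0 \<or> coef n (atom K b Neg n) c = 0"
proof -
  have "bdry K n (atom K b Pos (Suc n)) = bdry K n (atom K b Neg (Suc n))"
    using atom_bdry_eq[OF assms] by metis
  then show ?thesis
    using assms atom_carrier[OF assms(1)] by (simp add: atom_below sbdry_coef max_def)
qed

lemma atom_posit:
  assumes "b \<in> B" shows "atom K b \<alpha> n \<in> posit K n"
proof -
  consider "n < fst b" | "n = fst b" | "n > fst b" by linarith
  then show ?thesis
  proof cases
    case 1
    then have "0 \<le> coef n (atom K b \<alpha> n) c" for c
      using atom_carrier[OF assms] by (cases \<alpha>) (simp_all add: atom_below sbdry_coef)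
    then show ?thesis using posit_iff atom_carrier[OF assms] by blast
  qed (use assms in \<open>auto simp: atom_top atom_above posit_one intro: basis_posit in_dimI\<close>)
qed

lemma atom_coef_nonneg: "b \<in> B \<Longrightarrow> 0 \<le> coef n (atom K b \<alpha> n) c"
  using coef_posit atom_posit by blast

text \<open>The boundary parts of zero are zero, so vanishing of an atom in one dimension, up to its
  own, propagates downwards. Together with augmentation 1 in dimension 0 this yields
  \<open>atom_nonzero\<close>.\<close>

lemma atom_nonzero_below:
  assumes b: "b \<in> B" and n: "n \<le> m" "m \<le> fst b" and nz: "atom K b \<alpha> n \<noteq> \<one>\<^bsub>chains K n\<^esub>"
  shows "atom K b \<alpha> m \<noteq> \<one>\<^bsub>chains K m\<^esub>"
  using n(1) n(2)
proof (induction rule: dec_induct)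
  case base then show ?case using nz by simp
next
  case (step m)
  show ?case
  proof
    assume z: "atom K b \<alpha> (Suc m) = \<one>\<^bsub>chains K (Suc m)\<^esub>"
    have "atom K b \<alpha> m = \<one>\<^bsub>chains K m\<^esub>"
    proof (rule coef_eqI)
      show "coef m (atom K b \<alpha> m) c = coef m \<one>\<^bsub>chains K m\<^esub> c" for c
        using step z sbdry_coef[of "\<one>\<^bsub>chains K (Suc m)\<^esub>" m]
        by (cases \<alpha>) (simp_all add: atom_below)
    qed (use atom_carrier[OF b] in auto)
    with step show False by simp
  qed
qed

lemma coef_self: "b \<in> B \<Longrightarrow> coef (fst b) (snd b) c = (if c = snd b then 1 else 0)"
  using coef_basis[OF in_dimI] by simp

text \<open>The coordinates of \<open>x\<close> are nonnegative, so a positive coordinate of the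
  signed boundary needs a term of \<open>x\<close> that contributes with the same sign. The factor
  \<open>\<sigma>\<close> treats both signs at once.\<close>

lemma sbdry_pos_obtain:
  assumes x: "x \<in> posit K (Suc n)" and c: "0 < coef n (sbdry K \<alpha> n x) c"
  obtains a where "a \<in> in_dim B (Suc n)" "0 < coef (Suc n) x a" "c \<in> in_dim B n"
    "c \<sqsubseteq>\<^bsub>chain_order K n\<^esub> sbdry K \<alpha> n a"
proof -
  define \<sigma> :: int where "\<sigma> = (case \<alpha> of Neg \<Rightarrow> - 1 | Pos \<Rightarrow> 1)"
  have sb: "coef n (sbdry K \<alpha> n y) d = max 0 (\<sigma> * coef n (bdry K n y) d)"
    if "y \<in> carrier (chains K (Suc n))" for y d
    using sbdry_coef[OF that] by (cases \<alpha>) (simp_all add: \<sigma>_def)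
  note xc = posit_carrier[OF x]
  have "0 < \<sigma> * coef n (bdry K n x) c" using c unfolding sb[OF xc] by linarith
  then have "0 < (\<Sum>a | coef (Suc n) x a \<noteq> 0. coef (Suc n) x a * (\<sigma> * coef n (bdry K n a) c))"
    unfolding coef_bdry_expand[OF xc] sum_distrib_left by (simp add: mult.left_commute)
  then obtain a where a: "coef (Suc n) x a \<noteq> 0" "0 < coef (Suc n) x a * (\<sigma> * coef n (bdry K n a) c)"
    by (metis (mono_tags, lifting) leD mem_Collect_eq not_le_imp_less sum_nonpos)
  then have pos: "0 < coef (Suc n) x a" "0 < \<sigma> * coef n (bdry K n a) c"
    using coef_posit[OF x, of a] by (auto simp: zero_less_mult_iff)
  have aB: "a \<in> in_dim B (Suc n)" using coef_nz[OF xc a(1)] .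
  note ac = basis_carrier[OF aB]
  have "coef n (bdry K n a) c \<noteq> 0" using pos(2) by (metis less_irrefl mult_zero_right)
  then have cB: "c \<in> in_dim B n" using coef_nz[of "bdry K n a" n c] ac by simp
  have "c \<sqsubseteq>\<^bsub>chain_order K n\<^esub> sbdry K \<alpha> n a"
    using pos(2) sbdry_coef(1)[OF ac] basis_carrier[OF cB] by (auto simp: le_iff sb[OF ac] coef_basis[OF cB])
  then show thesis using that aB pos(1) cB by blast
qed

text \<open>One order serves in every dimension. By descent through the dimensions,
  \<open>key\<close> places a basis element of a positive part of \<open>b\<close> above
  \<open>b\<close> and one of a negative part below \<open>b\<close>; an element common to the
  positive part of \<open>a\<close> and the negative part of \<open>b\<close> thus lies between
  \<open>a\<close> and \<open>b\<close>.\<close>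

lemma strongly_loop_free_imp_loop_free:
  assumes "strongly_loop_free K B"
  shows "loop_free K B"
proof -
  obtain R where po: "partial_order_on B R"
    and R: "\<And>p a q b. (p, a) \<in> B \<Longrightarrow> (q, b) \<in> B \<Longrightarrow>
        q = Suc p \<and> a \<sqsubseteq>\<^bsub>chain_order K p\<^esub> sbdry K Neg p b \<or>
        p = Suc q \<and> b \<sqsubseteq>\<^bsub>chain_order K q\<^esub> sbdry K Pos q a \<Longrightarrow>
        ((p, a), (q, b)) \<in> R"
    using assms unfolding strongly_loop_free_def by blast
  have refl: "\<And>a. a \<in> B \<Longrightarrow> (a, a) \<in> R" and trans: "trans R" and anti: "antisym R"
    using po by (auto simp: partial_order_on_def preorder_on_def refl_on_def)
  have key: "case \<alpha> of Pos \<Rightarrow> (b, (n, c)) \<in> R | Neg \<Rightarrow> ((n, c), b) \<in> R"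
    if b: "b \<in> B" and n: "n \<le> fst b" and c: "0 < coef n (atom K b \<alpha> n) c" for b n c \<alpha>
    using n c
  proof (induction arbitrary: c rule: inc_induct)
    case base
    then have "(fst b, c) = b" using coef_self[OF b, of c] by (auto simp: atom_top split: if_splits)
    then show ?case using refl[OF b] by (cases \<alpha>) auto
  next
    case (step n)
    obtain a where a: "a \<in> in_dim B (Suc n)" "0 < coef (Suc n) (atom K b \<alpha> (Suc n)) a"
      "c \<in> in_dim B n" "c \<sqsubseteq>\<^bsub>chain_order K n\<^esub> sbdry K \<alpha> n a"
      using sbdry_pos_obtain[OF atom_posit[OF b]] step.prems atom_below[OF step.hyps(2)] by metis
    note IH = step.IH[OF a(2)]
    show ?case
    proof (cases \<alpha>)
      case Neg
      then have "((n, c), (Suc n, a)) \<in> R" using a by (intro R) (auto simp: in_dim_def)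
      then show ?thesis using IH trans Neg by (auto dest: transD)
    next
      case Pos
      then have "((Suc n, a), (n, c)) \<in> R" using a by (intro R) (auto simp: in_dim_def)
      then show ?thesis using IH trans Pos by (auto dest: transD)
    qed
  qed
  have "(a, b) \<in> R \<and> a \<noteq> b"
    if ab: "a \<in> B" "b \<in> B" "n < fst a" "n < fst b"
      and m: "\<one>\<^bsub>chains K n\<^esub> \<sqsubset>\<^bsub>chain_order K n\<^esub> (atom K a Pos n \<sqinter>\<^bsub>chain_order K n\<^esub> atom K b Neg n)"
    for a b n
  proof -
    obtain c where c: "0 < coef n (atom K a Pos n) c" "0 < coef n (atom K b Neg n) c"
      using m one_less_meet_iff[OF atom_posit[OF ab(1)] atom_posit[OF ab(2)]] by blast
    have 1: "(a, (n, c)) \<in> R" "((n, c), b) \<in> R"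
      using key[OF ab(1) _ c(1)] key[OF ab(2) _ c(2)] ab by auto
    then have "(a, b) \<in> R" using trans by (meson transD)
    \<comment> \<open>Equality would squeeze \<open>(n, c)\<close> between \<open>a\<close> and
      itself, but \<open>n\<close> is smaller than the dimension of \<open>a\<close>.\<close>
    moreover have "a \<noteq> b"
    proof
      assume "a = b"
      then have "a = (n, c)" using 1 anti by (metis antisymD)
      then show False using ab by simp
    qed
    ultimately show ?thesis by simp
  qed
  then show ?thesis
    unfolding loop_free_def using po by (intro exI[of _ "\<lambda>_. R"]) blast
qed

text \<open>Uniqueness of bases rests on this intrinsic description by the indecomposables of the
  positive cone. It later identifies bases that come from different existence statements.\<close>

lemma basis_indecomposable:
  "b \<in> in_dim B n \<longleftrightarrow> b \<in> posit K n \<and> b \<noteq> \<one>\<^bsub>chains K n\<^esub> \<and>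
    (\<forall>x\<in>posit K n. \<forall>y\<in>posit K n. b = x \<otimes>\<^bsub>chains K n\<^esub> y \<longrightarrow> x = \<one>\<^bsub>chains K n\<^esub> \<or> y = \<one>\<^bsub>chains K n\<^esub>)"
proof
  assume b: "b \<in> in_dim B n"
  have "x = \<one>\<^bsub>chains K n\<^esub> \<or> y = \<one>\<^bsub>chains K n\<^esub>"
    if x: "x \<in> posit K n" and y: "y \<in> posit K n" and xy: "b = x \<otimes>\<^bsub>chains K n\<^esub> y" for x y
  proof -
    note [simp] = posit_carrier[OF x] posit_carrier[OF y]
    have c: "coef n x c + coef n y c = (if c = b then 1 else 0)" for c
      using coef_basis[OF b, of c] xy by simp
    have nn: "0 \<le> coef n x c" "0 \<le> coef n y c" for c using coef_posit x y by auto
    have z: "coef n x c = 0" "coef n y c = 0" if "c \<noteq> b" for c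
      using c[of c] nn[of c] that by auto
    consider "coef n x b = 0" | "coef n y b = 0" using c[of b] nn[of b] by force
    then show ?thesis
    proof cases
      case 1
      then have "coef n x c = 0" for c using z by metis
      then show ?thesis using coef_eqI[of x n "\<one>\<^bsub>chains K n\<^esub>"] by simp
    next
      case 2
      then have "coef n y c = 0" for c using z by metis
      then show ?thesis using coef_eqI[of y n "\<one>\<^bsub>chains K n\<^esub>"] by simp
    qed
  qed
  moreover have "b \<noteq> \<one>\<^bsub>chains K n\<^esub>" using coef_basis[OF b, of b] by auto
  ultimately show "b \<in> posit K n \<and> b \<noteq> \<one>\<^bsub>chains K n\<^esub> \<and>
    (\<forall>x\<in>posit K n. \<forall>y\<in>posit K n. b = x \<otimes>\<^bsub>chains K n\<^esub> y \<longrightarrow> x = \<one>\<^bsub>chains K n\<^esub> \<or> y = \<one>\<^bsub>chains K n\<^esub>)"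
    using basis_posit[OF b] by blast
next
  assume a: "b \<in> posit K n \<and> b \<noteq> \<one>\<^bsub>chains K n\<^esub> \<and>
    (\<forall>x\<in>posit K n. \<forall>y\<in>posit K n. b = x \<otimes>\<^bsub>chains K n\<^esub> y \<longrightarrow> x = \<one>\<^bsub>chains K n\<^esub> \<or> y = \<one>\<^bsub>chains K n\<^esub>)"
  have bc: "b \<in> carrier (chains K n)" using a posit_carrier by blast
  obtain c where c: "coef n b c \<noteq> 0"
    using a coef_eqI[of b n "\<one>\<^bsub>chains K n\<^esub>"] bc by auto
  then have cp: "0 < coef n b c" using a coef_posit[of b n c] by linarith
  have cB: "c \<in> in_dim B n" using coef_nz[OF bc c] .
  note cc = basis_carrier[OF cB]
  let ?y = "b \<otimes>\<^bsub>chains K n\<^esub> inv\<^bsub>chains K n\<^esub> c"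
  have y: "?y \<in> posit K n"
    using bc cc cp a coef_posit[of b n] by (auto simp: posit_iff coef_basis[OF cB])
  have "b = c \<otimes>\<^bsub>chains K n\<^esub> ?y"
    using bc cc by (intro coef_eqI[of b n]) simp_all
  then have "c = \<one>\<^bsub>chains K n\<^esub> \<or> ?y = \<one>\<^bsub>chains K n\<^esub>"
    using a y basis_posit[OF cB] by blast
  moreover have "c \<noteq> \<one>\<^bsub>chains K n\<^esub>" using coef_basis[OF cB, of c] by auto
  ultimately have "?y = \<one>\<^bsub>chains K n\<^esub>" by simp
  then have "b = c" using \<open>b = c \<otimes>\<^bsub>chains K n\<^esub> ?y\<close> cc by simp
  then show "b \<in> in_dim B n" using cB by simp
qed

end

lemma adc_basis_unique:
  assumes "adc K" "adc_basis K B" "adc_basis K B'"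
  shows "B = B'"
proof -
  interpret B: based_adc K B using assms by (simp add: based_adc_def based_adc_axioms_def)
  interpret B': based_adc K B' using assms by (simp add: based_adc_def based_adc_axioms_def)
  have "in_dim B n = in_dim B' n" for n
    using B.basis_indecomposable B'.basis_indecomposable by blast
  then show ?thesis by (auto simp: in_dim_def)
qed


section \<open>Decompositions in \<open>\<nu> K\<close> for a loop-free unital basis\<close>

locale loop_free_adc = based_adc K B for K :: "'k adc_data" and B +
  fixes R :: "nat \<Rightarrow> (nat \<times> 'k) rel"
  assumes unital: "unital K B"
    and order: "partial_order_on B (R n)"
    and loop_free: "a \<in> B \<Longrightarrow> b \<in> B \<Longrightarrow> n < fst a \<Longrightarrow> n < fst b \<Longrightarrow>
      \<one>\<^bsub>chains K n\<^esub> \<sqsubset>\<^bsub>chain_order K n\<^esub>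
        (atom K a Pos n \<sqinter>\<^bsub>chain_order K n\<^esub> atom K b Neg n) \<Longrightarrow>
      (a, b) \<in> R n \<and> a \<noteq> b"
begin

abbreviation cell_coef :: "(sign \<Rightarrow> nat \<Rightarrow> 'k) \<Rightarrow> sign \<Rightarrow> nat \<Rightarrow> 'k \<Rightarrow> int" where
  "cell_coef x \<alpha> n c \<equiv> coef n (x \<alpha> n) c"

definition arrow :: "nat \<Rightarrow> nat \<times> 'k \<Rightarrow> nat \<times> 'k \<Rightarrow> bool" where
  "arrow n a b \<longleftrightarrow> (\<exists>c. 0 < cell_coef (atom K a) Pos n c \<and> 0 < cell_coef (atom K b) Neg n c)"

lemma arrow_R: "a \<in> B \<Longrightarrow> b \<in> B \<Longrightarrow> n < fst a \<Longrightarrow> n < fst b \<Longrightarrow> arrow n a b \<Longrightarrow> (a, b) \<in> R n \<and> a \<noteq> b"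
  using loop_free one_less_meet_iff[OF atom_posit atom_posit] unfolding arrow_def by blast

lemma R_refl: "a \<in> B \<Longrightarrow> (a, a) \<in> R n"
  using order[of n] by (auto simp: partial_order_on_def preorder_on_def refl_on_def)

lemma R_trans: "(a, b) \<in> R n \<Longrightarrow> (b, c) \<in> R n \<Longrightarrow> (a, c) \<in> R n"
  using order[of n] unfolding partial_order_on_def preorder_on_def by (meson transD)

lemma R_antisym: "(a, b) \<in> R n \<Longrightarrow> (b, a) \<in> R n \<Longrightarrow> a = b"
  using order[of n] unfolding partial_order_on_def by (meson antisymD)

text \<open>The strict part of \<open>R r\<close> on a finite set is well-founded. A minimal element
  has no incoming arrow, not even from itself, because arrows are strict in
  \<open>R r\<close>.\<close>

lemma minimal_ex:
  assumes S: "finite S" "S \<noteq> {}" "S \<subseteq> B" "\<And>s. s \<in> S \<Longrightarrow> r < fst s"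
  obtains a where "a \<in> S" "\<And>s. s \<in> S \<Longrightarrow> \<not> arrow r s a"
proof -
  define Q where "Q = {(s, t). s \<in> S \<and> t \<in> S \<and> (s, t) \<in> R r \<and> s \<noteq> t}"
  have "Q \<subseteq> S \<times> S" by (auto simp: Q_def)
  then have "finite Q" using S(1) by (meson finite_SigmaI finite_subset)
  moreover have "trans Q"
    unfolding trans_def Q_def using R_trans[of _ _ r] R_antisym[of _ _ r] by blast
  then have "acyclic Q" unfolding acyclic_def by (simp add: trancl_id) (simp add: Q_def)
  ultimately have "wf Q" by (rule finite_acyclic_wf)
  then obtain a where "a \<in> S" "\<And>s. (s, a) \<in> Q \<Longrightarrow> s \<notin> S"
    using wfE_min S(2) by (metis ex_in_conv)
  then have aQ: "a \<in> S" "\<And>s. s \<in> S \<Longrightarrow> (s, a) \<notin> Q" by blast+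
  have a: "a \<in> S" "\<And>s. s \<in> S \<Longrightarrow> \<not> ((s, a) \<in> R r \<and> s \<noteq> a)"
    using aQ unfolding Q_def by blast+
  show thesis
  proof (rule that[OF a(1)])
    fix s assume s: "s \<in> S"
    show "\<not> arrow r s a"
      using a(2)[OF s] arrow_R[of s a r] s a(1) S(3) S(4)[OF s] S(4)[OF a(1)] by blast
  qed
qed

section \<open>Atoms as cells of \<open>nu K\<close>\<close>

lemma atom_nu: "b \<in> B \<Longrightarrow> atom K b \<in> carrier (nu K)"
proof -
  assume b: "b \<in> B"
  have "atom K b Pos n \<otimes>\<^bsub>chains K n\<^esub> inv\<^bsub>chains K n\<^esub> atom K b Neg n = bdry K n (atom K b \<alpha> (Suc n))" for n \<alpha>
  proof -
    consider "n < fst b" | "n = fst b" | "n > fst b" by linarith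
    then show ?thesis
    proof cases
      case 1 then show ?thesis using atom_bdry_eq b by blast
    next
      case 2
      have "atom K b \<alpha> (Suc (fst b)) = \<one>\<^bsub>chains K (Suc (fst b))\<^esub>" by (simp add: atom_above)
      then show ?thesis using 2 basis_carrier[OF in_dimI[OF b]] by (simp add: atom_top)
    qed (simp add: atom_above)
  qed
  moreover have "\<exists>N. \<forall>\<alpha>. \<forall>n\<ge>N. atom K b \<alpha> n = \<one>\<^bsub>chains K n\<^esub>"
    by (rule exI[of _ "Suc (fst b)"]) (auto simp: atom_above)
  ultimately show ?thesis
    unfolding nu_carrier_iff using b atom_posit unital by (auto simp: unital_def)
qed

lemma atom_cells: "b \<in> B \<Longrightarrow> atom K b \<in> cells (nu K) (fst b)"
  unfolding nu_cells_iff using atom_nu by (auto simp: atom_above)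

lemma aug_one_zero: "aug K \<one>\<^bsub>chains K 0\<^esub> = 0"
  using aug_expand[of "\<one>\<^bsub>chains K 0\<^esub>"] by simp

lemma atom_nonzero: "b \<in> B \<Longrightarrow> n \<le> fst b \<Longrightarrow> atom K b \<alpha> n \<noteq> \<one>\<^bsub>chains K n\<^esub>"
  using atom_nonzero_below[of b 0 n \<alpha>] unital aug_one_zero unfolding unital_def
  by (metis le0 zero_neq_one)

lemma atom_coef_pos:
  assumes "b \<in> B" "n \<le> fst b"
  obtains c where "0 < cell_coef (atom K b) \<alpha> n c"
proof -
  obtain c where "cell_coef (atom K b) \<alpha> n c \<noteq> 0"
    using coef_eqI[of "atom K b \<alpha> n" n "\<one>\<^bsub>chains K n\<^esub>"] atom_nonzero[OF assms] atom_carrier[OF assms(1)] by auto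
  then show thesis using that[of c] atom_coef_nonneg[OF assms(1), of n \<alpha> c] by simp
qed

lemma atom_coef_top: "b \<in> B \<Longrightarrow> cell_coef (atom K b) \<alpha> (fst b) c = (if c = snd b then 1 else 0)"
  by (simp add: atom_top coef_self)

lemma atom_coef_above: "fst b < n \<Longrightarrow> cell_coef (atom K b) \<alpha> n c = 0"
  by (simp add: atom_above)

lemma atom_inj: "a \<in> B \<Longrightarrow> b \<in> B \<Longrightarrow> atom K a = atom K b \<Longrightarrow> a = b"
proof -
  assume a: "a \<in> B" and b: "b \<in> B" and eq: "atom K a = atom K b"
  have "\<not> fst a < fst b" if "a \<in> B" "b \<in> B" "atom K a = atom K b" for a b
    using that atom_nonzero[of b "fst b" Neg] atom_above[of a "fst b" Neg] by auto
  then have "fst a = fst b" using a b eq by (metis nat_neq_iff)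
  then show "a = b" using eq atom_top[of a Neg] atom_top[of b Neg] by (metis prod_eqI)
qed

lemma cell_nonneg: "x \<in> carrier (nu K) \<Longrightarrow> 0 \<le> cell_coef x \<alpha> n c"
  using coef_posit nuD(1) by blast

lemma cell_bdry:
  assumes "x \<in> carrier (nu K)"
  shows "coef n (bdry K n (x \<alpha> (Suc n))) c = cell_coef x Pos n c - cell_coef x Neg n c"
  using nuD(2)[OF assms] by (simp flip: nuD(3)[OF assms])

lemma cell_eqI:
  assumes "x \<in> carrier (nu K)" "y \<in> carrier (nu K)" "\<And>\<alpha> n c. cell_coef x \<alpha> n c = cell_coef y \<alpha> n c"
  shows "x = y"
  using assms by (intro ext coef_eqI[of _ _ ]) (auto intro: nuD(2) coef_eqI)

section \<open>Sums of atoms, cuts, and bounds on coordinates\<close>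

lemma coef_bdry_sum:
  assumes I: "finite I" and f: "\<And>i. i \<in> I \<Longrightarrow> f i \<in> carrier (chains K (Suc n))"
    and x: "x \<in> carrier (chains K (Suc n))" "\<And>c. coef (Suc n) x c = (\<Sum>i\<in>I. coef (Suc n) (f i) c)"
  shows "coef n (bdry K n x) c = (\<Sum>i\<in>I. coef n (bdry K n (f i)) c)"
proof -
  have fp: "finprod (chains K (Suc n)) f I \<in> carrier (chains K (Suc n))"
    using f by (auto intro: G.finprod_closed)
  have "x = finprod (chains K (Suc n)) f I"
    by (rule coef_eqI[OF x(1) fp]) (simp add: x(2) coef_finprod[OF I f])
  moreover have "coef n (bdry K n (finprod (chains K (Suc n)) f I)) c = (\<Sum>i\<in>I. coef n (bdry K n (f i)) c)"
    using I f
  proof (induction I rule: finite_induct)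
    case (insert i I)
    then have "f \<in> I \<rightarrow> carrier (chains K (Suc n))" "f i \<in> carrier (chains K (Suc n))" by auto
    with insert show ?case by simp
  qed simp
  ultimately show ?thesis by simp
qed

text \<open>Above dimension \<open>r\<close>, the cell \<open>x\<close> is the sum of the atoms \<open>e i\<close>. A family rather than a set is
  used because sums of atoms are shown to be free of repetitions only in \<open>cell_coef_le_1\<close>.\<close>

definition atom_sum :: "nat \<Rightarrow> ('i \<Rightarrow> nat \<times> 'k) \<Rightarrow> 'i set \<Rightarrow> (sign \<Rightarrow> nat \<Rightarrow> 'k) \<Rightarrow> bool" where
  "atom_sum r e I x \<longleftrightarrow> x \<in> carrier (nu K) \<and> finite I \<and> (\<forall>i\<in>I. e i \<in> B \<and> r < fst (e i)) \<and>
     (\<forall>j>r. \<forall>\<alpha> c. cell_coef x \<alpha> j c = (\<Sum>i\<in>I. cell_coef (atom K (e i)) \<alpha> j c))"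

lemma atom_sumD:
  assumes "atom_sum r e I x"
  shows "x \<in> carrier (nu K)" "finite I" "\<And>i. i \<in> I \<Longrightarrow> e i \<in> B" "\<And>i. i \<in> I \<Longrightarrow> r < fst (e i)"
    "\<And>j \<alpha> c. r < j \<Longrightarrow> cell_coef x \<alpha> j c = (\<Sum>i\<in>I. cell_coef (atom K (e i)) \<alpha> j c)"
  using assms by (auto simp: atom_sum_def)

text \<open>It suffices to apply the boundary to one equation in dimension \<open>r + 1\<close>, for
  a single sign \<open>\<alpha>\<close>. The hypothesis is kept this weak because
  \<open>set_sum_split\<close> applies it to factors not yet known to be sums of atoms in lower
  dimensions.\<close>

lemma sum_atoms_bdry:
  assumes x: "x \<in> carrier (nu K)" and I: "finite I" "\<And>i. i \<in> I \<Longrightarrow> e i \<in> B"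
    and eq: "\<And>c. cell_coef x \<alpha> (Suc r) c = (\<Sum>i\<in>I. cell_coef (atom K (e i)) \<alpha> (Suc r) c)"
  shows "cell_coef x Pos r c + (\<Sum>i\<in>I. cell_coef (atom K (e i)) Neg r c) =
    cell_coef x Neg r c + (\<Sum>i\<in>I. cell_coef (atom K (e i)) Pos r c)"
proof -
  have "cell_coef x Pos r c - cell_coef x Neg r c = (\<Sum>i\<in>I. coef r (bdry K r (atom K (e i) \<alpha> (Suc r))) c)"
    unfolding cell_bdry[OF x, of r \<alpha> c, symmetric]
    by (rule coef_bdry_sum) (use I eq nuD(2)[OF x] atom_carrier in auto)
  also have "\<dots> = (\<Sum>i\<in>I. cell_coef (atom K (e i)) Pos r c - cell_coef (atom K (e i)) Neg r c)"
    by (rule sum.cong) (use I cell_bdry[OF atom_nu] in auto)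
  finally show ?thesis by (simp add: sum_subtractf)
qed

lemma atom_sum_bdry:
  assumes "atom_sum r e I x"
  shows "cell_coef x Pos r c + (\<Sum>i\<in>I. cell_coef (atom K (e i)) Neg r c) =
    cell_coef x Neg r c + (\<Sum>i\<in>I. cell_coef (atom K (e i)) Pos r c)"
  using atom_sumD[OF assms] by (intro sum_atoms_bdry[where \<alpha> = Neg]) auto

text \<open>A cell is assembled from \<open>x\<close> below \<open>r\<close>, a new pair
  \<open>(p, q)\<close> in dimension \<open>r\<close> and the sum of atoms above. The conditions
  guard the seams: \<open>eq\<close> between \<open>r + 1\<close> and \<open>r\<close>,
  \<open>low\<close> between \<open>r\<close> and \<open>r - 1\<close>, and \<open>au\<close> in
  place of \<open>low\<close> when \<open>r = 0\<close>.\<close>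

lemma atom_sum_splice:
  assumes x: "x \<in> carrier (nu K)" and I: "finite I" "\<And>i. i \<in> I \<Longrightarrow> e i \<in> B" "\<And>i. i \<in> I \<Longrightarrow> r < fst (e i)"
    and p: "p \<in> posit K r" and q: "q \<in> posit K r"
    and eq: "\<And>c. coef r q c + (\<Sum>i\<in>I. cell_coef (atom K (e i)) Neg r c) =
        coef r p c + (\<Sum>i\<in>I. cell_coef (atom K (e i)) Pos r c)"
    and low: "\<And>k. Suc k = r \<Longrightarrow> bdry K k p = bdry K k (x Neg r)" "\<And>k. Suc k = r \<Longrightarrow> bdry K k q = bdry K k (x Neg r)"
    and au: "r = 0 \<Longrightarrow> aug K p = 1" "r = 0 \<Longrightarrow> aug K q = 1"
  shows "atom_sum r e I (\<lambda>\<beta> i. if i < r then x \<beta> i else if i = r then (case \<beta> of Neg \<Rightarrow> p | Pos \<Rightarrow> q)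
    else finprod (chains K i) (\<lambda>k. atom K (e k) \<beta> i) I)" (is "atom_sum r e I ?u")
proof -
  let ?U = "\<lambda>\<beta> i. finprod (chains K i) (\<lambda>k. atom K (e k) \<beta> i) I"
  have U: "?U \<beta> i \<in> posit K i" for \<beta> i
    by (rule finprod_posit) (use I atom_posit in auto)
  note Uc = U[THEN posit_carrier]
  have cU: "coef i (?U \<beta> i) c = (\<Sum>k\<in>I. cell_coef (atom K (e k)) \<beta> i c)" for \<beta> i c
    by (rule coef_finprod) (use I atom_carrier in auto)
  have bU: "coef i (bdry K i (?U \<beta> (Suc i))) c =
      (\<Sum>k\<in>I. cell_coef (atom K (e k)) Pos i c) - (\<Sum>k\<in>I. cell_coef (atom K (e k)) Neg i c)" for \<beta> i c
  proof -
    have "coef i (bdry K i (?U \<beta> (Suc i))) c = (\<Sum>k\<in>I. coef i (bdry K i (atom K (e k) \<beta> (Suc i))) c)"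
      by (rule coef_bdry_sum) (use I atom_carrier Uc cU in auto)
    also have "\<dots> = (\<Sum>k\<in>I. cell_coef (atom K (e k)) Pos i c - cell_coef (atom K (e k)) Neg i c)"
      by (rule sum.cong) (use I cell_bdry[OF atom_nu] in auto)
    finally show ?thesis by (simp add: sum_subtractf)
  qed
  note pq = p[THEN posit_carrier] q[THEN posit_carrier]
  have "?u Pos n \<otimes>\<^bsub>chains K n\<^esub> inv\<^bsub>chains K n\<^esub> ?u Neg n = bdry K n (?u \<beta> (Suc n))" for n \<beta>
  proof -
    consider "Suc n < r" | "Suc n = r" | "n = r" | "n > r" by linarith
    then show ?thesis
    proof cases
      case 1 then show ?thesis using nuD(3)[OF x] by simp
    next
      case 2 then show ?thesis using nuD(3)[OF x, of n Neg] low[OF 2] by (cases \<beta>) auto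
    next
      case 3
      have "coef r (q \<otimes>\<^bsub>chains K r\<^esub> inv\<^bsub>chains K r\<^esub> p) c = coef r (bdry K r (?U \<beta> (Suc r))) c" for c
        using eq[of c] pq by (simp add: bU)
      then have "q \<otimes>\<^bsub>chains K r\<^esub> inv\<^bsub>chains K r\<^esub> p = bdry K r (?U \<beta> (Suc r))"
        using pq Uc by (intro coef_eqI[of _ r]) auto
      then show ?thesis using 3 by simp
    next
      case 4
      have "coef n (?U Pos n \<otimes>\<^bsub>chains K n\<^esub> inv\<^bsub>chains K n\<^esub> ?U Neg n) c = coef n (bdry K n (?U \<beta> (Suc n))) c" for c
        using Uc by (simp add: bU cU)
      then have "?U Pos n \<otimes>\<^bsub>chains K n\<^esub> inv\<^bsub>chains K n\<^esub> ?U Neg n = bdry K n (?U \<beta> (Suc n))"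
        using Uc by (intro coef_eqI[of _ n]) auto
      then show ?thesis using 4 by simp
    qed
  qed
  moreover have "\<exists>N. \<forall>\<beta>. \<forall>n\<ge>N. ?u \<beta> n = \<one>\<^bsub>chains K n\<^esub>"
  proof (intro exI allI impI)
    \<comment> \<open>The sum of all dimensions is a crude common bound for the dimensions of the
      atoms.\<close>
    fix \<beta> n assume n: "Suc (r + (\<Sum>k\<in>I. fst (e k))) \<le> n"
    have "fst (e k) < n" if "k \<in> I" for k
      using n member_le_sum[OF that, of "\<lambda>k. fst (e k)"] I(1) by simp
    then have "?U \<beta> n = \<one>\<^bsub>chains K n\<^esub>" by (intro G.finprod_one_eqI) (simp add: atom_above)
    then show "?u \<beta> n = \<one>\<^bsub>chains K n\<^esub>" using n by simp
  qed
  ultimately have "?u \<in> carrier (nu K)"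
    unfolding nu_carrier_iff using nuD(1,4)[OF x] p q U au by (auto split: sign.splits)
  then show ?thesis
    unfolding atom_sum_def using I by (simp add: cU)
qed

text \<open>The middle part can only be \<open>x Neg r\<close> plus the boundary of the atoms in
  \<open>P\<close>; closure of \<open>P\<close> under predecessors is what makes it
  positive.\<close>

lemma atom_sum_cut:
  assumes x: "atom_sum r e I x" and P: "P \<subseteq> I"
    and closed: "\<And>s t. s \<in> I \<Longrightarrow> t \<in> P \<Longrightarrow> arrow r (e s) (e t) \<Longrightarrow> s \<in> P"
  obtains u v where "composable (nu K) r u v" "x = cmp (nu K) r u v" "atom_sum r e P u" "atom_sum r e (I - P) v"
proof -
  note xD = atom_sumD[OF x]
  have fP: "finite P" using P xD(2) finite_subset by blast
  let ?a = "\<lambda>J \<alpha> c. \<Sum>i\<in>J. cell_coef (atom K (e i)) \<alpha> r c"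
  let ?U = "finprod (chains K (Suc r)) (\<lambda>k. atom K (e k) Neg (Suc r)) P"
  have Uc: "?U \<in> carrier (chains K (Suc r))"
    using P xD(3) by (intro G.finprod_closed) (auto intro: atom_carrier[OF xD(3)])
  define q where "q = x Neg r \<otimes>\<^bsub>chains K r\<^esub> bdry K r ?U"
  have qc: "q \<in> carrier (chains K r)" unfolding q_def using nuD(2)[OF xD(1)] Uc by simp
  have split: "?a I \<alpha> c = ?a P \<alpha> c + ?a (I - P) \<alpha> c" for \<alpha> c
    by (metis (no_types, lifting) P sum.subset_diff xD(2) add.commute)
  have a_nonneg: "0 \<le> ?a J \<alpha> c" if "J \<subseteq> I" for J \<alpha> c
    using that xD(3) atom_coef_nonneg by (intro sum_nonneg) blast
  have "coef r (bdry K r ?U) c = (\<Sum>k\<in>P. coef r (bdry K r (atom K (e k) Neg (Suc r))) c)" for c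
    by (rule coef_bdry_sum[OF fP _ Uc coef_finprod[OF fP]]) (blast intro: atom_carrier xD(3) subsetD[OF P])+
  also have "(\<Sum>k\<in>P. coef r (bdry K r (atom K (e k) Neg (Suc r))) c) = ?a P Pos c - ?a P Neg c" for c
  proof -
    have "(\<Sum>k\<in>P. coef r (bdry K r (atom K (e k) Neg (Suc r))) c) =
        (\<Sum>k\<in>P. cell_coef (atom K (e k)) Pos r c - cell_coef (atom K (e k)) Neg r c)"
      by (rule sum.cong[OF refl]) (rule cell_bdry[OF atom_nu[OF xD(3)[OF subsetD[OF P]]]])
    then show ?thesis by (simp add: sum_subtractf)
  qed
  finally have q: "coef r q c = cell_coef x Neg r c + ?a P Pos c - ?a P Neg c" for c
    unfolding q_def using nuD(2)[OF xD(1)] Uc by simp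
  have "0 \<le> coef r q c" for c
  proof (cases "?a P Neg c = 0")
    case True
    then show ?thesis using cell_nonneg[OF xD(1), of r Neg c] a_nonneg[OF P, of Pos c] by (simp add: q)
  next
    \<comment> \<open>Some atom of \<open>P\<close> has \<open>c\<close> in its negative part, so no
      atom outside \<open>P\<close> has it in its positive part. Reading \<open>q\<close> from the
      other end, as \<open>x Pos r\<close> plus the negative minus the positive parts outside
      \<open>P\<close>, shows that its coordinate is nonnegative.\<close>
    case False
    then obtain t where t: "t \<in> P" "cell_coef (atom K (e t)) Neg r c \<noteq> 0"
      by (meson sum.neutral)
    then have t0: "0 < cell_coef (atom K (e t)) Neg r c"
      using P xD(3) atom_coef_nonneg[of "e t" r Neg c] by fastforce
    have "cell_coef (atom K (e s)) Pos r c = 0" if "s \<in> I - P" for s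
    proof (rule ccontr)
      assume "cell_coef (atom K (e s)) Pos r c \<noteq> 0"
      then have "0 < cell_coef (atom K (e s)) Pos r c"
        using that xD(3) atom_coef_nonneg[of "e s" r Pos c] by fastforce
      then have "arrow r (e s) (e t)" unfolding arrow_def using t0 by blast
      then show False using closed that t by blast
    qed
    then have "?a (I - P) Pos c = 0" by simp
    then show ?thesis
      using atom_sum_bdry[OF x, of c] split[of Pos c] split[of Neg c] a_nonneg[of "I - P" Neg c]
        cell_nonneg[OF xD(1), of r Pos c] by (simp add: q)
  qed
  then have qp: "q \<in> posit K r" using posit_iff qc by blast
  have lowq: "bdry K k q = bdry K k (x Neg r)" if "Suc k = r" for k
    using that nuD(2)[OF xD(1)] Uc bdry_bdry[of ?U k] unfolding q_def by auto
  have lowP: "bdry K k (x Pos r) = bdry K k (x Neg r)" if "Suc k = r" for k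
    using that nuD(3)[OF xD(1), of k] by metis
  have auq: "aug K q = 1" if "r = 0"
    using that hom_mult[OF aug_hom, of "x Neg 0" "bdry K 0 ?U"] nuD(2,4)[OF xD(1)] Uc aug_bdry[of ?U]
    unfolding q_def by simp
  have auP: "aug K (x \<alpha> r) = 1" if "r = 0" for \<alpha> using that nuD(4)[OF xD(1)] by simp
  note px = nuD(1)[OF xD(1)]
  have qv: "cell_coef x Pos r c + ?a (I - P) Neg c = coef r q c + ?a (I - P) Pos c" for c
    using atom_sum_bdry[OF x, of c] split[of Neg c] split[of Pos c] q[of c] by linarith
  let ?u = "\<lambda>\<beta> i. if i < r then x \<beta> i else if i = r then (case \<beta> of Neg \<Rightarrow> x Neg r | Pos \<Rightarrow> q)
    else finprod (chains K i) (\<lambda>k. atom K (e k) \<beta> i) P"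
  let ?v = "\<lambda>\<beta> i. if i < r then x \<beta> i else if i = r then (case \<beta> of Neg \<Rightarrow> q | Pos \<Rightarrow> x Pos r)
    else finprod (chains K i) (\<lambda>k. atom K (e k) \<beta> i) (I - P)"
  have u: "atom_sum r e P ?u"
    by (rule atom_sum_splice[OF xD(1) fP _ _ px qp _ _ lowq _ auq]) (use P xD auP q in auto)
  have v: "atom_sum r e (I - P) ?v"
    by (rule atom_sum_splice[OF xD(1) _ _ _ qp px _ lowq lowP auq auP])
      (use xD qv in auto)
  have c: "composable (nu K) r ?u ?v"
    unfolding nu_composable_iff using atom_sumD(1)[OF u] atom_sumD(1)[OF v] by simp
  have "x = cmp (nu K) r ?u ?v"
  proof (rule cell_eqI[OF xD(1) nu_cmp_closed[OF c]])
    fix \<alpha> n c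
    have "cell_coef x \<alpha> n c = cell_coef ?u \<alpha> n c + cell_coef ?v \<alpha> n c" if "r < n"
    proof -
      have "cell_coef x \<alpha> n c = (\<Sum>i\<in>I. cell_coef (atom K (e i)) \<alpha> n c)"
        using xD(5)[OF that] .
      also have "\<dots> = (\<Sum>i\<in>P. cell_coef (atom K (e i)) \<alpha> n c) + (\<Sum>i\<in>I - P. cell_coef (atom K (e i)) \<alpha> n c)"
        by (metis (no_types, lifting) P sum.subset_diff xD(2) add.commute)
      finally show ?thesis using atom_sumD(5)[OF u that] atom_sumD(5)[OF v that] by simp
    qed
    moreover have "?u \<alpha> n \<in> carrier (chains K n)" "?v \<alpha> n \<in> carrier (chains K n)"
      using nuD(2)[OF atom_sumD(1)[OF u]] nuD(2)[OF atom_sumD(1)[OF v]] .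
    ultimately show "cell_coef x \<alpha> n c = cell_coef (cmp (nu K) r ?u ?v) \<alpha> n c"
      unfolding nu_cmp[OF c] by (cases \<alpha>) auto
  qed
  then show thesis using that[OF c _ u v] by blast
qed

text \<open>If a coordinate \<open>c\<close> of dimension \<open>i + 1\<close> occurred twice, then after cutting off everything that
  is not above \<open>c\<close>, a coordinate of \<open>\<langle>c\<rangle>\<^sup>-\<close> in dimension \<open>i\<close> would occur twice.\<close>

lemma cell_coef_le_1:
  assumes "x \<in> carrier (nu K)"
  shows "cell_coef x \<alpha> i c \<le> 1"
  using assms
proof (induction i arbitrary: x \<alpha> c)
  case 0
  note x0 = nuD(2)[OF 0, of \<alpha> 0]
  show ?case
  proof (cases "cell_coef x \<alpha> 0 c = 0")
    case False
    let ?T = "{b. cell_coef x \<alpha> 0 b \<noteq> 0}"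
    \<comment> \<open>An atom of dimension 0 is its own bottom part, so unitality gives its basis
      element augmentation 1; hence the coordinates in dimension 0 add up to 1.\<close>
    have au: "aug K b = 1" if "b \<in> ?T" for b
    proof -
      have "(0, b) \<in> B" using that coef_nz[OF x0, of b] by (simp add: in_dim_def)
      then have "aug K (atom K (0, b) Neg 0) = 1" using unital unfolding unital_def by blast
      then show ?thesis using atom_top[of "(0, b)" Neg] by simp
    qed
    have "1 = aug K (x \<alpha> 0)" using nuD(4)[OF 0] by simp
    also have "\<dots> = (\<Sum>b\<in>?T. cell_coef x \<alpha> 0 b * aug K b)" by (rule aug_expand[OF x0])
    also have "\<dots> = (\<Sum>b\<in>?T. cell_coef x \<alpha> 0 b)" by (rule sum.cong) (auto simp: au)
    finally have "(\<Sum>b\<in>?T. cell_coef x \<alpha> 0 b) = 1" by simp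
    moreover have "cell_coef x \<alpha> 0 c \<le> (\<Sum>b\<in>?T. cell_coef x \<alpha> 0 b)"
      by (rule member_le_sum) (use False cell_nonneg[OF 0] coef_finite in auto)
    ultimately show ?thesis by simp
  qed simp
next
  case (Suc i)
  show ?case
  proof (rule ccontr)
    assume "\<not> cell_coef x \<alpha> (Suc i) c \<le> 1"
    then have two: "2 \<le> cell_coef x \<alpha> (Suc i) c" by simp
    note xc = nuD(2)[OF Suc.prems, of \<alpha> "Suc i"]
    \<comment> \<open>Truncation in dimension \<open>i + 1\<close> keeps the coordinate in question
      and leaves only atoms of dimension \<open>i + 1\<close>.\<close>
    define y where "y = face (nu K) \<alpha> (Suc i) x"
    have y: "y \<in> carrier (nu K)" unfolding y_def using nu_face_closed[OF Suc.prems] .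
    define m where "m = (\<lambda>b. nat (cell_coef x \<alpha> (Suc i) b))"
    \<comment> \<open>Each basis element is listed as often as its coordinate says, so that
      \<open>c\<close> occupies at least the two indices \<open>(c, 0)\<close> and
      \<open>(c, 1)\<close>.\<close>
    define I where "I = (SIGMA b : {b. cell_coef x \<alpha> (Suc i) b \<noteq> 0}. {..<m b})"
    define e where "e = (\<lambda>s :: 'k \<times> nat. (Suc i, fst s))"
    have finI: "finite I" unfolding I_def using coef_finite by auto
    have eB: "e s \<in> B" if "s \<in> I" for s
      using that coef_nz[OF xc, of "fst s"] by (auto simp: e_def I_def in_dim_def)
    have yI: "atom_sum i e I y"
    proof -
      have "cell_coef y \<beta> j d = (\<Sum>s\<in>I. cell_coef (atom K (e s)) \<beta> j d)" if "i < j" for j \<beta> d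
      proof (cases "j = Suc i")
        case True
        have "(\<Sum>s\<in>I. cell_coef (atom K (e s)) \<beta> j d) = (\<Sum>s\<in>I. if d = fst s then 1 else 0)"
          by (rule sum.cong) (use atom_coef_top[OF eB] True in \<open>auto simp: e_def\<close>)
        also have "\<dots> = (\<Sum>b | cell_coef x \<alpha> (Suc i) b \<noteq> 0. \<Sum>k<m b. if d = b then 1 else 0)"
          unfolding I_def by (subst sum.Sigma) (use coef_finite in \<open>auto intro: sum.cong\<close>)
        also have "\<dots> = (\<Sum>b | cell_coef x \<alpha> (Suc i) b \<noteq> 0. if d = b then int (m b) else 0)"
          by (rule sum.cong) auto
        also have "\<dots> = cell_coef x \<alpha> (Suc i) d"
          using coef_finite[of "Suc i" "x \<alpha> (Suc i)"] cell_nonneg[OF Suc.prems, of "Suc i" \<alpha> d]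
          by (simp add: sum.delta m_def)
        finally show ?thesis using True by (simp add: y_def nu_face)
      next
        case False
        then have j: "Suc i < j" using that by simp
        have "cell_coef (atom K (e s)) \<beta> j d = 0" for s
          using j by (intro atom_coef_above) (simp add: e_def)
        then show ?thesis using j by (simp add: y_def nu_face)
      qed
      then show ?thesis unfolding atom_sum_def using y finI eB by (auto simp: e_def)
    qed
    let ?c = "(Suc i, c)"
    have s01: "(c, 0) \<in> I" "(c, 1) \<in> I" using two by (auto simp: I_def m_def)
    have cB: "?c \<in> B" using eB[OF s01(1)] by (simp add: e_def)
    \<comment> \<open>What remains after cutting off \<open>P\<close> lies above \<open>c\<close> in
      \<open>R i\<close>, so none of it has an arrow to \<open>c\<close>, while both copies of
      \<open>c\<close> survive.\<close>
    define P where "P = {s \<in> I. (?c, e s) \<notin> R i}"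
    have "s \<in> P" if "s \<in> I" "t \<in> P" "arrow i (e s) (e t)" for s t
      using that arrow_R[of "e s" "e t" i] eB R_trans[of ?c "e s" i "e t"] unfolding P_def
      by (auto simp: e_def)
    then obtain u v where v: "atom_sum i e (I - P) v"
      using atom_sum_cut[OF yI, of P] unfolding P_def by blast
    obtain d where d: "0 < cell_coef (atom K ?c) Neg i d"
      using atom_coef_pos[OF cB, of i Neg] by auto
    note vD = atom_sumD[OF v]
    have IP: "s \<in> I - P \<longleftrightarrow> s \<in> I \<and> (?c, e s) \<in> R i" for s by (auto simp: P_def)
    have "cell_coef (atom K (e s)) Pos i d = 0" if "s \<in> I - P" for s
    proof (rule ccontr)
      assume "cell_coef (atom K (e s)) Pos i d \<noteq> 0"
      then have "0 < cell_coef (atom K (e s)) Pos i d"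
        using atom_coef_nonneg[OF vD(3)[OF that], of i Pos d] by simp
      then have "arrow i (e s) ?c" unfolding arrow_def using d by blast
      then have "(e s, ?c) \<in> R i \<and> e s \<noteq> ?c"
        using arrow_R[OF vD(3)[OF that] cB vD(4)[OF that]] by simp
      then show False using that IP R_antisym by metis
    qed
    then have "(\<Sum>s\<in>I - P. cell_coef (atom K (e s)) Pos i d) = 0" by simp
    moreover have "2 \<le> (\<Sum>s\<in>I - P. cell_coef (atom K (e s)) Neg i d)"
    proof -
      have "{(c, 0), (c, 1)} \<subseteq> I - P"
        using s01 R_refl[OF cB] by (auto simp: e_def P_def)
      then have "(\<Sum>s\<in>{(c, 0), (c, 1)}. cell_coef (atom K (e s)) Neg i d) \<le> (\<Sum>s\<in>I - P. cell_coef (atom K (e s)) Neg i d)"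
        by (intro sum_mono2) (use vD atom_coef_nonneg in auto)
      then show ?thesis using d by (simp add: e_def)
    qed
    moreover have "0 \<le> cell_coef v Pos i d" using cell_nonneg[OF vD(1)] .
    moreover have "cell_coef v Neg i d \<le> 1" using Suc.IH[OF vD(1)] .
    \<comment> \<open>With no positive part at \<open>d\<close>, the boundary equation forces
      \<open>cell_coef v Neg i d\<close> to be at least 2.\<close>
    ultimately show False using atom_sum_bdry[OF v, of d] by linarith
  qed
qed

text \<open>The left side is a coordinate of an actual cell. Cutting off all atoms that lie below
  one with \<open>d\<close> in its positive part collects every positive occurrence of
  \<open>d\<close> and, by antisymmetry, no negative one; the left side is then
  \<open>cell_coef u Pos r d\<close> for the first factor \<open>u\<close>.\<close>

lemma atom_sum_le_1:
  assumes x: "atom_sum r e I x"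
  shows "cell_coef x Neg r d + (\<Sum>i\<in>I. cell_coef (atom K (e i)) Pos r d) \<le> 1"
proof -
  note xD = atom_sumD[OF x]
  define P where "P = {s \<in> I. \<exists>s'\<in>I. 0 < cell_coef (atom K (e s')) Pos r d \<and> (e s, e s') \<in> R r}"
  have PI: "P \<subseteq> I" by (auto simp: P_def)
  have "s \<in> P" if "s \<in> I" "t \<in> P" "arrow r (e s) (e t)" for s t
    using that arrow_R[of "e s" "e t" r] xD(3,4) R_trans[of "e s" "e t" r] unfolding P_def by blast
  then obtain u v where uv: "composable (nu K) r u v" "x = cmp (nu K) r u v" "atom_sum r e P u"
    using atom_sum_cut[OF x PI] by blast
  have uN: "u Neg r = x Neg r" using uv by (simp add: nu_cmp)
  have "cell_coef (atom K (e t)) Neg r d = 0" if t: "t \<in> P" for t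
  proof (rule ccontr)
    assume "cell_coef (atom K (e t)) Neg r d \<noteq> 0"
    then have t0: "0 < cell_coef (atom K (e t)) Neg r d"
      using t xD(3) atom_coef_nonneg[of "e t" r Neg d] unfolding P_def by fastforce
    obtain s' where s': "s' \<in> I" "0 < cell_coef (atom K (e s')) Pos r d" "(e t, e s') \<in> R r"
      using t unfolding P_def by blast
    then have "arrow r (e s') (e t)" unfolding arrow_def using t0 by blast
    then have "(e s', e t) \<in> R r \<and> e s' \<noteq> e t"
      using arrow_R[of "e s'" "e t" r] s'(1) t xD(3,4) unfolding P_def by blast
    then show False using s'(3) R_antisym by metis
  qed
  then have "(\<Sum>s\<in>P. cell_coef (atom K (e s)) Neg r d) = 0" by simp
  moreover have "(\<Sum>s\<in>P. cell_coef (atom K (e s)) Pos r d) = (\<Sum>s\<in>I. cell_coef (atom K (e s)) Pos r d)"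
  proof (rule sum.mono_neutral_left[OF xD(2) PI], rule ballI)
    fix s assume s: "s \<in> I - P"
    show "cell_coef (atom K (e s)) Pos r d = 0"
    proof (rule ccontr)
      assume "cell_coef (atom K (e s)) Pos r d \<noteq> 0"
      then have "0 < cell_coef (atom K (e s)) Pos r d"
        using s xD(3) atom_coef_nonneg[of "e s" r Pos d] by fastforce
      then show False using s R_refl[OF xD(3)] unfolding P_def by blast
    qed
  qed
  moreover have "cell_coef u Pos r d \<le> 1"
    using cell_coef_le_1[OF atom_sumD(1)[OF uv(3)]] .
  ultimately show ?thesis using atom_sum_bdry[OF uv(3), of d] uN by simp
qed

section \<open>Sums without repetitions and their factorisations\<close>

abbreviation set_sum :: "nat \<Rightarrow> (nat \<times> 'k) set \<Rightarrow> (sign \<Rightarrow> nat \<Rightarrow> 'k) \<Rightarrow> bool" where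
  "set_sum r S x \<equiv> atom_sum r (\<lambda>s. s) S x"

abbreviation level_coef :: "(nat \<times> 'k) set \<Rightarrow> sign \<Rightarrow> nat \<Rightarrow> 'k \<Rightarrow> int" where
  "level_coef S \<alpha> n c \<equiv> (\<Sum>s\<in>S. cell_coef (atom K s) \<alpha> n c)"

lemma level_coef_nonneg: "S \<subseteq> B \<Longrightarrow> 0 \<le> level_coef S \<alpha> n c"
  using atom_coef_nonneg by (intro sum_nonneg) blast

lemma set_sum_subset: "set_sum r S x \<Longrightarrow> S \<subseteq> B"
  by (auto dest: atom_sumD(3))
lemma atom_member_le_level_coef:
  "finite S \<Longrightarrow> S \<subseteq> B \<Longrightarrow> s \<in> S \<Longrightarrow> cell_coef (atom K s) \<alpha> n c \<le> level_coef S \<alpha> n c"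
  using atom_coef_nonneg by (intro member_le_sum) blast+

lemma atom_set_sum:
  assumes "b \<in> B"
  shows "set_sum r (if r < fst b then {b} else {}) (atom K b)"
  using assms atom_nu[OF assms] by (auto simp: atom_sum_def atom_coef_above)

lemma set_sum_empty_iff: "set_sum r {} x \<longleftrightarrow> x \<in> cells (nu K) r"
proof
  assume x: "set_sum r {} x"
  have "x \<alpha> i = \<one>\<^bsub>chains K i\<^esub>" if "r < i" for \<alpha> i
    by (rule coef_eqI) (use nuD(2)[OF atom_sumD(1)[OF x]] atom_sumD(5)[OF x that] in auto)
  then show "x \<in> cells (nu K) r" using atom_sumD(1)[OF x] nu_cells_iff by blast
qed (auto simp: nu_cells_iff atom_sum_def)

lemma set_sum_mono:
  assumes x: "set_sum r S x" and "r \<le> i"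
  shows "set_sum i {s \<in> S. i < fst s} x"
proof -
  note xD = atom_sumD[OF x]
  have "level_coef S \<alpha> j c = level_coef {s \<in> S. i < fst s} \<alpha> j c" if "i < j" for j \<alpha> c
  proof (rule sum.mono_neutral_right[OF xD(2)], blast, rule ballI)
    fix s assume "s \<in> S - {s \<in> S. i < fst s}"
    then show "cell_coef (atom K s) \<alpha> j c = 0" using that by (intro atom_coef_above) auto
  qed
  then show ?thesis using xD \<open>r \<le> i\<close> unfolding atom_sum_def by simp
qed

lemma set_sum_dim:
  assumes x: "set_sum r S x" "x \<in> cells (nu K) n" and s: "s \<in> S"
  shows "fst s \<le> n"
proof (rule ccontr)
  assume n: "\<not> fst s \<le> n"
  note xD = atom_sumD[OF x(1)]
  have "cell_coef x Neg (fst s) (snd s) = 0" using x(2) n by (simp add: nu_cells_iff)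
  then have "level_coef S Neg (fst s) (snd s) = 0" using xD(5)[OF xD(4)[OF s]] by simp
  moreover have "cell_coef (atom K s) Neg (fst s) (snd s) = 1"
    using atom_coef_top[OF xD(3)[OF s], of Neg "snd s"] by simp
  ultimately show False
    using atom_member_le_level_coef[OF xD(2) set_sum_subset[OF x(1)] s, of "fst s" Neg "snd s"] by simp
qed

text \<open>Converse to \<open>atom_sum_cut\<close>. If an arrow through \<open>c\<close> led from
  \<open>s\<close> to \<open>t\<close>, the positive part of \<open>s\<close> would exhaust the
  bound of \<open>atom_sum_le_1\<close> at \<open>c\<close>. Then \<open>x Neg r\<close> and the
  positive parts of \<open>P\<close> vanish at \<open>c\<close>, and the boundary equation of
  \<open>u\<close> cannot balance the negative part of \<open>t\<close>.\<close>

lemma cut_closed: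
  assumes x: "set_sum r S x" and uv: "composable (nu K) r u v" "x = cmp (nu K) r u v"
    and u: "set_sum r P u" and P: "P \<subseteq> S" and s: "s \<in> S - P" and t: "t \<in> P"
  shows "\<not> arrow r s t"
proof
  assume "arrow r s t"
  then obtain c where c: "0 < cell_coef (atom K s) Pos r c" "0 < cell_coef (atom K t) Neg r c"
    unfolding arrow_def by blast
  note xD = atom_sumD[OF x] and uD = atom_sumD[OF u]
  have uN: "u Neg r = x Neg r" using uv by (simp add: nu_cmp)
  have "level_coef S Pos r c = level_coef P Pos r c + level_coef (S - P) Pos r c"
    by (metis (no_types, lifting) P sum.subset_diff xD(2) add.commute)
  moreover have "cell_coef (atom K s) Pos r c \<le> level_coef (S - P) Pos r c"
    by (rule atom_member_le_level_coef) (use xD s set_sum_subset[OF x] in auto)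
  moreover have "cell_coef (atom K t) Neg r c \<le> level_coef P Neg r c"
    by (rule atom_member_le_level_coef[OF uD(2) set_sum_subset[OF u] t])
  moreover have "0 \<le> level_coef P Pos r c" "0 \<le> cell_coef u Pos r c" "0 \<le> cell_coef x Neg r c"
    using level_coef_nonneg[OF set_sum_subset[OF u]] cell_nonneg uD(1) xD(1) by auto
  ultimately show False
    using atom_sum_le_1[OF x, of c] atom_sum_bdry[OF u, of c] uN c by simp
qed

text \<open>\<open>S'\<close> consists of the members of \<open>S\<close> that occur in \<open>p\<close>. The bound \<open>atom_sum_le_1\<close> in each
  dimension leaves room for only one way of distributing the coordinates between \<open>p\<close> and \<open>q\<close>.\<close>

lemma set_sum_split:
  assumes x: "set_sum r S x" and pq: "composable (nu K) m p q" "x = cmp (nu K) m p q" and m: "m \<le> r"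
  obtains S' where "S' \<subseteq> S" "set_sum r S' p" "set_sum r (S - S') q"
proof -
  \<comment> \<open>An atom is assigned to \<open>p\<close> if \<open>p\<close> contains its top
    coordinate.\<close>
  define S' where "S' = {s \<in> S. cell_coef p Neg (fst s) (snd s) = 1}"
  have S': "S' \<subseteq> S" by (auto simp: S'_def)
  note xD = atom_sumD[OF x]
  note SB = set_sum_subset[OF x]
  have p: "p \<in> carrier (nu K)" and q: "q \<in> carrier (nu K)" using pq(1) by (auto simp: composable_def)
  have fin: "finite S'" "finite (S - S')" using xD(2) S' finite_subset by auto
  have xpq: "cell_coef x \<alpha> i c = cell_coef p \<alpha> i c + cell_coef q \<alpha> i c" if "r < i" for \<alpha> i c
    using that m nuD(2)[OF p] nuD(2)[OF q] by (simp add: pq(2) nu_cmp[OF pq(1)])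
  have lsplit: "level_coef S \<alpha> i c = level_coef S' \<alpha> i c + level_coef (S - S') \<alpha> i c" for \<alpha> i c
    by (metis (no_types, lifting) S' sum.subset_diff xD(2) add.commute)
  obtain N where N: "\<And>\<alpha> n. n \<ge> N \<Longrightarrow> x \<alpha> n = \<one>\<^bsub>chains K n\<^esub>" using nu_bound[OF xD(1)] by blast
  \<comment> \<open>The equality is proved downwards from a dimension \<open>N\<close> from which on
    \<open>x\<close> vanishes; dimension \<open>i + 1\<close> fixes the difference of the two signs
    in dimension \<open>i\<close>.\<close>
  have claim: "\<forall>\<alpha> c. cell_coef p \<alpha> i c = level_coef S' \<alpha> i c \<and> cell_coef q \<alpha> i c = level_coef (S - S') \<alpha> i c"
    if "r < i" for i
    using that
  proof (induction "N - i" arbitrary: i rule: less_induct)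
    case less
    have nn: "0 \<le> cell_coef p \<alpha> i c" "0 \<le> cell_coef q \<alpha> i c"
      "0 \<le> level_coef S' \<alpha> i c" "0 \<le> level_coef (S - S') \<alpha> i c" for \<alpha> c
      using cell_nonneg[OF p] cell_nonneg[OF q] level_coef_nonneg[of S'] level_coef_nonneg[of "S - S'"] SB S' by blast+
    have tot: "cell_coef p \<alpha> i c + cell_coef q \<alpha> i c = level_coef S' \<alpha> i c + level_coef (S - S') \<alpha> i c" for \<alpha> c
      using xpq[OF less.prems] xD(5)[OF less.prems] lsplit by metis
    show ?case
    proof (cases "i < N")
      case False
      have "cell_coef x \<alpha> i c = 0" for \<alpha> c using N False by simp
      then have z: "cell_coef p \<alpha> i c + cell_coef q \<alpha> i c = 0" for \<alpha> c using xpq[OF less.prems] by metis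
      show ?thesis
      proof (intro allI)
        fix \<alpha> c
        show "cell_coef p \<alpha> i c = level_coef S' \<alpha> i c \<and> cell_coef q \<alpha> i c = level_coef (S - S') \<alpha> i c"
          using nn[of \<alpha> c] tot[of \<alpha> c] z[of \<alpha> c] by linarith
      qed
    next
      case True
      then have IH: "cell_coef p \<alpha> (Suc i) c = level_coef S' \<alpha> (Suc i) c"
        "cell_coef q \<alpha> (Suc i) c = level_coef (S - S') \<alpha> (Suc i) c" for \<alpha> c
        using less.hyps[of "Suc i"] less.prems by auto
      have bp: "cell_coef p Pos i c + level_coef S' Neg i c = cell_coef p Neg i c + level_coef S' Pos i c" for c
        by (rule sum_atoms_bdry[OF p fin(1) _ IH(1)]) (use S' SB in blast)
      have bq: "cell_coef q Pos i c + level_coef (S - S') Neg i c =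
          cell_coef q Neg i c + level_coef (S - S') Pos i c" for c
        by (rule sum_atoms_bdry[OF q fin(2) _ IH(2)]) (use SB in blast)
      let ?T = "{s \<in> S. i < fst s}"
      have xT: "set_sum i ?T x" using set_sum_mono[OF x] less.prems by simp
      have T1: "cell_coef x Neg i c + level_coef ?T Pos i c \<le> 1"
        "cell_coef x Pos i c + level_coef ?T Neg i c \<le> 1" for c
        using atom_sum_le_1[OF xT, of c] atom_sum_bdry[OF xT, of c] by auto
      have T_nn: "0 \<le> cell_coef (atom K s) \<alpha> i c" if "s \<in> S" for s \<alpha> c
        using that SB atom_coef_nonneg by blast
      show ?thesis
      proof (intro allI)
        fix \<alpha> c
        show "cell_coef p \<alpha> i c = level_coef S' \<alpha> i c \<and> cell_coef q \<alpha> i c = level_coef (S - S') \<alpha> i c"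
        proof (cases "(i, c) \<in> S")
          \<comment> \<open>The coordinate \<open>c\<close> of \<open>x\<close> is used up by the
            atom \<open>(i, c)\<close> itself, so no other atom of \<open>S\<close> meets it in
            dimension \<open>i\<close>, and the definition of \<open>S'\<close> decides to which
            factor it belongs.\<close>
          case True
          then have B: "(i, c) \<in> B" using SB by blast
          have self: "cell_coef (atom K (i, c)) \<beta> i c = 1" for \<beta>
            using atom_coef_top[OF B, of \<beta> c] by simp
          have x1: "1 \<le> cell_coef x \<beta> i c" for \<beta>
            using atom_member_le_level_coef[OF xD(2) SB True, of i \<beta> c] self[of \<beta>] xD(5)[OF less.prems] by simp
          have T0: "level_coef ?T \<beta> i c \<le> 0" for \<beta>
            using T1[of c] x1[of Neg] x1[of Pos] by (cases \<beta>) auto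
          have zero: "cell_coef (atom K s) \<beta> i c = 0" if "s \<in> S" "s \<noteq> (i, c)" for s \<beta>
          proof -
            consider "fst s < i" | "fst s = i" | "i < fst s" by linarith
            then show ?thesis
            proof cases
              case 1 then show ?thesis by (rule atom_coef_above)
            next
              case 2
              then have "snd s \<noteq> c" using that(2) by (metis prod.collapse)
              moreover have "s \<in> B" using that SB by blast
              ultimately show ?thesis using atom_coef_top[of s \<beta> c] 2 by auto
            next
              case 3
              have "cell_coef (atom K s) \<beta> i c \<le> level_coef ?T \<beta> i c"
                by (rule atom_member_le_level_coef) (use 3 that SB xD(2) in auto)
              then show ?thesis using T0[of \<beta>] T_nn[OF that(1), of \<beta> c] by simp
            qed
          qed
          have lev: "level_coef J \<beta> i c = (if (i, c) \<in> J then 1 else 0)" if "J \<subseteq> S" for J \<beta>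
          proof -
            have "level_coef J \<beta> i c = (\<Sum>s\<in>J. if s = (i, c) then 1 else 0)"
              by (rule sum.cong) (use that zero self in auto)
            then show ?thesis using that finite_subset[OF _ xD(2)] by (simp add: sum.delta)
          qed
          have L: "level_coef S' \<beta> i c = (if (i, c) \<in> S' then 1 else 0)"
            "level_coef (S - S') \<beta> i c = (if (i, c) \<in> S' then 0 else 1)" for \<beta>
            using lev[OF S'] lev[of "S - S'"] True by auto
          have pS: "(i, c) \<in> S' \<longleftrightarrow> cell_coef p Neg i c = 1" using True by (simp add: S'_def)
          have "cell_coef p Neg i c = level_coef S' Neg i c \<and> cell_coef q Neg i c = level_coef (S - S') Neg i c"
            using pS tot[of Neg c] nn[of Neg c] by (auto simp: L)
          moreover from this have "cell_coef p Pos i c = level_coef S' Pos i c \<and> cell_coef q Pos i c = level_coef (S - S') Pos i c"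
            using bp[of c] bq[of c] by (simp add: L)
          ultimately show ?thesis by (cases \<alpha>) auto
        next
          \<comment> \<open>Every atom of \<open>S\<close> meeting \<open>c\<close> now has
            dimension above \<open>i\<close>, so the four level coordinates add up to at most 1. At
            most one of them is nonzero, and the boundary equations of \<open>p\<close> and
            \<open>q\<close> say which factor has it.\<close>
          case False
          have ST: "level_coef S \<beta> i c = level_coef ?T \<beta> i c" for \<beta>
          proof (rule sum.mono_neutral_right[OF xD(2)], blast, rule ballI)
            fix s assume "s \<in> S - ?T"
            then have s: "s \<in> S" "\<not> i < fst s" by auto
            show "cell_coef (atom K s) \<beta> i c = 0"
            proof (cases "fst s = i")
              case True
              then have "snd s \<noteq> c" using s(1) False by (metis prod.collapse)
              then show ?thesis using atom_coef_top[of s \<beta> c] s(1) SB True by auto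
            qed (use s in \<open>simp add: atom_coef_above\<close>)
          qed
          have "level_coef S' Neg i c + level_coef (S - S') Neg i c + level_coef S' Pos i c + level_coef (S - S') Pos i c \<le> 1"
            using ST[of Pos] T1(1)[of c] xD(5)[OF less.prems, of Neg c] lsplit[of i Neg c] lsplit[of i Pos c] by linarith
          then have "cell_coef p Neg i c = level_coef S' Neg i c \<and> cell_coef q Neg i c = level_coef (S - S') Neg i c \<and>
              cell_coef p Pos i c = level_coef S' Pos i c \<and> cell_coef q Pos i c = level_coef (S - S') Pos i c"
            using tot[of Neg c] tot[of Pos c] bp[of c] bq[of c] nn[of Neg c] nn[of Pos c] by smt
          then show ?thesis by (cases \<alpha>) auto
        qed
      qed
    qed
  qed
  have "set_sum r S' p" "set_sum r (S - S') q"
    unfolding atom_sum_def using p q fin claim xD(3,4) S' by auto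
  with S' show thesis by (rule that)
qed

text \<open>Without arrows the positive and the negative parts of \<open>S\<close> are disjoint, so
  at each \<open>c\<close> the boundary equation leaves \<open>x\<close> as the only place that can
  account for the nonzero one.\<close>

lemma no_arrow_level_le:
  assumes x: "set_sum r S x" and no: "\<And>s t. s \<in> S \<Longrightarrow> t \<in> S \<Longrightarrow> \<not> arrow r s t"
  shows "level_coef S \<alpha> r c \<le> cell_coef x \<alpha> r c"
proof -
  note xD = atom_sumD[OF x]
  have zero: "level_coef S Pos r c = 0 \<or> level_coef S Neg r c = 0"
  proof (rule ccontr)
    assume "\<not> (level_coef S Pos r c = 0 \<or> level_coef S Neg r c = 0)"
    then obtain s t where st: "s \<in> S" "t \<in> S" "cell_coef (atom K s) Pos r c \<noteq> 0" "cell_coef (atom K t) Neg r c \<noteq> 0"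
      by (meson sum.neutral)
    then have "0 < cell_coef (atom K s) Pos r c" "0 < cell_coef (atom K t) Neg r c"
      using atom_coef_nonneg[OF xD(3), of s r Pos c] atom_coef_nonneg[OF xD(3), of t r Neg c] by simp_all
    then show False using no[OF st(1,2)] unfolding arrow_def by blast
  qed
  have nn: "0 \<le> cell_coef x \<beta> r c" "0 \<le> level_coef S \<beta> r c" for \<beta>
    using cell_nonneg[OF xD(1)] level_coef_nonneg[OF set_sum_subset[OF x]] by auto
  have "level_coef S Neg r c \<le> cell_coef x Neg r c \<and> level_coef S Pos r c \<le> cell_coef x Pos r c"
    using zero atom_sum_bdry[OF x, of c] nn[of Neg] nn[of Pos] by linarith
  then show ?thesis by (cases \<alpha>) auto
qed

text \<open>The new members are the basis elements of dimension \<open>r + 1\<close> in the part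
  \<open>w\<close> of \<open>x\<close> that the atoms of \<open>S\<close> do not explain. The
  boundary equation makes \<open>w\<close> independent of the sign, the absence of arrows makes it
  nonnegative, and \<open>cell_coef_le_1\<close> makes it the indicator of a set.\<close>

lemma set_sum_expand:
  assumes x: "set_sum (Suc r) S x" and no: "\<And>s t. s \<in> S \<Longrightarrow> t \<in> S \<Longrightarrow> \<not> arrow (Suc r) s t"
  obtains S' where "set_sum r S' x" "{s \<in> S'. Suc r < fst s} = S"
proof -
  note xD = atom_sumD[OF x]
  define w where "w c = cell_coef x Neg (Suc r) c - level_coef S Neg (Suc r) c" for c
  have wP: "w c = cell_coef x Pos (Suc r) c - level_coef S Pos (Suc r) c" for c
    using atom_sum_bdry[OF x, of c] by (simp add: w_def)
  have w0: "0 \<le> w c" for c using no_arrow_level_le[OF x no, of Neg c] by (simp add: w_def)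
  have w1: "w c \<le> 1" for c
    using cell_coef_le_1[OF xD(1), of "Suc r" Neg c] level_coef_nonneg[OF set_sum_subset[OF x], of "Suc r" Neg c]
    by (simp add: w_def)
  define W where "W = {c. w c = 1}"
  have WX: "cell_coef x Neg (Suc r) c \<noteq> 0" if "c \<in> W" for c
    using that level_coef_nonneg[OF set_sum_subset[OF x], of "Suc r" Neg c] unfolding W_def w_def by simp
  then have finW: "finite W" by (intro finite_subset[OF _ coef_finite[of "Suc r" "x Neg (Suc r)"]]) auto
  have WB: "(Suc r, c) \<in> B" if "c \<in> W" for c
    using coef_nz[OF nuD(2)[OF xD(1)] WX[OF that]] by (simp add: in_dim_def)
  define S' where "S' = S \<union> Pair (Suc r) ` W"
  have dis: "S \<inter> Pair (Suc r) ` W = {}" using xD(4) by fastforce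
  have lev: "level_coef S' \<alpha> j c = level_coef S \<alpha> j c + (\<Sum>d\<in>W. cell_coef (atom K (Suc r, d)) \<alpha> j c)" for \<alpha> j c
    unfolding S'_def using xD(2) finW dis
    by (subst sum.union_disjoint) (auto simp: sum.reindex inj_on_def)
  have "cell_coef x \<alpha> j c = level_coef S' \<alpha> j c" if "r < j" for \<alpha> j c
  proof (cases "j = Suc r")
    case True
    have "(\<Sum>d\<in>W. cell_coef (atom K (Suc r, d)) \<alpha> j c) = (\<Sum>d\<in>W. if c = d then 1 else 0)"
      by (rule sum.cong) (use atom_coef_top[OF WB] True in auto)
    also have "\<dots> = w c"
      using finW w0[of c] w1[of c] by (auto simp: sum.delta W_def)
    finally show ?thesis
      unfolding lev using True wP[of c] by (cases \<alpha>) (auto simp: w_def)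
  next
    case False
    then have j: "Suc r < j" using that by simp
    then have "(\<Sum>d\<in>W. cell_coef (atom K (Suc r, d)) \<alpha> j c) = 0"
      by (simp add: atom_coef_above)
    then show ?thesis unfolding lev using xD(5)[OF j] by simp
  qed
  moreover have "finite S'" unfolding S'_def using xD(2) finW by simp
  moreover have "s \<in> B \<and> r < fst s" if "s \<in> S'" for s
    using that xD(3,4)[of s] WB unfolding S'_def by auto
  ultimately have "set_sum r S' x"
    unfolding atom_sum_def using xD(1) by blast
  moreover have "{s \<in> S'. Suc r < fst s} = S"
    unfolding S'_def using xD(4) by auto
  ultimately show thesis by (rule that)
qed

section \<open>Cells with one atom, and generation by atoms\<close>

lemma posit_aug_zero:
  assumes y: "y \<in> posit K 0" and au: "aug K y = 0"
  shows "y = \<one>\<^bsub>chains K 0\<^esub>"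
proof -
  note yc = posit_carrier[OF y]
  let ?T = "{b. coef 0 y b \<noteq> 0}"
  have "aug K b = 1" if "b \<in> ?T" for b
  proof -
    have "(0, b) \<in> B" using that coef_nz[OF yc, of b] by (simp add: in_dim_def)
    then have "aug K (atom K (0, b) Neg 0) = 1" using unital unfolding unital_def by blast
    then show ?thesis using atom_top[of "(0, b)" Neg] by simp
  qed
  then have "(\<Sum>b\<in>?T. coef 0 y b) = (\<Sum>b\<in>?T. coef 0 y b * aug K b)"
    by (intro sum.cong) auto
  then have "(\<Sum>b\<in>?T. coef 0 y b) = 0" using aug_expand[OF yc] au by simp
  then have "\<forall>b\<in>?T. coef 0 y b = 0"
    using coef_posit[OF y] coef_finite[of 0 y] by (subst (asm) sum_nonneg_eq_0_iff) auto
  then show ?thesis using yc by (intro coef_eqI) auto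
qed

text \<open>In dimension 0 the augmentation counts basis elements, so comparable positive chains of
  augmentation 1 are equal (\<open>sub\<close>). This is applied to a basis element occurring in the
  0-cell \<open>x\<close> when \<open>S\<close> is empty, and to the bottom parts of
  \<open>b\<close> when \<open>S = {b}\<close>.\<close>

lemma set_sum_0_atom:
  assumes x: "set_sum 0 S x" and S: "card S \<le> 1"
  obtains b where "b \<in> B" "x = atom K b"
proof -
  note xD = atom_sumD[OF x]
  have sub: "y = z" if "y \<in> posit K 0" "z \<in> posit K 0" "aug K y = 1" "aug K z = 1" "\<And>c. coef 0 z c \<le> coef 0 y c" for y z
  proof -
    note yz = posit_carrier[OF that(1)] posit_carrier[OF that(2)]
    have "y \<otimes>\<^bsub>chains K 0\<^esub> inv\<^bsub>chains K 0\<^esub> z \<in> posit K 0"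
      using yz that(5) by (simp add: posit_iff)
    moreover have "aug K (y \<otimes>\<^bsub>chains K 0\<^esub> inv\<^bsub>chains K 0\<^esub> z) = 0"
    proof -
      interpret a: group_hom "chains K 0" integer_group "aug K"
        using aug_hom by (simp add: group_hom_def group_hom_axioms_def)
      have "aug K ((y \<otimes>\<^bsub>chains K 0\<^esub> inv\<^bsub>chains K 0\<^esub> z) \<otimes>\<^bsub>chains K 0\<^esub> z) = aug K (y \<otimes>\<^bsub>chains K 0\<^esub> inv\<^bsub>chains K 0\<^esub> z) + aug K z"
        using yz a.hom_mult[of "y \<otimes>\<^bsub>chains K 0\<^esub> inv\<^bsub>chains K 0\<^esub> z" z] by simp
      moreover have "(y \<otimes>\<^bsub>chains K 0\<^esub> inv\<^bsub>chains K 0\<^esub> z) \<otimes>\<^bsub>chains K 0\<^esub> z = y"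
        using yz by (simp add: G.m_assoc)
      ultimately show ?thesis using that(3,4) by simp
    qed
    ultimately have "y \<otimes>\<^bsub>chains K 0\<^esub> inv\<^bsub>chains K 0\<^esub> z = \<one>\<^bsub>chains K 0\<^esub>" by (rule posit_aug_zero)
    then have "coef 0 (y \<otimes>\<^bsub>chains K 0\<^esub> inv\<^bsub>chains K 0\<^esub> z) c = 0" for c by simp
    then show ?thesis using yz by (intro coef_eqI[of y 0 z]) auto
  qed
  consider "S = {}" | b where "S = {b}"
    using S xD(2) by (metis card_le_Suc0_iff_eq One_nat_def equals0I insertI1 is_singletonI' is_singletonE)
  then show thesis
  proof cases
    case 1
    have cell: "x \<in> cells (nu K) 0" using x unfolding 1 set_sum_empty_iff .
    have "x Neg 0 \<noteq> \<one>\<^bsub>chains K 0\<^esub>" using nuD(4)[OF xD(1), of Neg] aug_one_zero by auto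
    then obtain c where c: "cell_coef x Neg 0 c \<noteq> 0"
      using coef_eqI[OF nuD(2)[OF xD(1)] G.one_closed, of 0 Neg] by auto
    have cB: "(0, c) \<in> B" using coef_nz[OF nuD(2)[OF xD(1)] c] by (simp add: in_dim_def)
    have "1 \<le> cell_coef x Neg 0 c" using c cell_nonneg[OF xD(1), of 0 Neg c] by simp
    then have "x Neg 0 = atom K (0, c) Neg 0"
      using atom_coef_top[OF cB, of Neg] cell_nonneg[OF xD(1), of 0 Neg] unital cB
      by (intro sub) (auto simp: nuD[OF xD(1)] atom_posit unital_def)
    then have "x = atom K (0, c)"
      using cell atom_cells[OF cB] nu_cell_Neg[OF cell] atom_top[of "(0, c)"] unfolding nu_cells_iff
      by (intro ext) (metis fst_conv gr0I)
    then show thesis using that cB by blast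
  next
    case (2 b)
    have bB: "b \<in> B" "0 < fst b" using xD(3,4) 2 by auto
    have no: "\<not> arrow 0 s t" if "s \<in> S" "t \<in> S" for s t
      using that arrow_R[of b b 0] bB 2 by auto
    have x0: "x \<alpha> 0 = atom K b \<alpha> 0" for \<alpha>
      using no_arrow_level_le[OF x no, of \<alpha>] unital bB
      by (intro sub) (auto simp: nuD[OF xD(1)] atom_posit unital_def 2)
    have "x = atom K b"
    proof (rule cell_eqI[OF xD(1) atom_nu[OF bB(1)]])
      show "cell_coef x \<alpha> n c = cell_coef (atom K b) \<alpha> n c" for \<alpha> n c
        using x0 xD(5)[of n \<alpha> c] by (cases "n = 0") (auto simp: 2)
    qed
    then show thesis using that bB by blast
  qed
qed

text \<open>One \<open>r\<close>-face of a sum of atoms determines the other through the boundary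
  equation, and above \<open>r\<close> the atoms determine everything.\<close>

lemma set_sum_eqI:
  assumes u: "set_sum r S u" and v: "set_sum r S v" and f: "face (nu K) \<alpha> r u = face (nu K) \<alpha> r v"
  shows "u = v"
proof (rule cell_eqI[OF atom_sumD(1)[OF u] atom_sumD(1)[OF v]])
  fix \<beta> n c
  have lo: "u \<beta> i = v \<beta> i" if "i < r" for i \<beta>
    using fun_cong[OF fun_cong[OF f, of \<beta>], of i] that by (simp add: nu_face)
  have al: "u \<alpha> r = v \<alpha> r"
    using fun_cong[OF fun_cong[OF f, of \<beta>], of r] by (simp add: nu_face)
  consider "n < r" | "n = r" | "r < n" by linarith
  then show "cell_coef u \<beta> n c = cell_coef v \<beta> n c"
  proof cases
    case 2
    show ?thesis
      using al atom_sum_bdry[OF u, of c] atom_sum_bdry[OF v, of c] unfolding 2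
      by (cases \<alpha>; cases \<beta>) auto
  qed (use lo atom_sumD(5)[OF u] atom_sumD(5)[OF v] in auto)
qed

lemma singleton_no_arrow:
  assumes "set_sum r S x" "card S \<le> 1" "s \<in> S" "t \<in> S"
  shows "\<not> arrow r s t"
proof -
  have "s = t" using assms atom_sumD(2)[OF assms(1)] by (metis card_le_Suc0_iff_eq One_nat_def)
  then show ?thesis using assms atom_sumD(3,4)[OF assms(1)] arrow_R by blast
qed

lemma cells_generated:
  "cells (nu K) n = cmp_closure (nu K) {atom K b |b. b \<in> B \<and> fst b \<le> n}" (is "_ = ?cl")
proof
  show "?cl \<subseteq> cells (nu K) n"
  proof
    fix x assume "x \<in> ?cl"
    then show "x \<in> cells (nu K) n"
      by induction (auto intro: N.cmp_cells N.cells_mono[OF _ atom_cells])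
  qed
  \<comment> \<open>The outer induction lowers the level \<open>r\<close>; the inner one splits off
    an arrow-minimal atom until at most one atom is left above \<open>r\<close>.\<close>
  have single: "x \<in> ?cl" if "x \<in> cells (nu K) n" "set_sum r S x" "card S \<le> 1" for r S x
    using that
  proof (induction r arbitrary: S x)
    case 0
    obtain b where b: "b \<in> B" "x = atom K b" using set_sum_0_atom[OF 0(2,3)] .
    have "fst b \<le> n"
      using 0(1) atom_nonzero[OF b(1) order_refl, of Neg] unfolding b(2) nu_cells_iff by (meson not_le)
    then show ?case using b by (intro cmp_closure.incl) blast
  next
    case (Suc r)
    obtain S' where S': "set_sum r S' x"
      using set_sum_expand[OF Suc.prems(2) singleton_no_arrow[OF Suc.prems(2,3)]] by metis
    then show ?case
      using Suc.prems(1)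
    proof (induction "card S'" arbitrary: S' x rule: less_induct)
      case less
      show ?case
      proof (cases "card S' \<le> 1")
        case True then show ?thesis using Suc.IH less.prems by blast
      next
        case False
        note xD = atom_sumD[OF less.prems(1)]
        obtain a where a: "a \<in> S'" "\<And>s. s \<in> S' \<Longrightarrow> \<not> arrow r s a"
          using minimal_ex[OF xD(2) _ set_sum_subset[OF less.prems(1)] xD(4)] False by (metis card.empty zero_le)
        obtain u v where uv: "composable (nu K) r u v" "x = cmp (nu K) r u v" "set_sum r {a} u" "set_sum r (S' - {a}) v"
          using atom_sum_cut[OF less.prems(1), of "{a}"] a by blast
        note uvc = N.composable_carrier[OF uv(1)]
        have "r < n"
          using set_sum_dim[OF less.prems a(1)] xD(4)[OF a(1)] by simp
        \<comment> \<open>Coordinates of cells are nonnegative, so nothing can cancel above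
          \<open>n\<close> and the factors are again \<open>n\<close>-cells.\<close>
        then have cells: "u \<in> cells (nu K) n" "v \<in> cells (nu K) n"
        proof -
          have "u \<alpha> i = \<one>\<^bsub>chains K i\<^esub> \<and> v \<alpha> i = \<one>\<^bsub>chains K i\<^esub>" if "n < i" for \<alpha> i
          proof -
            have "cell_coef x \<alpha> i c = 0" for c using that less.prems(2) by (simp add: nu_cells_iff)
            moreover have "cell_coef x \<alpha> i c = cell_coef u \<alpha> i c + cell_coef v \<alpha> i c" for c
              using that \<open>r < n\<close> nuD(2)[OF uvc(1)] nuD(2)[OF uvc(2)] by (simp add: uv(2) nu_cmp[OF uv(1)])
            ultimately have "cell_coef u \<alpha> i c = 0 \<and> cell_coef v \<alpha> i c = 0" for c
              using cell_nonneg[OF uvc(1), of i \<alpha> c] cell_nonneg[OF uvc(2), of i \<alpha> c] by (smt (verit))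
            then show ?thesis
              using coef_eqI[OF nuD(2)[OF uvc(1)] G.one_closed] coef_eqI[OF nuD(2)[OF uvc(2)] G.one_closed] by simp
          qed
          then show "u \<in> cells (nu K) n" "v \<in> cells (nu K) n" using uvc by (auto simp: nu_cells_iff)
        qed
        have "u \<in> ?cl" using Suc.IH[OF cells(1) uv(3)] by simp
        moreover have "v \<in> ?cl"
          using less.hyps[OF _ uv(4) cells(2)] a(1) xD(2) by (metis card_Diff1_less)
        ultimately show ?thesis unfolding uv(2) using uv(1) by (rule cmp_closure.cmp)
      qed
    qed
  qed
  \<comment> \<open>An \<open>n\<close>-cell is a sum of no atoms at level \<open>n\<close>, which
    starts the descent.\<close>
  show "cells (nu K) n \<subseteq> ?cl"
    using single[of _ n "{}"] set_sum_empty_iff by auto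
qed

end


section \<open>Composites in an \<open>\<omega>\<close>-category\<close>

context omega_category
begin

lemma composable_assoc:
  assumes "composable C n x y" "composable C n y z"
  shows "composable C n (cmp C n x y) z" "composable C n x (cmp C n y z)"
    "cmp C n (cmp C n x y) z = cmp C n x (cmp C n y z)"
proof -
  show *: "composable C n (cmp C n x y) z" "composable C n x (cmp C n y z)"
    using assms cmp_closed face_cmp_Pos[OF assms(1)] face_cmp_Neg[OF assms(2)]
    by (auto simp: composable_def)
  show "cmp C n (cmp C n x y) z = cmp C n x (cmp C n y z)"
    using cmp_assoc[of n x y z] assms * by blast
qed

lemma composable_cmpD:
  assumes "composable C n x y"
  shows "composable C n (cmp C n x y) z \<longleftrightarrow> composable C n y z"
    and "composable C n z (cmp C n x y) \<longleftrightarrow> composable C n z x"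
  using assms cmp_closed[OF assms] face_cmp_Pos[OF assms] face_cmp_Neg[OF assms]
  by (auto simp: composable_def)

lemma composable_cmp_less:
  assumes "m < n" "composable C n x y" "composable C n x' y'"
  shows "composable C m (cmp C n x y) (cmp C n x' y') \<longleftrightarrow> composable C m x x'"
    "composable C m (cmp C n x y) (cmp C n x' y') \<longleftrightarrow> composable C m y y'"
  using assms cmp_closed face_cmp_less[OF assms(2,1)] face_cmp_less[OF assms(3,1)]
  unfolding composable_def by metis+

lemma interchange_composable:
  assumes "m < n" "composable C n x y" "composable C n x' y'" "composable C m x x'"
  shows "composable C n (cmp C m x x') (cmp C m y y')"
    "cmp C m (cmp C n x y) (cmp C n x' y') = cmp C n (cmp C m x x') (cmp C m y y')"
proof -
  have c: "composable C m (cmp C n x y) (cmp C n x' y')"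
    using composable_cmp_less(1)[OF assms(1-3)] assms(4) by simp
  then have y: "composable C m y y'" using composable_cmp_less(2)[OF assms(1-3)] by simp
  show "composable C n (cmp C m x x') (cmp C m y y')"
    using assms y cmp_closed face_cmp_greater[OF assms(4,1)] face_cmp_greater[OF y assms(1)]
    by (auto simp: composable_def)
  show "cmp C m (cmp C n x y) (cmp C n x' y') = cmp C n (cmp C m x x') (cmp C m y y')"
    using interchange[OF assms(1-3) c] .
qed

lemma composable_unit:
  assumes "x \<in> carrier C"
  shows "composable C n (face C Neg n x) x" "composable C n x (face C Pos n x)"
  using assms by (auto simp: composable_def face_closed face_face)

lemma composable_cell_self: "x \<in> cells C n \<Longrightarrow> composable C n x x"
  by (simp add: composable_def cells_carrier face_of_cell)

lemma cmp_cell_self: "x \<in> cells C n \<Longrightarrow> cmp C n x x = x"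
  using cmp_cell_right composable_cell_self by blast

text \<open>The Eckmann-Hilton form of interchange: padding \<open>x\<close> and \<open>y\<close>
  with their \<open>n\<close>-identities on opposite sides gives a \<open>#_n\<close>-composite of
  whiskered cells in either order.\<close>

lemma cmp_less_as_cmp:
  assumes m: "m < n" and xy: "composable C m x y"
  shows "cmp C m x y = cmp C n (cmp C m x (face C Neg n y)) (cmp C m (face C Pos n x) y)"
    "composable C n (cmp C m x (face C Neg n y)) (cmp C m (face C Pos n x) y)"
    "cmp C m x y = cmp C n (cmp C m (face C Neg n x) y) (cmp C m x (face C Pos n y))"
    "composable C n (cmp C m (face C Neg n x) y) (cmp C m x (face C Pos n y))"
    "composable C m x (face C \<alpha> n y)" "composable C m (face C \<alpha> n x) y"
proof -
  have x: "x \<in> carrier C" and y: "y \<in> carrier C" using xy by (auto simp: composable_def)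
  show 1: "composable C m x (face C \<alpha> n y)" "composable C m (face C \<alpha> n x) y" for \<alpha>
    using xy m by (auto simp: composable_def face_closed face_face)
  show "composable C n (cmp C m x (face C Neg n y)) (cmp C m (face C Pos n x) y)"
    "composable C n (cmp C m (face C Neg n x) y) (cmp C m x (face C Pos n y))"
    using interchange_composable(1)[OF m composable_unit(2)[OF x, of n] composable_unit(1)[OF y, of n] 1(1)]
      interchange_composable(1)[OF m composable_unit(1)[OF x, of n] composable_unit(2)[OF y, of n] 1(2)] by auto
  show "cmp C m x y = cmp C n (cmp C m x (face C Neg n y)) (cmp C m (face C Pos n x) y)"
    using interchange_composable(2)[OF m composable_unit(2)[OF x, of n] composable_unit(1)[OF y, of n] 1(1)]
    by (simp add: cmp_unit_left cmp_unit_right x y)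
  show "cmp C m x y = cmp C n (cmp C m (face C Neg n x) y) (cmp C m x (face C Pos n y))"
    using interchange_composable(2)[OF m composable_unit(1)[OF x, of n] composable_unit(2)[OF y, of n] 1(2)]
    by (simp add: cmp_unit_left cmp_unit_right x y)
qed

end

lemma subset_card_le_1: "finite S \<Longrightarrow> card S \<le> 1 \<Longrightarrow> P \<subseteq> S \<Longrightarrow> P = {} \<or> P = S"
  by (metis One_nat_def card.empty card_0_eq card_seteq finite_subset le_antisym le_Suc_eq le_zero_eq order_refl card_mono)

lemma omega_iso_bij:
  assumes C: "omega_category C" and f: "f \<in> omega_hom C D" and b: "bij_betw f (carrier C) (carrier D)"
  shows "omega_iso C D f"
proof -
  interpret C: omega_category C by fact
  let ?g = "\<lambda>y\<in>carrier D. inv_into (carrier C) f y"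
  have gf: "?g (f x) = x" if "x \<in> carrier C" for x
    using that b omega_homD(1)[OF f] by (simp add: bij_betw_def inv_into_f_f)
  have surj: "\<exists>x\<in>carrier C. y = f x" if "y \<in> carrier D" for y
    using b that by (auto simp: bij_betw_def)
  have fg: "f (?g y) = y" if "y \<in> carrier D" for y
    using surj[OF that] gf by metis
  have gc: "?g y \<in> carrier C" if "y \<in> carrier D" for y
    using surj[OF that] gf by metis
  have "?g \<in> omega_hom D C"
    unfolding omega_hom_def
  proof (intro CollectI conjI ballI allI impI)
    show "?g \<in> carrier D \<rightarrow>\<^sub>E carrier C" using gc by auto
    show fc: "?g (face D \<alpha> n y) = face C \<alpha> n (?g y)" if "y \<in> carrier D" for y \<alpha> n
      using surj[OF that] gf omega_homD(2)[OF f] C.face_closed by metis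
    fix n x y assume xy: "composable D n x y"
    then have cl: "x \<in> carrier D" "y \<in> carrier D" by (auto simp: composable_def)
    have c: "composable C n (?g x) (?g y)"
      using xy fc[OF cl(1), of Pos n] fc[OF cl(2), of Neg n] gc[OF cl(1)] gc[OF cl(2)]
      unfolding composable_def by metis
    then have "f (cmp C n (?g x) (?g y)) = cmp D n x y"
      using omega_homD(3)[OF f] fg cl by metis
    then show "?g (cmp D n x y) = cmp C n (?g x) (?g y)"
      using gf[OF C.cmp_closed[OF c]] by simp
  qed
  moreover have "omega_comp C ?g f = omega_id C" "omega_comp D f ?g = omega_id D"
    unfolding omega_comp_def omega_id_def compose_def using gf fg by (auto simp: fun_eq_iff)
  ultimately show ?thesis unfolding omega_iso_def using f by blast
qed

section \<open>The atoms of a cell, and their behaviour under composition\<close>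

context loop_free_adc
begin

text \<open>If \<open>s\<close> occurred with both signs without being in \<open>S\<close>, its
  positive occurrence would come from atoms of higher dimension; adding its occurrence in the
  negative part of \<open>x\<close> would exceed the bound of \<open>atom_sum_le_1\<close>. Hence
  \<open>x\<close> determines \<open>S\<close>.\<close>

lemma set_sum_mem_iff:
  assumes x: "set_sum r S x"
  shows "s \<in> S \<longleftrightarrow> r < fst s \<and> 1 \<le> cell_coef x Neg (fst s) (snd s) \<and> 1 \<le> cell_coef x Pos (fst s) (snd s)"
proof
  note xD = atom_sumD[OF x]
  assume s: "s \<in> S"
  have "1 \<le> cell_coef x \<alpha> (fst s) (snd s)" for \<alpha>
    using atom_member_le_level_coef[OF xD(2) set_sum_subset[OF x] s, of "fst s" \<alpha> "snd s"]
      atom_coef_top[OF xD(3)[OF s], of \<alpha> "snd s"] xD(5)[OF xD(4)[OF s], of \<alpha> "snd s"] by simp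
  then show "r < fst s \<and> 1 \<le> cell_coef x Neg (fst s) (snd s) \<and> 1 \<le> cell_coef x Pos (fst s) (snd s)"
    using xD(4)[OF s] by blast
next
  note xD = atom_sumD[OF x]
  assume a: "r < fst s \<and> 1 \<le> cell_coef x Neg (fst s) (snd s) \<and> 1 \<le> cell_coef x Pos (fst s) (snd s)"
  let ?i = "fst s" and ?c = "snd s"
  let ?T = "{t \<in> S. ?i < fst t}"
  show "s \<in> S"
  proof (rule ccontr)
    assume s: "s \<notin> S"
    have ST: "level_coef S \<alpha> ?i ?c = level_coef ?T \<alpha> ?i ?c" for \<alpha>
    proof (rule sum.mono_neutral_right[OF xD(2)], blast, rule ballI)
      fix t assume "t \<in> S - ?T"
      then have t: "t \<in> S" "\<not> ?i < fst t" by auto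
      show "cell_coef (atom K t) \<alpha> ?i ?c = 0"
      proof (cases "fst t = ?i")
        case True
        then have "snd t \<noteq> ?c" using s t(1) by (metis prod_eqI)
        then show ?thesis using atom_coef_top[OF xD(3)[OF t(1)], of \<alpha> ?c] True by auto
      qed (use t in \<open>simp add: atom_coef_above\<close>)
    qed
    have "set_sum ?i ?T x" using set_sum_mono[OF x] a by simp
    then show False
      using atom_sum_le_1[of ?i "\<lambda>s. s" ?T x ?c] a xD(5)[of ?i Pos ?c] ST[of Pos] by simp
  qed
qed

lemma set_sum_unique:
  assumes "set_sum r S x" "set_sum r T x" shows "S = T"
  using set_sum_mem_iff[OF assms(1)] set_sum_mem_iff[OF assms(2)] by blast

text \<open>A common atom would have a top coordinate of at least 2 in the composite.\<close>

lemma set_sum_disjoint: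
  assumes uv: "composable (nu K) m u v" and m: "m \<le> r" and u: "set_sum r S u" and v: "set_sum r T v"
  shows "S \<inter> T = {}"
proof (rule ccontr)
  assume "S \<inter> T \<noteq> {}"
  then obtain s where s: "s \<in> S" "s \<in> T" by blast
  have "cell_coef (cmp (nu K) m u v) Neg (fst s) (snd s) =
      cell_coef u Neg (fst s) (snd s) + cell_coef v Neg (fst s) (snd s)"
    using m set_sum_mem_iff[OF u, of s] s(1) nuD(2)[OF atom_sumD(1)[OF u]] nuD(2)[OF atom_sumD(1)[OF v]]
    by (simp add: nu_cmp[OF uv])
  then show False
    using cell_coef_le_1[OF nu_cmp_closed[OF uv], of "fst s" Neg "snd s"]
      set_sum_mem_iff[OF u, of s] set_sum_mem_iff[OF v, of s] s by simp
qed

lemma set_sum_cmp: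
  assumes uv: "composable (nu K) m u v" and m: "m \<le> r" and u: "set_sum r S u" and v: "set_sum r T v"
  shows "set_sum r (S \<union> T) (cmp (nu K) m u v)"
proof -
  note uD = atom_sumD[OF u] and vD = atom_sumD[OF v]
  have "cell_coef (cmp (nu K) m u v) \<alpha> j c = level_coef (S \<union> T) \<alpha> j c" if "r < j" for j \<alpha> c
    using that m uD(5)[OF that, of \<alpha> c] vD(5)[OF that, of \<alpha> c] nuD(2)[OF uD(1)] nuD(2)[OF vD(1)]
    by (simp add: nu_cmp[OF uv] sum.union_disjoint[OF uD(2) vD(2) set_sum_disjoint[OF assms]])
  then show ?thesis
    unfolding atom_sum_def using uD vD nu_cmp_closed[OF uv] by auto
qed

lemma set_sum_face: "x \<in> carrier (nu K) \<Longrightarrow> set_sum r {} (face (nu K) \<alpha> r x)"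
  unfolding set_sum_empty_iff by (rule N.face_cells)

end


section \<open>Decompositions in an \<open>\<omega>\<close>-category with a loop-free atomic basis\<close>

text \<open>Atomicity enters as \<open>eta_basis\<close>, which \<open>eta_atomic\<close> derives
  from the definition. Unitality is part of \<open>loop_free_adc\<close>, so all results on
  decompositions are available in \<open>nu (lam C)\<close>.\<close>

locale based_omega_category = omega_category C for C :: "'a omega_cat" +
  fixes E :: "'a set" and dm :: "'a \<Rightarrow> nat" and B :: "(nat \<times> ('a \<Rightarrow>\<^sub>0 int) set) set"
    and R :: "nat \<Rightarrow> (nat \<times> ('a \<Rightarrow>\<^sub>0 int) set) rel"
  assumes generated: "composition_generated C E dm"
    and bij: "bij_betw (basis_class C dm) E B"
    and lam_loop_free: "loop_free_adc (lam C) B R"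
    and eta_basis: "e \<in> E \<Longrightarrow> unit_eta C e = atom (lam C) (basis_class C dm e)"
begin

sublocale K: loop_free_adc "lam C" B R
  by (rule lam_loop_free)

abbreviation "\<eta> \<equiv> unit_eta C"

lemma cells_closure: "cells C n = cmp_closure C {e \<in> E. dm e \<le> n}"
  using generated by (simp add: composition_generated_def)

lemma basis_class_mem: "e \<in> E \<Longrightarrow> basis_class C dm e \<in> B"
  using bij by (auto simp: bij_betw_def)

lemmas eta_closed = omega_homD(1)[OF unit_eta_hom]
  and eta_face = omega_homD(2)[OF unit_eta_hom]
  and eta_cmp = omega_homD(3)[OF unit_eta_hom]
  and eta_composable = omega_homD(4)[OF unit_eta_hom]
  and eta_cells = omega_homD(5)[OF unit_eta_hom]

section \<open>Comparison of cells with their images under the unit\<close>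

lemma carrier_induct [consumes 1, case_names gen cmp]:
  assumes x: "x \<in> carrier C"
    and gen: "\<And>e. e \<in> E \<Longrightarrow> e \<in> carrier C \<Longrightarrow> P e"
    and cmp: "\<And>p q m. P p \<Longrightarrow> P q \<Longrightarrow> composable C m p q \<Longrightarrow> P (cmp C m p q)"
  shows "P x"
proof -
  obtain n where "x \<in> cells C n" using ex_cells[OF x] ..
  then have "x \<in> cmp_closure C {e \<in> E. dm e \<le> n}" using cells_closure by simp
  then show ?thesis
  proof induction
    case (incl e)
    then have "e \<in> cells C n" unfolding cells_closure by (rule cmp_closure.incl)
    then show ?case using gen incl cells_carrier by blast
  qed (rule cmp)
qed

text \<open>A generator of dimension \<open>n + 1\<close> has a basis element as its class, which is
  nonzero, and in the positive cone a sum vanishes only if both terms do. Composites in dimension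
  \<open>n + 1\<close> or higher are trivial.\<close>

lemma class_one_low:
  assumes "x \<in> cells C (Suc n)" "lam_class C (Suc n) x = \<one>\<^bsub>lam_chains C (Suc n)\<^esub>"
  shows "x \<in> cells C n"
proof -
  have "x \<in> cmp_closure C {e \<in> E. dm e \<le> Suc n}" using assms(1) cells_closure by simp
  then show ?thesis
    using assms(2)
  proof induction
    case (incl e)
    have "dm e \<noteq> Suc n"
    proof
      assume d: "dm e = Suc n"
      have eB: "(Suc n, lam_class C (Suc n) e) \<in> B"
        using basis_class_mem[of e] incl d by (simp add: basis_class_def)
      then show False
        using K.atom_nonzero[OF eB order_refl, of Neg] K.atom_top[of "(Suc n, lam_class C (Suc n) e)" Neg] incl by simp
    qed
    with incl show ?case unfolding cells_closure by (intro cmp_closure.incl) auto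
  next
    case (cmp p q m)
    have pq: "p \<in> cells C (Suc n)" "q \<in> cells C (Suc n)" using cmp.hyps cells_closure by auto
    show ?case
    proof (cases "m < Suc n")
      case True
      have pos: "lam_class C (Suc n) p \<in> posit (lam C) (Suc n)" "lam_class C (Suc n) q \<in> posit (lam C) (Suc n)"
        using pq lam_posit_class by auto
      have prod: "lam_class C (Suc n) p \<otimes>\<^bsub>chains (lam C) (Suc n)\<^esub> lam_class C (Suc n) q = \<one>\<^bsub>chains (lam C) (Suc n)\<^esub>"
        using lam_class_cmp[OF True pq cmp.hyps(3)] cmp.prems by simp
      have "K.coef (Suc n) (lam_class C (Suc n) p) c + K.coef (Suc n) (lam_class C (Suc n) q) c = 0" for c
        using arg_cong[OF prod, of "\<lambda>y. K.coef (Suc n) y c"] K.posit_carrier[OF pos(1)] K.posit_carrier[OF pos(2)]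
          K.coef_mult[of "lam_class C (Suc n) p" "Suc n" "lam_class C (Suc n) q" c] K.coef_one[of "Suc n" c] by simp
      then have "K.coef (Suc n) (lam_class C (Suc n) p) c = 0 \<and> K.coef (Suc n) (lam_class C (Suc n) q) c = 0" for c
        using K.coef_posit[OF pos(1), of c] K.coef_posit[OF pos(2), of c] by (smt (verit))
      then have "lam_class C (Suc n) p = \<one>\<^bsub>lam_chains C (Suc n)\<^esub> \<and> lam_class C (Suc n) q = \<one>\<^bsub>lam_chains C (Suc n)\<^esub>"
        using K.coef_eqI[OF K.posit_carrier[OF pos(1)] K.G.one_closed] K.coef_eqI[OF K.posit_carrier[OF pos(2)] K.G.one_closed]
          K.coef_one by simp
      then show ?thesis using cmp cmp_cells by blast
    next
      case False
      then have "cmp C m p q = p" using cmp_cell_right[OF cmp.hyps(3)] cells_mono[of "Suc n" m] pq by simp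
      then show ?thesis using cmp by simp
    qed
  qed
qed

lemma cells_iff_eta:
  assumes x: "x \<in> carrier C"
  shows "x \<in> cells C m \<longleftrightarrow> \<eta> x \<in> cells (nu (lam C)) m"
proof
  assume e: "\<eta> x \<in> cells (nu (lam C)) m"
  obtain n where n: "x \<in> cells C n" using ex_cells[OF x] ..
  have "x \<in> cells C n \<Longrightarrow> x \<in> cells C m" for n
  proof (induction n)
    case 0 then show ?case using cells_mono[of 0 m] by simp
  next
    case (Suc n)
    show ?case
    proof (cases "Suc n \<le> m")
      case True then show ?thesis using cells_mono Suc.prems by blast
    next
      case False
      then have "\<eta> x Neg (Suc n) = \<one>\<^bsub>lam_chains C (Suc n)\<^esub>" using e unfolding K.nu_cells_iff by simp
      then have "lam_class C (Suc n) x = \<one>\<^bsub>lam_chains C (Suc n)\<^esub>"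
        using x Suc.prems by (simp add: unit_eta_apply face_of_cell)
      then show ?thesis using class_one_low Suc by blast
    qed
  qed
  then show "x \<in> cells C m" using n by blast
qed (rule eta_cells)

text \<open>Splitting leaves one of the two factors without atoms above \<open>m\<close>; its image
  is then an \<open>m\<close>-cell, and by \<open>cells_iff_eta\<close> so is the factor
  itself.\<close>

lemma cmp_single_trivial:
  assumes pq: "composable C m p q" and S: "K.set_sum m S (\<eta> (cmp C m p q))" "card S \<le> 1"
  shows "cmp C m p q = p \<or> cmp C m p q = q"
proof -
  obtain S' where S': "S' \<subseteq> S" "K.set_sum m S' (\<eta> p)" "K.set_sum m (S - S') (\<eta> q)"
    using K.set_sum_split[OF S(1) eta_composable[OF pq] eta_cmp[OF pq] order_refl] .
  have "S' = {} \<or> S - S' = {}"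
    using subset_card_le_1[OF K.atom_sumD(2)[OF S(1)] S(2) S'(1)] by blast
  then have "p \<in> cells C m \<or> q \<in> cells C m"
    using S'(2,3) K.set_sum_empty_iff cells_iff_eta composable_carrier[OF pq] by metis
  then show ?thesis using cmp_cell_left[OF pq] cmp_cell_right[OF pq] by blast
qed

inductive dec :: "nat \<Rightarrow> (nat \<times> ('a \<Rightarrow>\<^sub>0 int) set) set \<Rightarrow> 'a \<Rightarrow> bool" for r where
  single: "x \<in> carrier C \<Longrightarrow> K.set_sum r S (\<eta> x) \<Longrightarrow> card S \<le> 1 \<Longrightarrow> dec r S x"
| cmp: "dec r S p \<Longrightarrow> dec r T q \<Longrightarrow> S \<inter> T = {} \<Longrightarrow> composable C r p q \<Longrightarrow> dec r (S \<union> T) (cmp C r p q)"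

lemma dec_set_sum: "dec r S x \<Longrightarrow> x \<in> carrier C \<and> K.set_sum r S (\<eta> x)"
proof (induction rule: dec.induct)
  case (cmp S p T q)
  then show ?case
    using K.set_sum_cmp[OF eta_composable order_refl] by (simp add: eta_cmp cmp_closed)
qed simp

lemma dec_cmpI:
  "dec r S p \<Longrightarrow> dec r T q \<Longrightarrow> composable C r p q \<Longrightarrow> dec r (S \<union> T) (cmp C r p q)"
  using K.set_sum_disjoint[OF eta_composable order_refl] dec_set_sum by (metis dec.cmp)

text \<open>An \<open>r\<close>-cell satisfies \<open>q = q #_r q\<close>, so interchange
  distributes whiskering with \<open>q\<close> over the \<open>#_r\<close>-factors of
  \<open>p\<close>.\<close>

lemma dec_whisker_right:
  assumes "dec r S p" "q \<in> cells C r" "composable C m p q" "m < r"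
  shows "dec r S (cmp C m p q)"
  using assms
proof (induction rule: dec.induct)
  case (single x S)
  have "K.set_sum r {} (\<eta> q)" using single(4) eta_cells K.set_sum_empty_iff by blast
  then have "K.set_sum r (S \<union> {}) (cmp (nu (lam C)) m (\<eta> x) (\<eta> q))"
    using single(6) by (intro K.set_sum_cmp[OF eta_composable[OF single(5)] _ single(2)]) auto
  then show ?case
    using single by (intro dec.single) (auto simp: cmp_closed eta_cmp)
next
  case (cmp S p1 T p2)
  note qq = composable_cell_self[OF cmp.prems(1)]
  have c: "composable C m (cmp C r p1 p2) (cmp C r q q)" using cmp by (simp add: cmp_cell_self)
  have c1: "composable C m p1 q" "composable C m p2 q"
    using composable_cmp_less[OF \<open>m < r\<close> cmp.hyps(4) qq] c by auto
  note ic = interchange_composable[OF \<open>m < r\<close> cmp.hyps(4) qq c1(1)]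
  show ?case
    using dec.cmp[OF cmp.IH(1)[OF cmp.prems(1) c1(1) cmp.prems(3)] cmp.IH(2)[OF cmp.prems(1) c1(2) cmp.prems(3)] cmp.hyps(3) ic(1)]
      ic(2) cmp_cell_self[OF cmp.prems(1)] by simp
qed

lemma dec_whisker_left:
  assumes "dec r S p" "q \<in> cells C r" "composable C m q p" "m < r"
  shows "dec r S (cmp C m q p)"
  using assms
proof (induction rule: dec.induct)
  case (single x S)
  have "K.set_sum r {} (\<eta> q)" using single(4) eta_cells K.set_sum_empty_iff by blast
  then have "K.set_sum r ({} \<union> S) (cmp (nu (lam C)) m (\<eta> q) (\<eta> x))"
    using single(6) by (intro K.set_sum_cmp[OF eta_composable[OF single(5)] _ _ single(2)]) auto
  then show ?case
    using single by (intro dec.single) (auto simp: cmp_closed eta_cmp)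
next
  case (cmp S p1 T p2)
  note qq = composable_cell_self[OF cmp.prems(1)]
  have c: "composable C m (cmp C r q q) (cmp C r p1 p2)" using cmp by (simp add: cmp_cell_self)
  have c1: "composable C m q p1" "composable C m q p2"
    using composable_cmp_less[OF \<open>m < r\<close> qq cmp.hyps(4)] c by auto
  note ic = interchange_composable[OF \<open>m < r\<close> qq cmp.hyps(4) c1(1)]
  show ?case
    using dec.cmp[OF cmp.IH(1)[OF cmp.prems(1) c1(1) cmp.prems(3)] cmp.IH(2)[OF cmp.prems(1) c1(2) cmp.prems(3)] cmp.hyps(3) ic(1)]
      ic(2) cmp_cell_self[OF cmp.prems(1)] by simp
qed

lemma dec_cmp_less:
  assumes p: "dec r S p" and q: "dec r T q" and pq: "composable C m p q" and m: "m < r"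
  shows "dec r (S \<union> T) (cmp C m p q)"
proof -
  note c = cmp_less_as_cmp[OF m pq]
  have f: "face C Neg r q \<in> cells C r" "face C Pos r p \<in> cells C r"
    using composable_carrier[OF pq] by (auto intro: face_cells)
  show ?thesis
    unfolding c(1)
    by (rule dec_cmpI[OF dec_whisker_right[OF p f(1) c(5) m] dec_whisker_left[OF q f(2) c(6) m] c(2)])
qed

text \<open>If at most one member of \<open>S\<close> has dimension greater than \<open>r + 1\<close>, then composites in dimensions
  greater than \<open>r\<close> are trivial.\<close>

lemma decI:
  assumes x: "x \<in> carrier C" and S: "K.set_sum r S (\<eta> x)" "card {s \<in> S. Suc r < fst s} \<le> 1"
  shows "dec r S x"
  using x S
proof (induction arbitrary: S rule: carrier_induct)
  case (gen e)
  have "S = (if r < fst (basis_class C dm e) then {basis_class C dm e} else {})"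
    by (rule K.set_sum_unique[OF gen(3)], unfold eta_basis[OF gen(1)]) (rule K.atom_set_sum[OF basis_class_mem[OF gen(1)]])
  then have "card S \<le> 1" by simp
  then show ?case using gen by (intro dec.single)
next
  case (cmp p q m)
  have fin: "finite S" using K.atom_sumD(2)[OF cmp.prems(1)] .
  show ?case
  proof (cases "r < m")
    case True
    have "K.set_sum m {s \<in> S. m < fst s} (\<eta> (cmp C m p q))"
      using K.set_sum_mono[OF cmp.prems(1)] True by simp
    moreover have "card {s \<in> S. m < fst s} \<le> card {s \<in> S. Suc r < fst s}"
      using True fin by (intro card_mono) auto
    ultimately have "cmp C m p q = p \<or> cmp C m p q = q"
      using cmp_single_trivial[OF cmp.hyps] cmp.prems(2) by simp
    then show ?thesis
      using cmp.IH(1)[of S] cmp.IH(2)[of S] cmp.prems by (elim disjE) simp_all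
  next
    case False
    then have m: "m \<le> r" by simp
    obtain S' where S': "S' \<subseteq> S" "K.set_sum r S' (\<eta> p)" "K.set_sum r (S - S') (\<eta> q)"
      using K.set_sum_split[OF cmp.prems(1) eta_composable[OF cmp.hyps] eta_cmp[OF cmp.hyps] m] .
    have "card {s \<in> S'. Suc r < fst s} \<le> card {s \<in> S. Suc r < fst s}"
      "card {s \<in> S - S'. Suc r < fst s} \<le> card {s \<in> S. Suc r < fst s}"
      using fin S'(1) by (auto intro!: card_mono)
    then have "dec r S' p" "dec r (S - S') q" using cmp.IH S' cmp.prems(2) by simp_all
    then have "dec r (S' \<union> (S - S')) (cmp C m p q)"
      using dec_cmpI[of r S' p "S - S'" q] dec_cmp_less[of r S' p "S - S'" q m] cmp.hyps m
      by (cases "m = r") simp_all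
    moreover have "S' \<union> (S - S') = S" using S'(1) by blast
    ultimately show ?thesis by simp
  qed
qed

section \<open>Injectivity of the unit and exchange of factors, level by level\<close>

definition inj_level :: "nat \<Rightarrow> bool" where
  "inj_level r \<longleftrightarrow> (\<forall>x y S. x \<in> carrier C \<longrightarrow> y \<in> carrier C \<longrightarrow> K.set_sum r S (\<eta> x) \<longrightarrow> card S \<le> 1 \<longrightarrow>
     \<eta> x = \<eta> y \<longrightarrow> x = y)"

lemma inj_levelD:
  "inj_level r \<Longrightarrow> x \<in> carrier C \<Longrightarrow> y \<in> carrier C \<Longrightarrow> K.set_sum r S (\<eta> x) \<Longrightarrow> card S \<le> 1 \<Longrightarrow> \<eta> x = \<eta> y \<Longrightarrow> x = y"
  unfolding inj_level_def by blast

text \<open>Only the index sets of \<open>q'\<close> and \<open>p'\<close> are prescribed; their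
  images under the unit are then forced by \<open>K.set_sum_eqI\<close>, because the outer faces of
  the composite are fixed.\<close>

definition swap_level :: "nat \<Rightarrow> bool" where
  "swap_level r \<longleftrightarrow> (\<forall>p q S T. composable C r p q \<longrightarrow> K.set_sum r S (\<eta> p) \<longrightarrow> card S \<le> 1 \<longrightarrow>
     K.set_sum r T (\<eta> q) \<longrightarrow> card T \<le> 1 \<longrightarrow> (\<forall>s\<in>S. \<forall>t\<in>T. \<not> K.arrow r s t) \<longrightarrow>
     (\<exists>q' p'. composable C r q' p' \<and> cmp C r p q = cmp C r q' p' \<and>
        K.set_sum r T (\<eta> q') \<and> K.set_sum r S (\<eta> p')))"

text \<open>The cell \<open>p\<close> passes the factors of \<open>q\<close> one at a time, as in
  insertion sort; \<open>swap_dec\<close> then moves the factors of its left cell in turn.\<close>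

lemma swap_single_dec:
  assumes sw: "swap_level r" and q: "dec r T q"
    and "composable C r p q" "K.set_sum r S (\<eta> p)" "card S \<le> 1" "\<And>s t. s \<in> S \<Longrightarrow> t \<in> T \<Longrightarrow> \<not> K.arrow r s t"
  shows "\<exists>q' p'. dec r T q' \<and> K.set_sum r S (\<eta> p') \<and> composable C r q' p' \<and> cmp C r p q = cmp C r q' p'"
  using q assms(3-)
proof (induction arbitrary: p rule: dec.induct)
  case (single q T)
  obtain q' p' where "composable C r q' p'" "cmp C r p q = cmp C r q' p'"
     "K.set_sum r T (\<eta> q')" "K.set_sum r S (\<eta> p')"
    using sw single unfolding swap_level_def by blast
  moreover from this have "dec r T q'" using single(3) composable_carrier by (intro dec.single)
  ultimately show ?case by blast
next
  case (cmp T1 q1 T2 q2)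
  have c1: "composable C r p q1" using cmp.prems(1) composable_cmpD(2)[OF cmp.hyps(4)] by simp
  obtain q1' p' where 1: "dec r T1 q1'" "K.set_sum r S (\<eta> p')" "composable C r q1' p'" "cmp C r p q1 = cmp C r q1' p'"
    using cmp.IH(1)[OF c1 cmp.prems(2,3)] cmp.prems(4) by blast
  have c2: "composable C r p' q2"
    using composable_cmpD(1)[OF 1(3)] composable_cmpD(1)[OF c1] cmp.hyps(4) 1(4) by metis
  obtain q2' p'' where 2: "dec r T2 q2'" "K.set_sum r S (\<eta> p'')" "composable C r q2' p''" "cmp C r p' q2 = cmp C r q2' p''"
    using cmp.IH(2)[OF c2 1(2) cmp.prems(3)] cmp.prems(4) by blast
  have c3: "composable C r q1' q2'"
    using composable_cmpD(2)[OF 2(3)] composable_cmpD(2)[OF c2] 1(3) 2(4) by metis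
  have "cmp C r p (cmp C r q1 q2) = cmp C r (cmp C r q1' p') q2"
    using composable_assoc(3)[OF c1 cmp.hyps(4)] 1(4) by simp
  also have "\<dots> = cmp C r q1' (cmp C r q2' p'')"
    using composable_assoc(3)[OF 1(3) c2] 2(4) by simp
  also have "\<dots> = cmp C r (cmp C r q1' q2') p''"
    using composable_assoc(3)[OF c3 2(3)] by simp
  finally show ?case
    using dec.cmp[OF 1(1) 2(1) cmp.hyps(3) c3] 2(2) composable_assoc(1)[OF c3 2(3)] by blast
qed

lemma swap_dec:
  assumes sw: "swap_level r" and p: "dec r S p" and "dec r T q"
    and "composable C r p q" "\<And>s t. s \<in> S \<Longrightarrow> t \<in> T \<Longrightarrow> \<not> K.arrow r s t"
  shows "\<exists>q' p'. dec r T q' \<and> dec r S p' \<and> composable C r q' p' \<and> cmp C r p q = cmp C r q' p'"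
  using p assms(3-)
proof (induction arbitrary: q rule: dec.induct)
  case (single p S)
  then show ?case
    using swap_single_dec[OF sw single(4,5) single(2,3)] composable_carrier by (metis dec.single)
next
  case (cmp S1 p1 S2 p2)
  have c2: "composable C r p2 q" using cmp.prems(2) composable_cmpD(1)[OF cmp.hyps(4)] by simp
  obtain q' p2' where 2: "dec r T q'" "dec r S2 p2'" "composable C r q' p2'" "cmp C r p2 q = cmp C r q' p2'"
    using cmp.IH(2)[OF cmp.prems(1) c2] cmp.prems(3) by blast
  have c1: "composable C r p1 q'"
    using composable_cmpD(2)[OF 2(3)] composable_cmpD(2)[OF c2] cmp.hyps(4) 2(4) by metis
  obtain q'' p1' where 1: "dec r T q''" "dec r S1 p1'" "composable C r q'' p1'" "cmp C r p1 q' = cmp C r q'' p1'"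
    using cmp.IH(1)[OF 2(1) c1] cmp.prems(3) by blast
  have c3: "composable C r p1' p2'"
    using composable_cmpD(1)[OF 1(3)] composable_cmpD(1)[OF c1] 2(3) 1(4) by metis
  have "cmp C r (cmp C r p1 p2) q = cmp C r p1 (cmp C r q' p2')"
    using composable_assoc(3)[OF cmp.hyps(4) c2] 2(4) by simp
  also have "\<dots> = cmp C r (cmp C r q'' p1') p2'"
    using composable_assoc(3)[OF c1 2(3)] 1(4) by simp
  also have "\<dots> = cmp C r q'' (cmp C r p1' p2')"
    using composable_assoc(3)[OF 1(3) c3] by simp
  finally show ?case
    using dec.cmp[OF 1(2) 2(2) cmp.hyps(3) c3] 1(1) composable_assoc(2)[OF 1(3) c3] by blast
qed

text \<open>The counterpart of \<open>K.atom_sum_cut\<close> in \<open>C\<close>. Both factors are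
  cut, and the part of the left one outside \<open>P\<close> is exchanged with the part of the right
  one inside \<open>P\<close>; the arrows that would forbid this are excluded by the closure of
  \<open>P\<close>.\<close>

lemma dec_cut:
  assumes sw: "swap_level r" and x: "dec r S x" and "P \<subseteq> S"
    and "\<And>s t. s \<in> S - P \<Longrightarrow> t \<in> P \<Longrightarrow> \<not> K.arrow r s t"
  shows "\<exists>u v. dec r P u \<and> dec r (S - P) v \<and> composable C r u v \<and> x = cmp C r u v"
  using x assms(3-)
proof (induction arbitrary: P rule: dec.induct)
  case (single x S)
  have f: "dec r {} (face C \<alpha> r x)" for \<alpha>
    using single(1) K.set_sum_face[OF eta_closed[OF single(1)]]
    by (intro dec.single) (auto simp: face_closed eta_face)
  have "P = {} \<or> P = S"
    using subset_card_le_1[OF K.atom_sumD(2)[OF single(2)] single(3,4)] .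
  then show ?case
  proof
    assume "P = {}"
    then show ?thesis
      using f[of Neg] dec.single[OF single(1-3)] composable_unit(1)[OF single(1), of r] cmp_unit_left[OF single(1), of r]
      by (metis Diff_empty)
  next
    assume "P = S"
    then show ?thesis
      using f[of Pos] dec.single[OF single(1-3)] composable_unit(2)[OF single(1), of r] cmp_unit_right[OF single(1), of r]
      by (metis Diff_cancel)
  qed
next
  case (cmp S1 x1 S2 x2)
  obtain u1 v1 where 1: "dec r (P \<inter> S1) u1" "dec r (S1 - P \<inter> S1) v1" "composable C r u1 v1" "x1 = cmp C r u1 v1"
    using cmp.IH(1)[of "P \<inter> S1"] cmp.prems by blast
  obtain u2 v2 where 2: "dec r (P \<inter> S2) u2" "dec r (S2 - P \<inter> S2) v2" "composable C r u2 v2" "x2 = cmp C r u2 v2"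
    using cmp.IH(2)[of "P \<inter> S2"] cmp.prems by blast
  have c: "composable C r v1 u2"
    using cmp.hyps(4) composable_cmpD(1)[OF 1(3)] composable_cmpD(2)[OF 2(3)] 1(4) 2(4) by simp
  obtain u2' v1' where 3: "dec r (P \<inter> S2) u2'" "dec r (S1 - P \<inter> S1) v1'" "composable C r u2' v1'"
      "cmp C r v1 u2 = cmp C r u2' v1'"
    using swap_dec[OF sw 1(2) 2(1) c] cmp.prems(2) cmp.hyps(3) by blast
  have c1: "composable C r u1 u2'"
    using composable_cmpD(2)[OF 3(3)] composable_cmpD(2)[OF c] 1(3) 3(4) by metis
  have c2: "composable C r v1' v2"
    using composable_cmpD(1)[OF 3(3)] composable_cmpD(1)[OF c] 2(3) 3(4) by metis
  have P: "P \<inter> S1 \<union> P \<inter> S2 = P" "(S1 - P \<inter> S1) \<union> (S2 - P \<inter> S2) = S1 \<union> S2 - P"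
    using cmp.prems(1) by auto
  have "cmp C r x1 x2 = cmp C r u1 (cmp C r v1 (cmp C r u2 v2))"
    using composable_assoc(3)[OF 1(3) composable_assoc(2)[OF c 2(3)]] 1(4) 2(4) by simp
  also have "cmp C r v1 (cmp C r u2 v2) = cmp C r u2' (cmp C r v1' v2)"
    using composable_assoc(3)[OF c 2(3)] composable_assoc(3)[OF 3(3) c2] 3(4) by simp
  also have "cmp C r u1 (cmp C r u2' (cmp C r v1' v2)) = cmp C r (cmp C r u1 u2') (cmp C r v1' v2)"
    using composable_assoc(3)[OF c1 composable_assoc(2)[OF 3(3) c2]] by simp
  finally have "cmp C r x1 x2 = cmp C r (cmp C r u1 u2') (cmp C r v1' v2)" .
  moreover have "composable C r (cmp C r u1 u2') (cmp C r v1' v2)"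
    using composable_assoc(1)[OF c1 composable_assoc(2)[OF 3(3) c2]] .
  ultimately show ?case
    using dec_cmpI[OF 1(1) 3(1) c1] dec_cmpI[OF 3(2) 2(2) c2] unfolding P by blast
qed

lemma dec_face:
  assumes "composable C r u v" "x = cmp C r u v"
  shows "face (nu (lam C)) Neg r (\<eta> u) = face (nu (lam C)) Neg r (\<eta> x)"
    "face (nu (lam C)) Pos r (\<eta> v) = face (nu (lam C)) Pos r (\<eta> x)"
  using assms K.N.face_cmp_Neg[OF eta_composable] K.N.face_cmp_Pos[OF eta_composable]
  by (simp_all add: eta_cmp)

text \<open>Factorisations of the image lift to \<open>C\<close>: the atoms of \<open>Y1\<close>
  form an admissible set by \<open>K.cut_closed\<close>, so \<open>p\<close> can be cut along them,
  and each factor is recognised as lying over \<open>Y1\<close> or \<open>Y2\<close> by its atoms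
  and one outer face.\<close>

lemma lift_cmp:
  assumes sw: "swap_level k" and p: "p \<in> carrier C" "K.set_sum (Suc k) S0 (\<eta> p)" "card S0 \<le> 1"
    and Y: "composable (nu (lam C)) k Y1 Y2" "\<eta> p = cmp (nu (lam C)) k Y1 Y2"
  obtains u v where "composable C k u v" "p = cmp C k u v" "\<eta> u = Y1" "\<eta> v = Y2"
proof -
  obtain S where S: "K.set_sum k S (\<eta> p)" "{s \<in> S. Suc k < fst s} = S0"
    by (rule K.set_sum_expand[OF p(2) K.singleton_no_arrow[OF p(2,3)]])
  have d: "dec k S p" using decI[OF p(1) S(1)] S(2) p(3) by simp
  obtain P where P: "P \<subseteq> S" "K.set_sum k P Y1" "K.set_sum k (S - P) Y2"
    using K.set_sum_split[OF S(1) Y order_refl] .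
  obtain u v where uv: "dec k P u" "dec k (S - P) v" "composable C k u v" "p = cmp C k u v"
    using dec_cut[OF sw d P(1)] K.cut_closed[OF S(1) Y P(2,1)] by blast
  have "\<eta> u = Y1"
    using K.set_sum_eqI[OF _ P(2), of "\<eta> u" Neg] dec_set_sum[OF uv(1)] dec_face(1)[OF uv(3,4)]
      K.N.face_cmp_Neg[OF Y(1)] Y(2) by simp
  moreover have "\<eta> v = Y2"
    using K.set_sum_eqI[OF _ P(3), of "\<eta> v" Pos] dec_set_sum[OF uv(2)] dec_face(2)[OF uv(3,4)]
      K.N.face_cmp_Pos[OF Y(1)] Y(2) by simp
  ultimately show thesis using that uv by blast
qed

text \<open>An \<open>r\<close>-cell has no atoms above \<open>r\<close>, so level \<open>r\<close>
  covers it with the empty set; since every cell lies in some \<open>cells C r\<close>, injectivity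
  at all levels is full injectivity.\<close>

lemma inj_low: "inj_level r \<Longrightarrow> x \<in> cells C r \<Longrightarrow> y \<in> cells C r \<Longrightarrow> \<eta> x = \<eta> y \<Longrightarrow> x = y"
  using inj_levelD[of r x y "{}"] eta_cells K.set_sum_empty_iff cells_carrier by simp

text \<open>If one factor is an \<open>r\<close>-cell, the composite is the other factor, and an
  identity can be put on either side of it.\<close>

lemma swap_trivial:
  assumes pq: "composable C r p q" and S: "K.set_sum r S (\<eta> p)" and T: "K.set_sum r T (\<eta> q)"
    and "S = {} \<or> T = {}"
  shows "\<exists>q' p'. composable C r q' p' \<and> cmp C r p q = cmp C r q' p' \<and>
        K.set_sum r T (\<eta> q') \<and> K.set_sum r S (\<eta> p')"
proof -
  have pc: "p \<in> carrier C" and qc: "q \<in> carrier C" using composable_carrier[OF pq] .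
  have cell: "K.set_sum r {} (\<eta> (face C \<alpha> r z))" if "z \<in> carrier C" for \<alpha> z
    using that face_cells eta_cells K.set_sum_empty_iff by auto
  from assms(4) show ?thesis
  proof
    assume S0: "S = {}"
    then have "p \<in> cells C r" using S K.set_sum_empty_iff cells_iff_eta[OF pc] by simp
    then have "cmp C r p q = cmp C r q (face C Pos r q)"
      using cmp_cell_left[OF pq] cmp_unit_right[OF qc] by simp
    then show ?thesis using composable_unit(2)[OF qc] T cell[OF qc] S0 by blast
  next
    assume T0: "T = {}"
    then have "q \<in> cells C r" using T K.set_sum_empty_iff cells_iff_eta[OF qc] by simp
    then have "cmp C r p q = cmp C r (face C Neg r p) p"
      using cmp_cell_right[OF pq] cmp_unit_left[OF pc] by simp
    then show ?thesis using composable_unit(1)[OF pc] S cell[OF pc] T0 by blast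
  qed
qed

text \<open>Both orders of composing \<open>p\<close> and \<open>q\<close> arise by interchange from one composite in dimension
  \<open>k\<close>, whose factors separate \<open>s\<close> from \<open>t\<close>.\<close>

lemma swap_Suc:
  assumes inj: "inj_level (Suc k)" and sw: "swap_level k"
  shows "swap_level (Suc k)"
  unfolding swap_level_def
proof (intro allI impI)
  let ?r = "Suc k" and ?N = "nu (lam C)"
  fix p q S T
  assume pq: "composable C ?r p q" and S: "K.set_sum ?r S (\<eta> p)" "card S \<le> 1"
    and T: "K.set_sum ?r T (\<eta> q)" "card T \<le> 1" and no: "\<forall>s\<in>S. \<forall>t\<in>T. \<not> K.arrow ?r s t"
  have pc: "p \<in> carrier C" and qc: "q \<in> carrier C" using composable_carrier[OF pq] .
  note epq = eta_composable[OF pq]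
  let ?y = "cmp ?N ?r (\<eta> p) (\<eta> q)"
  have y: "K.set_sum ?r (S \<union> T) ?y" by (rule K.set_sum_cmp[OF epq order_refl S(1) T(1)])
  have dis: "S \<inter> T = {}" by (rule K.set_sum_disjoint[OF epq order_refl S(1) T(1)])
  show "\<exists>q' p'. composable C ?r q' p' \<and> cmp C ?r p q = cmp C ?r q' p' \<and>
        K.set_sum ?r T (\<eta> q') \<and> K.set_sum ?r S (\<eta> p')"
  proof (cases "S = {} \<or> T = {}")
    case True then show ?thesis by (rule swap_trivial[OF pq S(1) T(1)])
  next
    case False
    then obtain s t where st: "s \<in> S" "t \<in> T" by blast
    have Ss: "S = {s}" using subset_card_le_1[OF K.atom_sumD(2)[OF S(1)] S(2), of "{s}"] st by simp
    have Tt: "T = {t}" using subset_card_le_1[OF K.atom_sumD(2)[OF T(1)] T(2), of "{t}"] st by simp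
    have stB: "s \<in> B" "t \<in> B" "?r < fst s" "?r < fst t"
      using K.atom_sumD(3,4)[OF S(1) st(1)] K.atom_sumD(3,4)[OF T(1) st(2)] by auto
    have ne: "s \<noteq> t" using dis st by blast
    \<comment> \<open>The given factorisation is itself a cut along \<open>S\<close>, which rules
      out an arrow from \<open>t\<close> to \<open>s\<close>.\<close>
    have no_ts: "\<not> K.arrow ?r t s"
      using K.cut_closed[OF y epq refl S(1)] dis st by blast
    have "\<not> K.arrow ?r a b" if "a \<in> S \<union> T" "b \<in> S \<union> T" for a b
      using that no no_ts K.arrow_R[of a a ?r] stB unfolding Ss Tt by blast
    \<comment> \<open>As no arrows are left, the composite can be resolved into atoms one level
      lower.\<close>
    then obtain U where U: "K.set_sum k U ?y" "{z \<in> U. ?r < fst z} = S \<union> T"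
      using K.set_sum_expand[OF y] by blast
    have UB: "z \<in> B" "k < fst z" if "z \<in> U" for z using K.atom_sumD(3,4)[OF U(1) that] .
    have stU: "s \<in> U" "t \<in> U" using U(2) st by auto
    have closed: "z \<in> {z \<in> U. (z, a) \<in> R k}"
      if "z \<in> U" "w \<in> {z \<in> U. (z, a) \<in> R k}" "K.arrow k z w" for z w a
      using that K.arrow_R[of z w k] UB K.R_trans[of z w k a] by blast
    have face_piece: "K.set_sum ?r {} (face ?N \<alpha> ?r Z)" if "Z \<in> carrier ?N" for Z \<alpha>
      using K.set_sum_face[OF that] .
    show ?thesis
    \<comment> \<open>At most one of \<open>s\<close> and \<open>t\<close> lies below the other. If
      \<open>t\<close> is not below \<open>s\<close>, the elements below \<open>s\<close> are cut
      off to the left; otherwise \<open>s\<close> is not below \<open>t\<close>, and those below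
      \<open>t\<close> are cut off.\<close>
    proof (cases "(t, s) \<in> R k")
      case False
      let ?P = "{z \<in> U. (z, s) \<in> R k}"
      have cl: "z \<in> ?P" if "z \<in> U" "w \<in> ?P" "K.arrow k z w" for z w
        using that by (rule closed)
      obtain Y1 Y2 where Y: "composable ?N k Y1 Y2" "?y = cmp ?N k Y1 Y2" "K.set_sum k ?P Y1" "K.set_sum k (U - ?P) Y2"
        using K.atom_sum_cut[OF U(1), of ?P] cl by blast
      have Yc: "Y1 \<in> carrier ?N" "Y2 \<in> carrier ?N" using K.N.composable_carrier[OF Y(1)] .
      have "{z \<in> ?P. ?r < fst z} = {z \<in> U. ?r < fst z} \<inter> {z. (z, s) \<in> R k}"
        "{z \<in> U - ?P. ?r < fst z} = {z \<in> U. ?r < fst z} - {z. (z, s) \<in> R k}" by auto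
      then have big: "{z \<in> ?P. ?r < fst z} = S" "{z \<in> U - ?P. ?r < fst z} = T"
        using False K.R_refl[OF stB(1)] unfolding U(2) Ss Tt by auto
      have Y1: "K.set_sum ?r S Y1" using K.set_sum_mono[OF Y(3), of ?r] unfolding big by simp
      have Y2: "K.set_sum ?r T Y2" using K.set_sum_mono[OF Y(4), of ?r] unfolding big by simp
      note w = K.N.cmp_less_as_cmp[OF lessI Y(1)]
      \<comment> \<open>\<open>Y1\<close> whiskered with the source of \<open>Y2\<close> has the
        same atoms and the same source as the image of \<open>p\<close>, hence equals it; for
        \<open>q\<close> targets are used instead.\<close>
      have p: "\<eta> p = cmp ?N k Y1 (face ?N Neg ?r Y2)"
      proof (rule K.set_sum_eqI[OF S(1)])
        show "K.set_sum ?r S (cmp ?N k Y1 (face ?N Neg ?r Y2))"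
          using K.set_sum_cmp[OF w(5) le_SucI[OF order_refl] Y1 face_piece[OF Yc(2)]] by simp
        show "face ?N Neg ?r (\<eta> p) = face ?N Neg ?r (cmp ?N k Y1 (face ?N Neg ?r Y2))"
          using K.N.face_cmp_Neg[OF epq] K.N.face_cmp_Neg[OF w(2)] w(1) Y(2) by simp
      qed
      have q: "\<eta> q = cmp ?N k (face ?N Pos ?r Y1) Y2"
      proof (rule K.set_sum_eqI[OF T(1)])
        show "K.set_sum ?r T (cmp ?N k (face ?N Pos ?r Y1) Y2)"
          using K.set_sum_cmp[OF w(6) le_SucI[OF order_refl] face_piece[OF Yc(1)] Y2] by simp
        show "face ?N Pos ?r (\<eta> q) = face ?N Pos ?r (cmp ?N k (face ?N Pos ?r Y1) Y2)"
          using K.N.face_cmp_Pos[OF epq] K.N.face_cmp_Pos[OF w(2)] w(1) Y(2) by simp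
      qed
      obtain u v where uv: "composable C k u v" "p = cmp C k u v" "\<eta> u = Y1" "\<eta> v = face ?N Neg ?r Y2"
        using lift_cmp[OF sw pc S w(5) p] .
      obtain u' v' where uv': "composable C k u' v'" "q = cmp C k u' v'" "\<eta> u' = face ?N Pos ?r Y1" "\<eta> v' = Y2"
        using lift_cmp[OF sw qc T w(6) q] .
      have cl: "u \<in> carrier C" "v \<in> carrier C" "u' \<in> carrier C" "v' \<in> carrier C"
        using composable_carrier[OF uv(1)] composable_carrier[OF uv'(1)] by auto
      \<comment> \<open>Both sides are \<open>?r\<close>-cells with the same image, so injectivity
        at level \<open>?r\<close> identifies them. This is where exchange depends on
        injectivity.\<close>
      have u'eq: "u' = face C Pos ?r u"
        by (rule inj_low[OF inj]) (use cl uv uv' Yc in \<open>simp_all add: cells_iff_eta K.N.face_cells face_cells eta_face\<close>)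
      have veq: "v = face C Neg ?r v'"
        by (rule inj_low[OF inj]) (use cl uv uv' Yc in \<open>simp_all add: cells_iff_eta K.N.face_cells face_cells eta_face\<close>)
      have uv'': "composable C k u v'"
        using uv(1) cl unfolding veq by (simp add: composable_def face_face)
      note e = cmp_less_as_cmp[OF lessI uv'']
      \<comment> \<open>One composite in dimension \<open>k\<close> carries both orders: the first
        form in \<open>cmp_less_as_cmp\<close> gives \<open>p\<close> and \<open>q\<close>, the
        second gives the exchanged factors.\<close>
      have "cmp C ?r p q = cmp C k u v'"
        using e(1) uv(2) uv'(2) u'eq veq by simp
      then have "cmp C ?r p q = cmp C ?r (cmp C k (face C Neg ?r u) v') (cmp C k u (face C Pos ?r v'))"
        using e(3) by simp
      moreover have "K.set_sum ?r T (\<eta> (cmp C k (face C Neg ?r u) v'))"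
        using K.set_sum_cmp[OF eta_composable[OF e(6)] le_SucI[OF order_refl], where S = "{}" and T = T] face_piece eta_closed cl Y2
        by (simp add: eta_cmp[OF e(6)] eta_face uv')
      moreover have "K.set_sum ?r S (\<eta> (cmp C k u (face C Pos ?r v')))"
        using K.set_sum_cmp[OF eta_composable[OF e(5)] le_SucI[OF order_refl], where S = S and T = "{}"] face_piece eta_closed cl Y1
        by (simp add: eta_cmp[OF e(5)] eta_face uv)
      ultimately show ?thesis using e(4) by blast
    next
      \<comment> \<open>The mirror image: \<open>t\<close> goes to the left, and the two forms in
        \<open>cmp_less_as_cmp\<close> change places.\<close>
      case True
      then have nst: "(s, t) \<notin> R k" using ne K.R_antisym by blast
      let ?P = "{z \<in> U. (z, t) \<in> R k}"
      have cl: "z \<in> ?P" if "z \<in> U" "w \<in> ?P" "K.arrow k z w" for z w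
        using that by (rule closed)
      obtain Y1 Y2 where Y: "composable ?N k Y1 Y2" "?y = cmp ?N k Y1 Y2" "K.set_sum k ?P Y1" "K.set_sum k (U - ?P) Y2"
        using K.atom_sum_cut[OF U(1), of ?P] cl by blast
      have Yc: "Y1 \<in> carrier ?N" "Y2 \<in> carrier ?N" using K.N.composable_carrier[OF Y(1)] .
      have "{z \<in> ?P. ?r < fst z} = {z \<in> U. ?r < fst z} \<inter> {z. (z, t) \<in> R k}"
        "{z \<in> U - ?P. ?r < fst z} = {z \<in> U. ?r < fst z} - {z. (z, t) \<in> R k}" by auto
      then have big: "{z \<in> ?P. ?r < fst z} = T" "{z \<in> U - ?P. ?r < fst z} = S"
        using nst K.R_refl[OF stB(2)] unfolding U(2) Ss Tt by auto
      have Y1: "K.set_sum ?r T Y1" using K.set_sum_mono[OF Y(3), of ?r] unfolding big by simp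
      have Y2: "K.set_sum ?r S Y2" using K.set_sum_mono[OF Y(4), of ?r] unfolding big by simp
      note w = K.N.cmp_less_as_cmp[OF lessI Y(1)]
      have p: "\<eta> p = cmp ?N k (face ?N Neg ?r Y1) Y2"
      proof (rule K.set_sum_eqI[OF S(1)])
        show "K.set_sum ?r S (cmp ?N k (face ?N Neg ?r Y1) Y2)"
          using K.set_sum_cmp[OF w(6) le_SucI[OF order_refl] face_piece[OF Yc(1)] Y2] by simp
        show "face ?N Neg ?r (\<eta> p) = face ?N Neg ?r (cmp ?N k (face ?N Neg ?r Y1) Y2)"
          using K.N.face_cmp_Neg[OF epq] K.N.face_cmp_Neg[OF w(4)] w(3) Y(2) by simp
      qed
      have q: "\<eta> q = cmp ?N k Y1 (face ?N Pos ?r Y2)"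
      proof (rule K.set_sum_eqI[OF T(1)])
        show "K.set_sum ?r T (cmp ?N k Y1 (face ?N Pos ?r Y2))"
          using K.set_sum_cmp[OF w(5) le_SucI[OF order_refl] Y1 face_piece[OF Yc(2)]] by simp
        show "face ?N Pos ?r (\<eta> q) = face ?N Pos ?r (cmp ?N k Y1 (face ?N Pos ?r Y2))"
          using K.N.face_cmp_Pos[OF epq] K.N.face_cmp_Pos[OF w(4)] w(3) Y(2) by simp
      qed
      obtain u v where uv: "composable C k u v" "p = cmp C k u v" "\<eta> u = face ?N Neg ?r Y1" "\<eta> v = Y2"
        using lift_cmp[OF sw pc S w(6) p] .
      obtain u' v' where uv': "composable C k u' v'" "q = cmp C k u' v'" "\<eta> u' = Y1" "\<eta> v' = face ?N Pos ?r Y2"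
        using lift_cmp[OF sw qc T w(5) q] .
      have cl: "u \<in> carrier C" "v \<in> carrier C" "u' \<in> carrier C" "v' \<in> carrier C"
        using composable_carrier[OF uv(1)] composable_carrier[OF uv'(1)] by auto
      have ueq: "u = face C Neg ?r u'"
        by (rule inj_low[OF inj]) (use cl uv uv' Yc in \<open>simp_all add: cells_iff_eta K.N.face_cells face_cells eta_face\<close>)
      have v'eq: "v' = face C Pos ?r v"
        by (rule inj_low[OF inj]) (use cl uv uv' Yc in \<open>simp_all add: cells_iff_eta K.N.face_cells face_cells eta_face\<close>)
      have uv'': "composable C k u' v"
        using uv(1) cl unfolding ueq by (simp add: composable_def face_face)
      note e = cmp_less_as_cmp[OF lessI uv'']
      have "cmp C ?r p q = cmp C k u' v"
        using e(3) uv(2) uv'(2) ueq v'eq by simp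
      then have "cmp C ?r p q = cmp C ?r (cmp C k u' (face C Neg ?r v)) (cmp C k (face C Pos ?r u') v)"
        using e(1) by simp
      moreover have "K.set_sum ?r T (\<eta> (cmp C k u' (face C Neg ?r v)))"
        using K.set_sum_cmp[OF eta_composable[OF e(5)] le_SucI[OF order_refl], where S = T and T = "{}"] face_piece eta_closed cl Y1
        by (simp add: eta_cmp[OF e(5)] eta_face uv')
      moreover have "K.set_sum ?r S (\<eta> (cmp C k (face C Pos ?r u') v))"
        using K.set_sum_cmp[OF eta_composable[OF e(6)] le_SucI[OF order_refl], where S = "{}" and T = S] face_piece eta_closed cl Y2
        by (simp add: eta_cmp[OF e(6)] eta_face uv)
      ultimately show ?thesis using e(2) by blast
    qed
  qed
qed

text \<open>An atom has at most one atom above every level, so by \<open>cmp_single_trivial\<close>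
  a composite over it is one of its own factors, and one arrives at a generator.\<close>

lemma eta_eq_atom:
  assumes "x \<in> carrier C" "\<eta> x = atom (lam C) b" "b \<in> B"
  shows "x \<in> E \<and> basis_class C dm x = b"
  using assms(1,2)
proof (induction rule: carrier_induct)
  case (gen e)
  then show ?case using eta_basis K.atom_inj[OF basis_class_mem assms(3)] by auto
next
  case (cmp p q m)
  let ?S = "if m < fst b then {b} else {}"
  have "K.set_sum m ?S (\<eta> (cmp C m p q))" using K.atom_set_sum[OF assms(3), of m] cmp.prems by simp
  moreover have "card ?S \<le> 1" by simp
  ultimately have "cmp C m p q = p \<or> cmp C m p q = q" by (rule cmp_single_trivial[OF cmp.hyps])
  then show ?case using cmp.IH cmp.prems by (elim disjE) simp_all
qed

lemma inj_0: "inj_level 0"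
  unfolding inj_level_def
proof (intro allI impI)
  fix x y S assume a: "x \<in> carrier C" "y \<in> carrier C" "K.set_sum 0 S (\<eta> x)" "card S \<le> 1" "\<eta> x = \<eta> y"
  obtain b where b: "b \<in> B" "\<eta> x = atom (lam C) b" using K.set_sum_0_atom[OF a(3,4)] .
  have "x \<in> E \<and> basis_class C dm x = b" "y \<in> E \<and> basis_class C dm y = b"
    using eta_eq_atom[OF a(1) b(2,1)] eta_eq_atom[OF a(2) _ b(1)] a(5) b(2) by auto
  then show "x = y" using bij by (metis bij_betw_def inj_onD)
qed

text \<open>At level 0 the images are atoms, and composability makes the target of the first equal
  to the source of the second. This common part is nonzero and gives an arrow, so the excluded
  arrows leave only the case where one factor is a 0-cell.\<close>

lemma swap_0: "swap_level 0"
  unfolding swap_level_def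
proof (intro allI impI)
  fix p q S T
  assume pq: "composable C 0 p q" and S: "K.set_sum 0 S (\<eta> p)" "card S \<le> 1"
    and T: "K.set_sum 0 T (\<eta> q)" "card T \<le> 1" and no: "\<forall>s\<in>S. \<forall>t\<in>T. \<not> K.arrow 0 s t"
  obtain a b where a: "a \<in> B" "\<eta> p = atom (lam C) a" and b: "b \<in> B" "\<eta> q = atom (lam C) b"
    using K.set_sum_0_atom[OF S] K.set_sum_0_atom[OF T] by metis
  have Sa: "S = (if 0 < fst a then {a} else {})"
    by (rule K.set_sum_unique[OF S(1)], unfold a(2)) (rule K.atom_set_sum[OF a(1)])
  have Tb: "T = (if 0 < fst b then {b} else {})"
    by (rule K.set_sum_unique[OF T(1)], unfold b(2)) (rule K.atom_set_sum[OF b(1)])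
  have eq: "atom (lam C) a Pos 0 = atom (lam C) b Neg 0"
    using eta_composable[OF pq] unfolding K.nu_composable_iff a(2) b(2) by simp
  obtain c where "0 < K.cell_coef (atom (lam C) a) Pos 0 c" using K.atom_coef_pos[OF a(1) le0] .
  then have "K.arrow 0 a b" unfolding K.arrow_def using eq by auto
  then have "S = {} \<or> T = {}" using no unfolding Sa Tb by (auto split: if_splits)
  then show "\<exists>q' p'. composable C 0 q' p' \<and> cmp C 0 p q = cmp C 0 q' p' \<and>
        K.set_sum 0 T (\<eta> q') \<and> K.set_sum 0 S (\<eta> p')"
    by (rule swap_trivial[OF pq S(1) T(1)])
qed

lemma inj_Suc:
  assumes inj: "inj_level k" and sw: "swap_level k"
  shows "inj_level (Suc k)"
proof -
  have main: "x = y" if "dec k S x" "dec k S y" "\<eta> x = \<eta> y" for S x y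
    using that
  proof (induction "card S" arbitrary: S x y rule: less_induct)
    case less
    note x = dec_set_sum[OF less.prems(1)] and y = dec_set_sum[OF less.prems(2)]
    show ?case
    proof (cases "card S \<le> 1")
      case True then show ?thesis using inj_levelD[OF inj] x y less.prems(3) by blast
    next
      case False
      note S = K.atom_sumD[OF conjunct2[OF x]]
      \<comment> \<open>The choice of \<open>a\<close> depends on \<open>S\<close> alone, so the
        same atom is cut off \<open>x\<close> and \<open>y\<close>; the first factors then have
        equal images and agree by injectivity at level \<open>k\<close>.\<close>
      obtain a where a: "a \<in> S" "\<And>s. s \<in> S \<Longrightarrow> \<not> K.arrow k s a"
        using K.minimal_ex[OF S(2) _ K.set_sum_subset[OF conjunct2[OF x]] S(4)] False by (metis card.empty zero_le)
      have aS: "{a} \<subseteq> S" using a by simp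
      have na: "\<not> K.arrow k s t" if "s \<in> S - {a}" "t \<in> {a}" for s t using that a by blast
      obtain u v where uv: "dec k {a} u" "dec k (S - {a}) v" "composable C k u v" "x = cmp C k u v"
        using dec_cut[OF sw less.prems(1) aS na] by blast
      obtain u' v' where uv': "dec k {a} u'" "dec k (S - {a}) v'" "composable C k u' v'" "y = cmp C k u' v'"
        using dec_cut[OF sw less.prems(2) aS na] by blast
      have "\<eta> u = \<eta> u'"
        using K.set_sum_eqI[of k "{a}" "\<eta> u" "\<eta> u'" Neg] dec_set_sum[OF uv(1)] dec_set_sum[OF uv'(1)]
          dec_face(1)[OF uv(3,4)] dec_face(1)[OF uv'(3,4)] less.prems(3) by simp
      then have "u = u'"
        using inj_levelD[OF inj, of u u' "{a}"] dec_set_sum[OF uv(1)] dec_set_sum[OF uv'(1)] by simp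
      moreover have "\<eta> v = \<eta> v'"
        using K.set_sum_eqI[of k "S - {a}" "\<eta> v" "\<eta> v'" Pos] dec_set_sum[OF uv(2)] dec_set_sum[OF uv'(2)]
          dec_face(2)[OF uv(3,4)] dec_face(2)[OF uv'(3,4)] less.prems(3) by simp
      then have "v = v'"
        using less.hyps[OF _ uv(2) uv'(2)] card_Diff1_less[OF S(2) a(1)] by blast
      ultimately show ?thesis using uv uv' by simp
    qed
  qed
  show ?thesis
    unfolding inj_level_def
  proof (intro allI impI)
    fix x y S0 assume a: "x \<in> carrier C" "y \<in> carrier C" "K.set_sum (Suc k) S0 (\<eta> x)" "card S0 \<le> 1" "\<eta> x = \<eta> y"
    obtain S where S: "K.set_sum k S (\<eta> x)" "{s \<in> S. Suc k < fst s} = S0"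
      by (rule K.set_sum_expand[OF a(3) K.singleton_no_arrow[OF a(3,4)]])
    have "dec k S x" "dec k S y"
      using decI[OF a(1) S(1)] decI[OF a(2), of k S] S a by simp_all
    then show "x = y" using main a(5) by blast
  qed
qed

lemma inj_swap: "inj_level r \<and> swap_level r"
  by (induction r) (use inj_0 swap_0 inj_Suc swap_Suc in blast)+

lemma eta_inj: "inj_on \<eta> (carrier C)"
proof (rule inj_onI)
  fix x y assume xy: "x \<in> carrier C" "y \<in> carrier C" "\<eta> x = \<eta> y"
  obtain n where n: "x \<in> cells C n" using ex_cells[OF xy(1)] ..
  then have "y \<in> cells C n" using cells_iff_eta xy by simp
  with n show "x = y" using inj_low[OF conjunct1[OF inj_swap]] xy(3) by blast
qed

lemma eta_surj: "\<eta> ` carrier C = carrier (nu (lam C))"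
proof
  show "\<eta> ` carrier C \<subseteq> carrier (nu (lam C))" using eta_closed by blast
  show "carrier (nu (lam C)) \<subseteq> \<eta> ` carrier C"
  proof
    fix z assume "z \<in> carrier (nu (lam C))"
    then obtain n where "z \<in> cells (nu (lam C)) n" using K.N.ex_cells by blast
    then have "z \<in> cmp_closure (nu (lam C)) {atom (lam C) b |b. b \<in> B \<and> fst b \<le> n}"
      unfolding K.cells_generated .
    then show "z \<in> \<eta> ` carrier C"
    proof induction
      case (incl z)
      then obtain b where b: "b \<in> B" "z = atom (lam C) b" by blast
      then obtain e where e: "e \<in> E" "basis_class C dm e = b" using bij by (auto simp: bij_betw_def)
      then have "e \<in> carrier C" using generated by (auto simp: composition_generated_def)
      then show ?case using eta_basis e b by force
    next
      case (cmp y z m)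
      then obtain p q where pq: "p \<in> carrier C" "q \<in> carrier C" "y = \<eta> p" "z = \<eta> q" by blast
      \<comment> \<open>Surjectivity needs injectivity: composability is lifted because faces with
        equal images are equal.\<close>
      have "\<eta> (face C Pos m p) = \<eta> (face C Neg m q)"
        using cmp.hyps(3) pq by (simp add: composable_def eta_face)
      then have "composable C m p q"
        using pq eta_inj face_closed by (simp add: composable_def inj_on_eq_iff)
      then show ?case using eta_cmp cmp_closed pq by (metis image_eqI)
    qed
  qed
qed

lemma eta_iso: "omega_iso C (nu (lam C)) \<eta>"
  by (rule omega_iso_bij[OF omega_category_axioms unit_eta_hom])
    (simp add: bij_betw_def eta_inj eta_surj)

end


section \<open>Transport of bases along isomorphisms\<close>

lemma partial_order_on_image:
  assumes inj: "inj_on F B" and po: "partial_order_on B R"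
  shows "partial_order_on (F ` B) (map_prod F F ` R)"
proof -
  have R: "R \<subseteq> B \<times> B" and refl: "\<And>x. x \<in> B \<Longrightarrow> (x, x) \<in> R" and tr: "trans R" and anti: "antisym R"
    using po by (auto simp: partial_order_on_def preorder_on_def refl_on_def)
  have iff: "(F x, F y) \<in> map_prod F F ` R \<longleftrightarrow> (x, y) \<in> R" if "x \<in> B" "y \<in> B" for x y
  proof
    assume "(F x, F y) \<in> map_prod F F ` R"
    then obtain x' y' where "(x', y') \<in> R" "F x = F x'" "F y = F y'" by auto
    moreover from this have "x' = x" "y' = y" using R inj that by (auto dest: inj_onD)
    ultimately show "(x, y) \<in> R" by simp
  qed (auto intro: rev_image_eqI)
  have sub: "map_prod F F ` R \<subseteq> F ` B \<times> F ` B" using R by auto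
  have "trans (map_prod F F ` R)"
  proof (rule transI)
    fix a b c assume ab: "(a, b) \<in> map_prod F F ` R" and bc: "(b, c) \<in> map_prod F F ` R"
    then obtain x y z where xyz: "x \<in> B" "y \<in> B" "z \<in> B" "a = F x" "b = F y" "c = F z" using sub by blast
    then show "(a, c) \<in> map_prod F F ` R" using ab bc iff tr by (metis transD)
  qed
  moreover have "antisym (map_prod F F ` R)"
  proof (rule antisymI)
    fix a b assume ab: "(a, b) \<in> map_prod F F ` R" and ba: "(b, a) \<in> map_prod F F ` R"
    then obtain x y where xy: "x \<in> B" "y \<in> B" "a = F x" "b = F y" using sub by blast
    then show "a = b" using ab ba iff anti by (metis antisymD)
  qed
  moreover have "refl_on (F ` B) (map_prod F F ` R)"
    using sub refl iff by (auto simp: refl_on_def)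
  ultimately show ?thesis using sub by (simp add: partial_order_on_def preorder_on_def)
qed

context based_adc
begin

text \<open>A description without coordinates, through the positive cone and the order, both of
  which an isomorphism transports directly. Positivity of \<open>x\<close> and \<open>y\<close> says
  that zero is a lower bound.\<close>

lemma meet_one_order_iff:
  assumes x: "x \<in> carrier (chains K n)" and y: "y \<in> carrier (chains K n)"
  shows "x \<sqinter>\<^bsub>chain_order K n\<^esub> y = \<one>\<^bsub>chains K n\<^esub> \<longleftrightarrow> x \<in> posit K n \<and> y \<in> posit K n \<and>
    (\<forall>l\<in>carrier (chains K n). l \<sqsubseteq>\<^bsub>chain_order K n\<^esub> x \<and> l \<sqsubseteq>\<^bsub>chain_order K n\<^esub> y \<longrightarrow>
      l \<sqsubseteq>\<^bsub>chain_order K n\<^esub> \<one>\<^bsub>chains K n\<^esub>)"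
proof
  assume "x \<sqinter>\<^bsub>chain_order K n\<^esub> y = \<one>\<^bsub>chains K n\<^esub>"
  then have m: "min (coef n x c) (coef n y c) = 0" for c using meet_one_iff[OF x y] by blast
  then have "0 \<le> coef n x c \<and> 0 \<le> coef n y c" for c using m[of c] by linarith
  then show "x \<in> posit K n \<and> y \<in> posit K n \<and>
    (\<forall>l\<in>carrier (chains K n). l \<sqsubseteq>\<^bsub>chain_order K n\<^esub> x \<and> l \<sqsubseteq>\<^bsub>chain_order K n\<^esub> y \<longrightarrow>
      l \<sqsubseteq>\<^bsub>chain_order K n\<^esub> \<one>\<^bsub>chains K n\<^esub>)"
    using posit_iff[OF x] posit_iff[OF y] x y m by (auto simp: le_iff) (metis min.boundedI)
next
  assume a: "x \<in> posit K n \<and> y \<in> posit K n \<and>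
    (\<forall>l\<in>carrier (chains K n). l \<sqsubseteq>\<^bsub>chain_order K n\<^esub> x \<and> l \<sqsubseteq>\<^bsub>chain_order K n\<^esub> y \<longrightarrow>
      l \<sqsubseteq>\<^bsub>chain_order K n\<^esub> \<one>\<^bsub>chains K n\<^esub>)"
  note m = meet_coef[OF x y]
  have "x \<sqinter>\<^bsub>chain_order K n\<^esub> y \<sqsubseteq>\<^bsub>chain_order K n\<^esub> x" "x \<sqinter>\<^bsub>chain_order K n\<^esub> y \<sqsubseteq>\<^bsub>chain_order K n\<^esub> y"
    unfolding le_iff[OF m(1) x] le_iff[OF m(1) y] m(2) by simp_all
  then have "x \<sqinter>\<^bsub>chain_order K n\<^esub> y \<sqsubseteq>\<^bsub>chain_order K n\<^esub> \<one>\<^bsub>chains K n\<^esub>"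
    using a m(1) by blast
  then have "min (coef n x c) (coef n y c) \<le> 0" for c
    unfolding le_iff[OF m(1) G.one_closed] m(2) coef_one by blast
  moreover have "0 \<le> min (coef n x c) (coef n y c)" for c using a coef_posit by simp
  ultimately show "x \<sqinter>\<^bsub>chain_order K n\<^esub> y = \<one>\<^bsub>chains K n\<^esub>"
    using meet_one_iff[OF x y] by (metis order_antisym)
qed

lemma one_less_meet_iff_neq:
  assumes x: "x \<in> posit K n" and y: "y \<in> posit K n"
  shows "\<one>\<^bsub>chains K n\<^esub> \<sqsubset>\<^bsub>chain_order K n\<^esub> (x \<sqinter>\<^bsub>chain_order K n\<^esub> y) \<longleftrightarrow>
    x \<sqinter>\<^bsub>chain_order K n\<^esub> y \<noteq> \<one>\<^bsub>chains K n\<^esub>"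
  unfolding one_less_meet_iff[OF x y] meet_one_iff[OF posit_carrier[OF x] posit_carrier[OF y]]
  using coef_posit[OF x] coef_posit[OF y] by (metis antisym_conv2 min_def order.strict_iff_not)

lemma sbdry_spec:
  assumes x: "x \<in> carrier (chains K (Suc n))"
  shows "bdry K n x = sbdry K Pos n x \<otimes>\<^bsub>chains K n\<^esub> inv\<^bsub>chains K n\<^esub> sbdry K Neg n x"
    and "sbdry K Neg n x \<sqinter>\<^bsub>chain_order K n\<^esub> sbdry K Pos n x = \<one>\<^bsub>chains K n\<^esub>"
proof -
  note c = sbdry_coef[OF x]
  show "bdry K n x = sbdry K Pos n x \<otimes>\<^bsub>chains K n\<^esub> inv\<^bsub>chains K n\<^esub> sbdry K Neg n x"
    by (rule coef_eqI) (use c(1) x in \<open>auto simp: c(2,3) max_def\<close>)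
  show "sbdry K Neg n x \<sqinter>\<^bsub>chain_order K n\<^esub> sbdry K Pos n x = \<one>\<^bsub>chains K n\<^esub>"
    using c(1) by (auto simp: meet_one_iff c(2,3) min_def max_def)
qed

lemma hom_basis_eqI:
  assumes h: "h \<in> hom (chains K n) G" and k: "k \<in> hom (chains K n) G" and G: "group G"
    and eq: "\<And>b. b \<in> in_dim B n \<Longrightarrow> h b = k b" and x: "x \<in> carrier (chains K n)"
  shows "h x = k x"
proof -
  have ev: "eval_basis n \<in> hom (free_basis n) (chains K n)" using eval_iso by (simp add: iso_def)
  have "(h \<circ> eval_basis n) (coords n x) = (k \<circ> eval_basis n) (coords n x)"
  proof (rule hom_frag_eqI[OF hom_compose[OF ev h] hom_compose[OF ev k] G _ coords_keys[OF x]])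
    fix b assume b: "b \<in> in_dim B n"
    then show "(h \<circ> eval_basis n) (frag_of b) = (k \<circ> eval_basis n) (frag_of b)"
      using eq basis_carrier G.comm_group_axioms by simp
  qed
  then show ?thesis using eval_coords[OF x] by simp
qed

end

locale adc_isomorphism = K: adc K + L: adc L
  for K :: "'k adc_data" and L :: "'l adc_data" +
  fixes f :: "nat \<Rightarrow> 'k \<Rightarrow> 'l" and g :: "nat \<Rightarrow> 'l \<Rightarrow> 'k"
  assumes f: "f \<in> adc_hom K L" and g: "g \<in> adc_hom L K"
    and gf_id: "adc_comp K g f = adc_id K" and fg_id: "adc_comp L f g = adc_id L"
begin

sublocale f: group_hom "chains K n" "chains L n" "f n" for n
  by (rule adc_hom_group_hom[OF K.adc_axioms L.adc_axioms f])

sublocale g: group_hom "chains L n" "chains K n" "g n" for n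
  by (rule adc_hom_group_hom[OF L.adc_axioms K.adc_axioms g])

lemma gf: "x \<in> carrier (chains K n) \<Longrightarrow> g n (f n x) = x"
  using fun_cong[OF fun_cong[OF gf_id, of n], of x] by (simp add: adc_comp_def adc_id_def compose_def)

lemma fg: "y \<in> carrier (chains L n) \<Longrightarrow> f n (g n y) = y"
  using fun_cong[OF fun_cong[OF fg_id, of n], of y] by (simp add: adc_comp_def adc_id_def compose_def)

lemma f_eq_iff: "x \<in> carrier (chains K n) \<Longrightarrow> y \<in> carrier (chains K n) \<Longrightarrow> f n x = f n y \<longleftrightarrow> x = y"
  using gf by metis

lemma f_posit_iff: "x \<in> carrier (chains K n) \<Longrightarrow> f n x \<in> posit L n \<longleftrightarrow> x \<in> posit K n"
  using adc_homD(5)[OF f, of x n] adc_homD(5)[OF g, of "f n x" n] gf by metis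

lemma f_posit_image: "f n ` posit K n = posit L n"
proof
  show "f n ` posit K n \<subseteq> posit L n" using adc_homD(5)[OF f] by blast
  show "posit L n \<subseteq> f n ` posit K n"
    using adc_homD(5)[OF g] fg L.posit_carrier by (metis image_eqI subsetI)
qed

lemma f_le_iff:
  assumes "x \<in> carrier (chains K n)" "y \<in> carrier (chains K n)"
  shows "f n x \<sqsubseteq>\<^bsub>chain_order L n\<^esub> f n y \<longleftrightarrow> x \<sqsubseteq>\<^bsub>chain_order K n\<^esub> y"
  using assms f_posit_iff[of "y \<otimes>\<^bsub>chains K n\<^esub> inv\<^bsub>chains K n\<^esub> x" n]
  by (simp add: chain_order_def)

definition F :: "nat \<times> 'k \<Rightarrow> nat \<times> 'l" where
  "F b = (fst b, f (fst b) (snd b))"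

lemma fst_F [simp]: "fst (F b) = fst b"
  by (simp add: F_def)

lemma in_dim_F: "in_dim (F ` B) n = f n ` in_dim B n"
  by (force simp: in_dim_def F_def)

lemma F_inj:
  assumes "adc_basis K B" shows "inj_on F B"
proof (rule inj_onI)
  interpret based_adc K B using assms K.adc_axioms by (simp add: based_adc_def based_adc_axioms_def)
  fix a b assume ab: "a \<in> B" "b \<in> B" "F a = F b"
  then have "fst a = fst b" "f (fst a) (snd a) = f (fst a) (snd b)" by (auto simp: F_def)
  moreover have "snd a \<in> carrier (chains K (fst a))" "snd b \<in> carrier (chains K (fst b))"
    using ab basis_carrier in_dimI by auto
  ultimately show "a = b" using f_eq_iff by (metis prod_eqI)
qed

text \<open>Evaluation in \<open>L\<close> factors as relabelling of generators by \<open>g\<close>,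
  evaluation in \<open>K\<close>, and \<open>f\<close>, all of them bijective.\<close>

lemma basis_image:
  assumes B: "adc_basis K B"
  shows "adc_basis L (F ` B)"
  unfolding adc_basis_def
proof (intro allI conjI)
  fix n
  interpret B: based_adc K B using B K.adc_axioms by (simp add: based_adc_def based_adc_axioms_def)
  let ?S = "in_dim B n" and ?T = "in_dim (F ` B) n"
  have T: "?T = f n ` ?S" by (rule in_dim_F)
  have Tc: "?T \<subseteq> carrier (chains L n)" unfolding T using B.basis_carrier by auto
  have gT: "g n y \<in> ?S" if "y \<in> ?T" for y using that B.basis_carrier gf unfolding T by auto
  let ?\<phi> = "frag_extend (frag_of \<circ> g n)" and ?\<psi> = "frag_extend (frag_of \<circ> f n)"
  have \<phi>: "?\<phi> \<in> hom (free_Abelian_group ?T) (free_Abelian_group ?S)"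
    by (rule frag_extend_hom) (use gT in auto)
  have \<psi>: "?\<psi> \<in> hom (free_Abelian_group ?S) (free_Abelian_group ?T)"
    by (rule frag_extend_hom) (auto simp: T)
  have id_hom: "id \<in> hom (free_Abelian_group S) (free_Abelian_group S)" for S :: "'z set"
    by (auto simp: hom_def dest: subsetD[OF keys_add])
  have 1: "(?\<psi> \<circ> ?\<phi>) c = id c" if "Poly_Mapping.keys c \<subseteq> ?T" for c
    by (rule hom_frag_eqI[OF hom_compose[OF \<phi> \<psi>] id_hom _ _ that]) (use fg Tc in auto)
  have 2: "(?\<phi> \<circ> ?\<psi>) c = id c" if "Poly_Mapping.keys c \<subseteq> ?S" for c
    by (rule hom_frag_eqI[OF hom_compose[OF \<psi> \<phi>] id_hom _ _ that]) (use gf B.basis_carrier in auto)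
  have \<phi>_bij: "bij_betw ?\<phi> (carrier (free_Abelian_group ?T)) (carrier (free_Abelian_group ?S))"
    by (rule bij_betw_byWitness[where f' = ?\<psi>])
      (use 1 2 hom_in_carrier[OF \<phi>] hom_in_carrier[OF \<psi>] in auto)
  have f_bij: "bij_betw (f n) (carrier (chains K n)) (carrier (chains L n))"
    by (rule bij_betw_byWitness[where f' = "g n"]) (use gf fg in auto)
  have evL: "free_ext (chains L n) (\<lambda>b. b) \<in> hom (free_Abelian_group ?T) (chains L n)"
    by (rule free_ext_hom[OF L.G.comm_group_axioms]) (use Tc in auto)
  have evK: "B.eval_basis n \<in> hom (B.free_basis n) (chains K n)" using B.eval_iso by (simp add: iso_def)
  have eq: "free_ext (chains L n) (\<lambda>b. b) c = (f n \<circ> (B.eval_basis n \<circ> ?\<phi>)) c" if "Poly_Mapping.keys c \<subseteq> ?T" for c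
  proof (rule hom_frag_eqI[OF evL hom_compose[OF hom_compose[OF \<phi> evK] f.homh] L.G.is_group _ that])
    fix y assume y: "y \<in> ?T"
    then have "y \<in> carrier (chains L n)" "g n y \<in> carrier (chains K n)" using Tc by auto
    then show "free_ext (chains L n) (\<lambda>b. b) (frag_of y) = (f n \<circ> (B.eval_basis n \<circ> ?\<phi>)) (frag_of y)"
      using fg by (simp add: L.G.comm_group_axioms K.G.comm_group_axioms)
  qed
  have "bij_betw (f n \<circ> (B.eval_basis n \<circ> ?\<phi>)) (carrier (free_Abelian_group ?T)) (carrier (chains L n))"
    using bij_betw_trans[OF bij_betw_trans[OF \<phi>_bij] f_bij] B.eval_iso by (simp add: iso_def)
  moreover have "bij_betw (free_ext (chains L n) (\<lambda>b. b)) (carrier (free_Abelian_group ?T)) (carrier (chains L n)) \<longleftrightarrow>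
    bij_betw (f n \<circ> (B.eval_basis n \<circ> ?\<phi>)) (carrier (free_Abelian_group ?T)) (carrier (chains L n))"
    by (rule bij_betw_cong) (use eq in auto)
  ultimately show "free_abelian_on (chains L n) ?T"
    unfolding free_abelian_on_def iso_def using Tc evL L.G.comm_group_axioms by blast
  have "posit L n = f n ` submonoid_generated (chains K n) ?S"
    using f_posit_image B.posit_generated by metis
  also have "\<dots> = submonoid_generated (chains L n) ?T"
    unfolding T by (rule submonoid_generated_image[OF f.homh K.G.is_group L.G.is_group]) (use B.basis_carrier in auto)
  finally show "posit L n = submonoid_generated (chains L n) ?T" .
qed

end

locale based_adc_isomorphism = adc_isomorphism K L f g + B: based_adc K B
  for K :: "'k adc_data" and L :: "'l adc_data" and f g B
begin

sublocale B': based_adc L "F ` B"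
  using basis_image[OF B.basis] L.adc_axioms by (simp add: based_adc_def based_adc_axioms_def)

lemma meet_one_iff_image:
  assumes x: "x \<in> carrier (chains K n)" and y: "y \<in> carrier (chains K n)"
  shows "f n x \<sqinter>\<^bsub>chain_order L n\<^esub> f n y = \<one>\<^bsub>chains L n\<^esub> \<longleftrightarrow>
    x \<sqinter>\<^bsub>chain_order K n\<^esub> y = \<one>\<^bsub>chains K n\<^esub>"
proof -
  have all: "(\<forall>l\<in>carrier (chains L n). P l) \<longleftrightarrow> (\<forall>k\<in>carrier (chains K n). P (f n k))" for P
    using fg by (metis f.hom_closed g.hom_closed)
  have "f n \<one>\<^bsub>chains K n\<^esub> = \<one>\<^bsub>chains L n\<^esub>" by simp
  then have "f n k \<sqsubseteq>\<^bsub>chain_order L n\<^esub> \<one>\<^bsub>chains L n\<^esub> \<longleftrightarrow> k \<sqsubseteq>\<^bsub>chain_order K n\<^esub> \<one>\<^bsub>chains K n\<^esub>"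
    if "k \<in> carrier (chains K n)" for k using f_le_iff[OF that K.G.one_closed] by simp
  then show ?thesis
    unfolding B.meet_one_order_iff[OF x y] B'.meet_one_order_iff[OF f.hom_closed[OF x] f.hom_closed[OF y]] all
    using x y by (simp add: f_posit_iff f_le_iff)
qed

text \<open>The images of the two parts are again disjoint with the right difference, so the
  uniqueness in \<open>sbdry_coef\<close> recognises them.\<close>

lemma sbdry_image:
  assumes x: "x \<in> carrier (chains K (Suc n))"
  shows "sbdry L \<alpha> n (f (Suc n) x) = f n (sbdry K \<alpha> n x)"
proof -
  have c: "sbdry K \<beta> n x \<in> carrier (chains K n)" for \<beta> using B.sbdry_coef(1)[OF x] .
  have "bdry L n (f (Suc n) x) = f n (sbdry K Pos n x) \<otimes>\<^bsub>chains L n\<^esub> inv\<^bsub>chains L n\<^esub> f n (sbdry K Neg n x)"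
    using adc_homD(3)[OF f x] arg_cong[OF B.sbdry_spec(1)[OF x], of "f n"] c by simp
  moreover have "f n (sbdry K Neg n x) \<sqinter>\<^bsub>chain_order L n\<^esub> f n (sbdry K Pos n x) = \<one>\<^bsub>chains L n\<^esub>"
    using meet_one_iff_image c B.sbdry_spec(2)[OF x] by blast
  ultimately have "sbdry L Neg n (f (Suc n) x) = f n (sbdry K Neg n x) \<and> sbdry L Pos n (f (Suc n) x) = f n (sbdry K Pos n x)"
    using c x by (intro B'.sbdry_coef(4)) auto
  then show ?thesis by (cases \<alpha>) auto
qed

lemma atom_image:
  assumes b: "b \<in> B"
  shows "atom L (F b) \<alpha> n = f n (atom K b \<alpha> n)"
proof (cases "n \<le> fst b")
  case True
  then show ?thesis
  proof (induction rule: inc_induct)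
    case base then show ?case using B'.atom_top[of "F b" \<alpha>] B.atom_top[of b \<alpha>] by (simp add: F_def)
  next
    case (step n)
    then show ?case
      using B'.atom_below[of n "F b" \<alpha>] B.atom_below[of n b \<alpha>] sbdry_image[OF B.atom_carrier[OF b]] by simp
  qed
qed (simp add: B.atom_above B'.atom_above)

lemma unital_image: "unital K B \<Longrightarrow> unital L (F ` B)"
  unfolding unital_def using atom_image adc_homD(4)[OF f] B.atom_carrier by auto

lemma loop_free_image:
  assumes "loop_free K B" shows "loop_free L (F ` B)"
proof -
  obtain R where R: "\<And>n. partial_order_on B (R n)"
    "\<And>n a b. a \<in> B \<Longrightarrow> b \<in> B \<Longrightarrow> fst a > n \<Longrightarrow> fst b > n \<Longrightarrow>
       \<one>\<^bsub>chains K n\<^esub> \<sqsubset>\<^bsub>chain_order K n\<^esub> (atom K a Pos n \<sqinter>\<^bsub>chain_order K n\<^esub> atom K b Neg n) \<Longrightarrow>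
       (a, b) \<in> R n \<and> a \<noteq> b"
    using assms unfolding loop_free_def by blast
  have inj: "inj_on F B" by (rule F_inj[OF B.basis])
  have "(F a, F b) \<in> map_prod F F ` R n \<and> F a \<noteq> F b"
    if ab: "a \<in> B" "b \<in> B" "n < fst a" "n < fst b"
      and m: "\<one>\<^bsub>chains L n\<^esub> \<sqsubset>\<^bsub>chain_order L n\<^esub> (atom L (F a) Pos n \<sqinter>\<^bsub>chain_order L n\<^esub> atom L (F b) Neg n)"
    for n a b
  proof -
    have "atom L (F a) Pos n \<sqinter>\<^bsub>chain_order L n\<^esub> atom L (F b) Neg n \<noteq> \<one>\<^bsub>chains L n\<^esub>"
      using m B'.one_less_meet_iff_neq B'.atom_posit ab(1,2) by blast
    then have "atom K a Pos n \<sqinter>\<^bsub>chain_order K n\<^esub> atom K b Neg n \<noteq> \<one>\<^bsub>chains K n\<^esub>"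
      using meet_one_iff_image[OF B.atom_carrier[OF ab(1)] B.atom_carrier[OF ab(2)]] atom_image ab(1,2) by metis
    then have "\<one>\<^bsub>chains K n\<^esub> \<sqsubset>\<^bsub>chain_order K n\<^esub> (atom K a Pos n \<sqinter>\<^bsub>chain_order K n\<^esub> atom K b Neg n)"
      using B.one_less_meet_iff_neq B.atom_posit ab(1,2) by blast
    then have "(a, b) \<in> R n \<and> a \<noteq> b" using R(2) ab by blast
    then show ?thesis using inj ab(1,2) by (auto dest: inj_onD intro: rev_image_eqI)
  qed
  then have "\<forall>a\<in>F ` B. \<forall>b\<in>F ` B. fst a > n \<and> fst b > n \<and>
      \<one>\<^bsub>chains L n\<^esub> \<sqsubset>\<^bsub>chain_order L n\<^esub> (atom L a Pos n \<sqinter>\<^bsub>chain_order L n\<^esub> atom L b Neg n)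
      \<longrightarrow> (a, b) \<in> map_prod F F ` R n \<and> a \<noteq> b" for n
    unfolding ball_simps(9) using fst_F by metis
  then show ?thesis
    unfolding loop_free_def using partial_order_on_image[OF inj R(1)]
    by (intro exI[of _ "\<lambda>n. map_prod F F ` R n"]) blast
qed

lemma strongly_loop_free_image:
  assumes "strongly_loop_free K B" shows "strongly_loop_free L (F ` B)"
proof -
  obtain R where R: "partial_order_on B R"
    "\<And>p a q b. (p, a) \<in> B \<Longrightarrow> (q, b) \<in> B \<Longrightarrow>
        q = Suc p \<and> a \<sqsubseteq>\<^bsub>chain_order K p\<^esub> sbdry K Neg p b \<or>
        p = Suc q \<and> b \<sqsubseteq>\<^bsub>chain_order K q\<^esub> sbdry K Pos q a \<Longrightarrow>
        ((p, a), (q, b)) \<in> R \<and> (p, a) \<noteq> (q, b)"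
    using assms unfolding strongly_loop_free_def by blast
  have inj: "inj_on F B" by (rule F_inj[OF B.basis])
  have "((p, a'), (q, b')) \<in> map_prod F F ` R \<and> (p, a') \<noteq> (q, b')"
    if ab: "(p, a') \<in> F ` B" "(q, b') \<in> F ` B"
      "q = Suc p \<and> a' \<sqsubseteq>\<^bsub>chain_order L p\<^esub> sbdry L Neg p b' \<or>
       p = Suc q \<and> b' \<sqsubseteq>\<^bsub>chain_order L q\<^esub> sbdry L Pos q a'" for p a' q b'
  proof -
    obtain a b where a: "(p, a) \<in> B" "a' = f p a" and b: "(q, b) \<in> B" "b' = f q b"
      using ab(1,2) by (auto simp: F_def)
    have c: "a \<in> carrier (chains K p)" "b \<in> carrier (chains K q)"
      using a b B.basis_carrier by (auto simp: in_dim_def)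
    have "q = Suc p \<and> a \<sqsubseteq>\<^bsub>chain_order K p\<^esub> sbdry K Neg p b \<or>
        p = Suc q \<and> b \<sqsubseteq>\<^bsub>chain_order K q\<^esub> sbdry K Pos q a"
      using ab(3)
    proof
      assume l: "q = Suc p \<and> a' \<sqsubseteq>\<^bsub>chain_order L p\<^esub> sbdry L Neg p b'"
      then have b': "b \<in> carrier (chains K (Suc p))" using c by simp
      show ?thesis
        using l f_le_iff[OF c(1) B.sbdry_coef(1)[OF b']] sbdry_image[OF b'] a(2) b(2) by auto
    next
      assume l: "p = Suc q \<and> b' \<sqsubseteq>\<^bsub>chain_order L q\<^esub> sbdry L Pos q a'"
      then have a': "a \<in> carrier (chains K (Suc q))" using c by simp
      show ?thesis
        using l f_le_iff[OF c(2) B.sbdry_coef(1)[OF a']] sbdry_image[OF a'] a(2) b(2) by auto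
    qed
    then have "((p, a), (q, b)) \<in> R \<and> (p, a) \<noteq> (q, b)" using R(2) a b by blast
    moreover have "(p, a') = F (p, a)" "(q, b') = F (q, b)" using a b by (simp_all add: F_def)
    ultimately show ?thesis using inj a b by (metis (no_types, lifting) inj_onD map_prod_imageI)
  qed
  then show ?thesis
    unfolding strongly_loop_free_def using partial_order_on_image[OF inj R(1)] by blast
qed

end


section \<open>The basis of \<open>\<nu> K\<close>\<close>

context loop_free_adc
begin

text \<open>The candidate inverse of the counit: the linear extension of the map that sends a basis
  element to the class of its atom.\<close>

definition counit_inv :: "nat \<Rightarrow> 'k \<Rightarrow> ((sign \<Rightarrow> nat \<Rightarrow> 'k) \<Rightarrow>\<^sub>0 int) set" where
  "counit_inv n = (\<lambda>x\<in>carrier (chains K n).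
     free_ext (lam_chains (nu K) n) (\<lambda>b. lam_class (nu K) n (atom K (n, b))) (coords n x))"

lemma atom_class_closed:
  "b \<in> in_dim B n \<Longrightarrow> lam_class (nu K) n (atom K (n, b)) \<in> carrier (lam_chains (nu K) n)"
  using atom_cells[of "(n, b)"] by (intro N.lam_class_closed) (simp add: in_dim_def)

lemma counit_inv_hom: "counit_inv n \<in> hom (chains K n) (lam_chains (nu K) n)"
proof -
  have "free_ext (lam_chains (nu K) n) (\<lambda>b. lam_class (nu K) n (atom K (n, b))) \<in> hom (free_basis n) (lam_chains (nu K) n)"
    by (rule free_ext_hom[OF N.L.comm_group_axioms]) (use atom_class_closed in auto)
  from hom_compose[OF coords_hom this] show ?thesis
    unfolding counit_inv_def by (auto simp: hom_def)
qed

lemma counit_inv_basis: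
  assumes b: "b \<in> in_dim B n"
  shows "counit_inv n b = lam_class (nu K) n (atom K (n, b))"
proof -
  have "coords n b = frag_of b"
    using coords_eval[of "frag_of b" n] b basis_carrier[OF b] G.comm_group_axioms by simp
  then show ?thesis
    using basis_carrier[OF b] atom_class_closed[OF b] N.L.comm_group_axioms by (simp add: counit_inv_def)
qed

text \<open>Generation by atoms makes the counit invertible at this point: both sides are additive
  under composition in dimensions below \<open>n\<close>, so it is enough to compare them on atoms.
  Atoms of dimension below \<open>n\<close> give zero on both sides.\<close>

lemma counit_inv_cell:
  assumes "x \<in> cells (nu K) n"
  shows "counit_inv n (x Neg n) = lam_class (nu K) n x"
proof -
  interpret h: group_hom "chains K n" "lam_chains (nu K) n" "counit_inv n"
    using counit_inv_hom G.is_group N.L.is_group by (simp add: group_hom_def group_hom_axioms_def)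
  have cl: "cells (nu K) n = cmp_closure (nu K) {atom K b |b. b \<in> B \<and> fst b \<le> n}" by (rule cells_generated)
  have "x \<in> cmp_closure (nu K) {atom K b |b. b \<in> B \<and> fst b \<le> n}" using assms cl by simp
  then show ?thesis
  proof induction
    case (incl x)
    then obtain b where b: "b \<in> B" "fst b \<le> n" "x = atom K b" by blast
    show ?case
    proof (cases "fst b = n")
      case True
      then have "(n, snd b) = b" by auto
      then show ?thesis using True b counit_inv_basis[OF in_dimI[OF b(1)]] atom_top[of b Neg] by simp
    next
      case False
      then show ?thesis
        using b N.lam_class_low[OF atom_cells[OF b(1)], of n] atom_above[of b n Neg] by simp
    qed
  next
    case (cmp p q m)
    have pq: "p \<in> cells (nu K) n" "q \<in> cells (nu K) n" using cmp.hyps cl by auto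
    show ?case
    proof (cases "m < n")
      case True
      then show ?thesis
        using N.lam_class_cmp[OF True pq cmp.hyps(3)] cmp.IH nuD(2)[OF N.cells_carrier[OF pq(1)]] nuD(2)[OF N.cells_carrier[OF pq(2)]]
        by (simp add: nu_cmp[OF cmp.hyps(3)])
    next
      case False
      then have "cmp (nu K) m p q = p" using N.cmp_cell_right[OF cmp.hyps(3)] N.cells_mono[of n m] pq by simp
      then show ?thesis using cmp.IH by simp
    qed
  qed
qed

lemma counit_counit_inv:
  assumes "x \<in> carrier (chains K n)"
  shows "counit_pi K n (counit_inv n x) = x"
proof -
  have "(counit_pi K n \<circ> counit_inv n) x = id x"
  proof (rule hom_basis_eqI[OF hom_compose[OF counit_inv_hom] _ G.is_group _ assms])
    show "counit_pi K n \<in> hom (lam_chains (nu K) n) (chains K n)" using adc_homD(1)[OF counit_pi_hom] by simp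
    show "id \<in> hom (chains K n) (chains K n)" by (auto simp: hom_def)
    fix b assume b: "b \<in> in_dim B n"
    then have "(n, b) \<in> B" by (simp add: in_dim_def)
    then show "(counit_pi K n \<circ> counit_inv n) b = id b"
      using counit_pi_class[OF atom_cells, of "(n, b)"] atom_top[of "(n, b)" Neg] by (simp add: counit_inv_basis[OF b])
  qed
  then show ?thesis by simp
qed

lemma counit_inv_counit:
  assumes "X \<in> carrier (lam_chains (nu K) n)"
  shows "counit_inv n (counit_pi K n X) = X"
proof -
  have p: "counit_pi K n \<in> hom (lam_chains (nu K) n) (chains K n)" using adc_homD(1)[OF counit_pi_hom] by simp
  have "(counit_inv n \<circ> counit_pi K n) X = id X"
  proof (rule N.lam_hom_eqI[OF hom_compose[OF p counit_inv_hom] _ N.L.is_group _ assms])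
    show "id \<in> hom (lam_chains (nu K) n) (lam_chains (nu K) n)" by (auto simp: hom_def)
  qed (simp add: counit_pi_class counit_inv_cell)
  then show ?thesis by simp
qed

lemma counit_inv_adc_hom: "counit_inv \<in> adc_hom K (lam (nu K))"
proof -
  interpret L: adc "lam (nu K)" by (rule N.adc_lam)
  note pD = adc_homD[OF counit_pi_hom, unfolded lam_simps]
  have cl: "counit_inv n x \<in> carrier (lam_chains (nu K) n)" if "x \<in> carrier (chains K n)" for n x
    using hom_in_carrier[OF counit_inv_hom that] .
  \<comment> \<open>Compatibility with the boundary is inherited from the counit, which is a chain
    map and already known to be bijective.\<close>
  have "counit_inv n (bdry K n x) = bdry (lam (nu K)) n (counit_inv (Suc n) x)"
    if x: "x \<in> carrier (chains K (Suc n))" for n x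
  proof -
    have "counit_pi K n (bdry (lam (nu K)) n (counit_inv (Suc n) x)) = bdry K n x"
      using pD(3)[OF cl[OF x]] counit_counit_inv[OF x] by simp
    then show ?thesis
      using counit_inv_counit[of "bdry (lam (nu K)) n (counit_inv (Suc n) x)" n] L.D.hom_closed[of "counit_inv (Suc n) x" n] cl[OF x]
      by simp
  qed
  moreover have "aug (lam (nu K)) (counit_inv 0 x) = aug K x" if x: "x \<in> carrier (chains K 0)" for x
    using pD(4)[OF cl[OF x]] counit_counit_inv[OF x] by simp
  moreover have "counit_inv n ` posit K n \<subseteq> posit (lam (nu K)) n" for n
  proof -
    have "counit_inv n ` posit K n = submonoid_generated (lam_chains (nu K) n) (counit_inv n ` in_dim B n)"
      unfolding posit_generated
      by (rule submonoid_generated_image[OF counit_inv_hom G.is_group N.L.is_group]) (use basis_carrier in auto)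
    moreover have "x \<in> posit (lam (nu K)) n" if "x \<in> submonoid_generated (lam_chains (nu K) n) (counit_inv n ` in_dim B n)" for x
      using that
    proof induction
      case one then show ?case using L.posit_one[of n] by simp
    next
      case (incl s)
      then obtain b where b: "b \<in> in_dim B n" "s = counit_inv n b" by blast
      then show ?case
        using N.lam_posit_class[of "atom K (n, b)" n] atom_cells[of "(n, b)"] counit_inv_basis[OF b(1)] by (simp add: in_dim_def)
    next
      case (mult x y) then show ?case using L.posit_mult[of x n y] by simp
    qed
    ultimately show ?thesis by blast
  qed
  moreover have "counit_inv n \<in> carrier (chains K n) \<rightarrow>\<^sub>E carrier (lam_chains (nu K) n)" for n
  proof -
    have "counit_inv n \<in> extensional (carrier (chains K n))" by (simp add: counit_inv_def)
    then show ?thesis unfolding PiE_def using cl by blast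
  qed
  ultimately show ?thesis
    unfolding adc_hom_def using counit_inv_hom by simp
qed

lemma counit_isomorphism:
  "adc_isomorphism K (lam (nu K)) counit_inv (counit_pi K)"
  "adc_isomorphism (lam (nu K)) K (counit_pi K) counit_inv"
proof -
  have "adc_comp K (counit_pi K) counit_inv = adc_id K"
    unfolding adc_comp_def adc_id_def compose_def using counit_counit_inv by (auto simp: fun_eq_iff)
  moreover have "adc_comp (lam (nu K)) counit_inv (counit_pi K) = adc_id (lam (nu K))"
    unfolding adc_comp_def adc_id_def compose_def using counit_inv_counit by (auto simp: fun_eq_iff)
  ultimately show "adc_isomorphism K (lam (nu K)) counit_inv (counit_pi K)"
    "adc_isomorphism (lam (nu K)) K (counit_pi K) counit_inv"
    using adc_axioms N.adc_lam counit_inv_adc_hom counit_pi_hom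
    by (simp_all add: adc_isomorphism_def adc_isomorphism_axioms_def)
qed

lemma counit_iso: "adc_iso (lam (nu K)) K (counit_pi K)"
  using counit_isomorphism(2) unfolding adc_iso_def adc_isomorphism_def adc_isomorphism_axioms_def by blast

text \<open>The atoms form the basis; \<open>counit_inv\<close> sends the basis of \<open>K\<close>
  to their classes, so loop-freeness is transported along \<open>I.F\<close>. Atomicity is the
  disjointness of the two parts of an atom.\<close>

lemma nu_basis:
  obtains E dm B' where "omega_basis (nu K) E dm B'" "atomic (nu K) E dm" "loop_free (lam (nu K)) B'"
    "strongly_loop_free K B \<Longrightarrow> strongly_loop_free (lam (nu K)) B'"
proof -
  interpret I: adc_isomorphism K "lam (nu K)" counit_inv "counit_pi K" by (rule counit_isomorphism(1))
  interpret I: based_adc_isomorphism K "lam (nu K)" counit_inv "counit_pi K" B ..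
  define E where "E = atom K ` B"
  define dm where "dm = (\<lambda>x. fst (inv_into B (atom K) x))"
  have inj: "inj_on (atom K) B" using atom_inj by (auto intro: inj_onI)
  have dm: "dm (atom K b) = fst b" if "b \<in> B" for b using that inj by (simp add: dm_def)
  have "{e \<in> E. dm e \<le> n} = {atom K b |b. b \<in> B \<and> fst b \<le> n}" for n
    using dm unfolding E_def by (auto simp del: split_paired_All split_paired_Ex)
  then have gen: "composition_generated (nu K) E dm"
    unfolding composition_generated_def using cells_generated atom_nu by (auto simp: E_def)
  have bc: "basis_class (nu K) dm (atom K b) = I.F b" if "b \<in> B" for b
    using dm[OF that] counit_inv_basis[OF in_dimI[OF that]] by (simp add: basis_class_def I.F_def)
  have "bij_betw (basis_class (nu K) dm) E (I.F ` B)"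
  proof (rule bij_betw_imageI)
    show "inj_on (basis_class (nu K) dm) E"
      unfolding E_def using I.F_inj[OF basis] bc by (auto simp: inj_on_def)
    show "basis_class (nu K) dm ` E = I.F ` B"
      unfolding E_def using bc by (auto simp: image_image)
  qed
  then have ob: "omega_basis (nu K) E dm (I.F ` B)"
    unfolding omega_basis_def using gen I.basis_image[OF basis] by simp
  have "lam_class (nu K) n (face (nu K) Neg n e) \<sqinter>\<^bsub>chain_order (lam (nu K)) n\<^esub> lam_class (nu K) n (face (nu K) Pos n e)
       = \<one>\<^bsub>chains (lam (nu K)) n\<^esub>" if e: "e \<in> E" "n < dm e" for e n
  proof -
    obtain b where b: "b \<in> B" "e = atom K b" using e by (auto simp: E_def)
    have n: "n < fst b" using e dm b by simp
    have cls: "lam_class (nu K) n (face (nu K) \<alpha> n e) = counit_inv n (atom K b \<alpha> n)" for \<alpha>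
      using counit_inv_cell[OF N.face_cells[OF atom_nu[OF b(1)]], of n \<alpha>] b by (simp add: nu_face)
    have "min (cell_coef (atom K b) Neg n c) (cell_coef (atom K b) Pos n c) = 0" for c
      using atom_disjoint[OF b(1) n, of c] atom_coef_nonneg[OF b(1)] by (auto simp: min_def order_antisym)
    then show ?thesis
      unfolding cls using I.meet_one_iff_image meet_one_iff atom_carrier[OF b(1)] by blast
  qed
  then have at: "atomic (nu K) E dm" unfolding atomic_def by blast
  have lf: "loop_free K B"
    unfolding loop_free_def using order loop_free by (intro exI[of _ R]) blast
  show thesis
    using that[OF ob at I.loop_free_image[OF lf] I.strongly_loop_free_image] .
qed

end


section \<open>The equivalence\<close>

lemma based_adcI: "adc K \<Longrightarrow> adc_basis K B \<Longrightarrow> based_adc K B"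
  by (simp add: based_adc_def based_adc_axioms_def)

lemma loop_free_adcI:
  assumes "adc K" "adc_basis K B" "unital K B" "loop_free K B"
  obtains R where "loop_free_adc K B R"
proof -
  obtain R where "\<And>n. partial_order_on B (R n)"
    "\<And>n a b. a \<in> B \<Longrightarrow> b \<in> B \<Longrightarrow> fst a > n \<Longrightarrow> fst b > n \<Longrightarrow>
       \<one>\<^bsub>chains K n\<^esub> \<sqsubset>\<^bsub>chain_order K n\<^esub> (atom K a Pos n \<sqinter>\<^bsub>chain_order K n\<^esub> atom K b Neg n) \<Longrightarrow>
       (a, b) \<in> R n \<and> a \<noteq> b"
    using assms(4) unfolding loop_free_def by blast
  then have "loop_free_adc K B R"
    using assms based_adcI by (simp add: loop_free_adc_def loop_free_adc_axioms_def)
  then show thesis by (rule that)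
qed

text \<open>By downward induction: the classes of the faces of \<open>e\<close> satisfy the boundary
  equation and are disjoint by atomicity, so by uniqueness they are the signed boundary parts that
  define the atom.\<close>

lemma eta_atomic:
  assumes C: "omega_category C" and ob: "omega_basis C E dm B" and at: "atomic C E dm" and e: "e \<in> E"
  shows "unit_eta C e = atom (lam C) (basis_class C dm e)"
proof -
  interpret omega_category C by fact
  interpret K: based_adc "lam C" B using ob adc_lam by (intro based_adcI) (auto simp: omega_basis_def)
  have gen: "composition_generated C E dm" using ob by (simp add: omega_basis_def)
  have ec: "e \<in> cells C (dm e)"
    using gen e unfolding composition_generated_def by (auto intro: cmp_closure.incl)
  have ecar: "e \<in> carrier C" using ec cells_carrier by blast
  let ?b = "basis_class C dm e"
  have eta: "unit_eta C e \<alpha> n = lam_class C n (face C \<alpha> n e)" for \<alpha> n using ecar by (simp add: unit_eta_apply)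
  have "unit_eta C e \<alpha> n = atom (lam C) ?b \<alpha> n" for \<alpha> n
  proof (cases "n \<le> dm e")
    case True
    then show ?thesis
    proof (induction rule: inc_induct)
      case base
      then show ?case using K.atom_top[of ?b \<alpha>] ec by (simp add: eta basis_class_def face_of_cell)
    next
      case (step n)
      have "sbdry (lam C) Neg n (unit_eta C e \<alpha> (Suc n)) = unit_eta C e Neg n \<and>
          sbdry (lam C) Pos n (unit_eta C e \<alpha> (Suc n)) = unit_eta C e Pos n"
      proof (rule K.sbdry_coef(4))
        show "bdry (lam C) n (unit_eta C e \<alpha> (Suc n)) =
            unit_eta C e Pos n \<otimes>\<^bsub>chains (lam C) n\<^esub> inv\<^bsub>chains (lam C) n\<^esub> unit_eta C e Neg n"
          using K.nuD(3)[OF unit_eta_closed[OF ecar]] by simp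
        show "unit_eta C e Neg n \<sqinter>\<^bsub>chain_order (lam C) n\<^esub> unit_eta C e Pos n = \<one>\<^bsub>chains (lam C) n\<^esub>"
          using at e step(2) unfolding atomic_def eta by blast
      qed (use K.nuD(2)[OF unit_eta_closed[OF ecar]] in auto)
      then have "sbdry (lam C) \<alpha> n (unit_eta C e \<alpha> (Suc n)) = unit_eta C e \<alpha> n" by (cases \<alpha>) auto
      moreover have "n < fst ?b" using step(2) by (simp add: basis_class_def)
      ultimately show ?case using K.atom_below step.IH by simp
    qed
  next
    case False
    then have "unit_eta C e \<alpha> n = \<one>\<^bsub>chains (lam C) n\<^esub>"
      using K.nu_cells_iff[of "unit_eta C e" "dm e"] omega_homD(5)[OF unit_eta_hom ec] by simp
    then show ?thesis using False K.atom_above[of ?b n \<alpha>] by (simp add: basis_class_def)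
  qed
  then show ?thesis by (intro ext)
qed

lemma lam_unital:
  assumes C: "omega_category C" and ob: "omega_basis C E dm B" and at: "atomic C E dm"
  shows "unital (lam C) B"
proof -
  interpret omega_category C by fact
  interpret K: adc "lam C" by (rule adc_lam)
  show ?thesis
    unfolding unital_def
  proof (intro ballI allI)
    fix b \<alpha> assume "b \<in> B"
    then obtain e where e: "e \<in> E" "b = basis_class C dm e"
      using ob unfolding omega_basis_def bij_betw_def by blast
    then have "e \<in> carrier C" using ob by (auto simp: omega_basis_def composition_generated_def)
    then show "aug (lam C) (atom (lam C) b \<alpha> 0) = 1"
      using K.nuD(4)[OF unit_eta_closed] eta_atomic[OF C ob at e(1)] e(2) by metis
  qed
qed

lemma loop_free_atomic_lam:
  assumes "omega_loop_free_atomic C"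
  shows "adc_loop_free_unital (lam C) \<and> omega_iso C (nu (lam C)) (unit_eta C)"
proof -
  obtain E dm B where C: "omega_category C" and ob: "omega_basis C E dm B" and at: "atomic C E dm"
    and lf: "loop_free (lam C) B"
    using assms unfolding omega_loop_free_atomic_def by blast
  interpret omega_category C by fact
  have b: "adc_basis (lam C) B" using ob by (simp add: omega_basis_def)
  note un = lam_unital[OF C ob at]
  obtain R where R: "loop_free_adc (lam C) B R" using loop_free_adcI[OF adc_lam b un lf] .
  interpret based_omega_category C E dm B R
    using C ob R eta_atomic[OF C ob at]
    by (simp add: based_omega_category_def based_omega_category_axioms_def omega_basis_def)
  show ?thesis
    using adc_lam b un lf eta_iso unfolding adc_loop_free_unital_def by blast
qed

lemma strongly_imp_loop_free_adc:
  assumes "adc_strongly_loop_free_unital K" shows "adc_loop_free_unital K"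
  using assms based_adc.strongly_loop_free_imp_loop_free[OF based_adcI]
  unfolding adc_strongly_loop_free_unital_def adc_loop_free_unital_def by blast

lemma strongly_imp_loop_free_omega:
  assumes "omega_strongly_loop_free_atomic C" shows "omega_loop_free_atomic C"
  using assms based_adc.strongly_loop_free_imp_loop_free[OF based_adcI[OF omega_category.adc_lam]]
  unfolding omega_strongly_loop_free_atomic_def omega_loop_free_atomic_def omega_basis_def by blast

text \<open>The two existence statements may speak of different bases of \<open>lam C\<close>;
  uniqueness of bases identifies them.\<close>

lemma strongly_lam_iff:
  assumes "omega_loop_free_atomic C"
  shows "omega_strongly_loop_free_atomic C \<longleftrightarrow> adc_strongly_loop_free_unital (lam C)"
proof
  assume "omega_strongly_loop_free_atomic C"
  then obtain E dm B where a: "omega_category C" "omega_basis C E dm B" "atomic C E dm" "strongly_loop_free (lam C) B"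
    unfolding omega_strongly_loop_free_atomic_def by blast
  then show "adc_strongly_loop_free_unital (lam C)"
    using lam_unital[OF a(1-3)] omega_category.adc_lam[OF a(1)]
    unfolding adc_strongly_loop_free_unital_def omega_basis_def by blast
next
  assume "adc_strongly_loop_free_unital (lam C)"
  then obtain B' where B': "adc (lam C)" "adc_basis (lam C) B'" "strongly_loop_free (lam C) B'"
    unfolding adc_strongly_loop_free_unital_def by blast
  obtain E dm B where a: "omega_category C" "omega_basis C E dm B" "atomic C E dm"
    using assms unfolding omega_loop_free_atomic_def by blast
  have "B = B'" using adc_basis_unique[OF B'(1) _ B'(2)] a(2) unfolding omega_basis_def by blast
  then show "omega_strongly_loop_free_atomic C"
    using a B'(3) unfolding omega_strongly_loop_free_atomic_def by blast
qed

lemma loop_free_unital_nu: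
  assumes "adc_loop_free_unital K"
  shows "omega_loop_free_atomic (nu K) \<and> adc_iso (lam (nu K)) K (counit_pi K)"
proof -
  obtain B where a: "adc K" "adc_basis K B" "unital K B" "loop_free K B"
    using assms unfolding adc_loop_free_unital_def by blast
  obtain R where "loop_free_adc K B R" using loop_free_adcI[OF a] .
  then interpret loop_free_adc K B R .
  obtain E dm B' where "omega_basis (nu K) E dm B'" "atomic (nu K) E dm" "loop_free (lam (nu K)) B'"
    using nu_basis by blast
  then show ?thesis
    using counit_iso omega_category_nu unfolding omega_loop_free_atomic_def by blast
qed

text \<open>Forwards, \<open>nu_basis\<close> transports the order; backwards, a strongly loop-free
  basis of \<open>lam (nu K)\<close> is carried to \<open>K\<close> by the counit.\<close>

lemma strongly_nu_iff:
  assumes "adc_loop_free_unital K"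
  shows "adc_strongly_loop_free_unital K \<longleftrightarrow> omega_strongly_loop_free_atomic (nu K)"
proof
  assume "adc_strongly_loop_free_unital K"
  then obtain B where a: "adc K" "adc_basis K B" "unital K B" "strongly_loop_free K B"
    unfolding adc_strongly_loop_free_unital_def by blast
  have lf: "loop_free K B"
    using based_adc.strongly_loop_free_imp_loop_free[OF based_adcI[OF a(1,2)] a(4)] .
  obtain R where "loop_free_adc K B R" using loop_free_adcI[OF a(1-3) lf] .
  then interpret loop_free_adc K B R .
  obtain E dm B' where "omega_basis (nu K) E dm B'" "atomic (nu K) E dm" "strongly_loop_free (lam (nu K)) B'"
    using nu_basis a(4) by metis
  then show "omega_strongly_loop_free_atomic (nu K)"
    using omega_category_nu unfolding omega_strongly_loop_free_atomic_def by blast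
next
  assume s: "omega_strongly_loop_free_atomic (nu K)"
  then have "adc_strongly_loop_free_unital (lam (nu K))"
    using strongly_lam_iff strongly_imp_loop_free_omega by blast
  then obtain B' where B': "adc_basis (lam (nu K)) B'" "unital (lam (nu K)) B'" "strongly_loop_free (lam (nu K)) B'"
    unfolding adc_strongly_loop_free_unital_def by blast
  obtain B where a: "adc K" "adc_basis K B" "unital K B" "loop_free K B"
    using assms unfolding adc_loop_free_unital_def by blast
  obtain R where "loop_free_adc K B R" using loop_free_adcI[OF a] .
  then interpret loop_free_adc K B R .
  interpret I: adc_isomorphism "lam (nu K)" K "counit_pi K" counit_inv by (rule counit_isomorphism(2))
  interpret I: based_adc_isomorphism "lam (nu K)" K "counit_pi K" counit_inv B'
    by (rule based_adc_isomorphism.intro[OF I.adc_isomorphism_axioms based_adcI[OF N.adc_lam B'(1)]])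
  show "adc_strongly_loop_free_unital K"
    unfolding adc_strongly_loop_free_unital_def
    using a(1) I.basis_image[OF B'(1)] I.unital_image[OF B'(2)] I.strongly_loop_free_image[OF B'(3)] by blast
qed


text \<open>The subcategories are full, so they are given by predicates on objects. The adjunction
  restricts to an adjoint equivalence as soon as both functors respect these predicates and the unit
  and counit are invertible on them.\<close>

theorem theorem5p11:
  shows
  "\<comment> \<open>\<open>\<lambda>\<close> is a functor\<close>
   (\<forall>C :: 'a omega_cat. omega_category C \<longrightarrow> adc (lam C)) \<and>
   (\<forall>(C :: 'a omega_cat) (D :: 'b omega_cat) f.
      omega_category C \<and> omega_category D \<and> f \<in> omega_hom C D \<longrightarrow>
      lam_map C D f \<in> adc_hom (lam C) (lam D)) \<and>
   (\<forall>C :: 'a omega_cat. omega_category C \<longrightarrow> lam_map C C (omega_id C) = adc_id (lam C)) \<and>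
   (\<forall>(C :: 'a omega_cat) (D :: 'b omega_cat) (E :: 'c omega_cat) f g.
      omega_category C \<and> omega_category D \<and> omega_category E \<and>
      f \<in> omega_hom C D \<and> g \<in> omega_hom D E \<longrightarrow>
      lam_map C E (omega_comp C g f) = adc_comp (lam C) (lam_map D E g) (lam_map C D f)) \<and>

   \<comment> \<open>\<open>\<nu>\<close> is a functor\<close>
   (\<forall>K :: 'k adc_data. adc K \<longrightarrow> omega_category (nu K)) \<and>
   (\<forall>(K :: 'k adc_data) (L :: 'l adc_data) f.
      adc K \<and> adc L \<and> f \<in> adc_hom K L \<longrightarrow>
      nu_map K f \<in> omega_hom (nu K) (nu L)) \<and>
   (\<forall>K :: 'k adc_data. adc K \<longrightarrow> nu_map K (adc_id K) = omega_id (nu K)) \<and>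
   (\<forall>(K :: 'k adc_data) (L :: 'l adc_data) (M :: 'm adc_data) f g.
      adc K \<and> adc L \<and> adc M \<and> f \<in> adc_hom K L \<and> g \<in> adc_hom L M \<longrightarrow>
      nu_map K (adc_comp K g f) = omega_comp (nu K) (nu_map L g) (nu_map K f)) \<and>

   \<comment> \<open>\<open>\<eta>\<close> and \<open>\<pi>\<close> are natural transformations\<close>
   (\<forall>C :: 'a omega_cat. omega_category C \<longrightarrow> unit_eta C \<in> omega_hom C (nu (lam C))) \<and>
   (\<forall>(C :: 'a omega_cat) (D :: 'b omega_cat) f.
      omega_category C \<and> omega_category D \<and> f \<in> omega_hom C D \<longrightarrow>
      omega_comp C (nu_map (lam C) (lam_map C D f)) (unit_eta C) = omega_comp C (unit_eta D) f) \<and>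
   (\<forall>K :: 'k adc_data. adc K \<longrightarrow> counit_pi K \<in> adc_hom (lam (nu K)) K) \<and>
   (\<forall>(K :: 'k adc_data) (L :: 'l adc_data) f.
      adc K \<and> adc L \<and> f \<in> adc_hom K L \<longrightarrow>
      adc_comp (lam (nu K)) (counit_pi L) (lam_map (nu K) (nu L) (nu_map K f)) =
      adc_comp (lam (nu K)) f (counit_pi K)) \<and>

   \<comment> \<open>the triangle identities\<close>
   (\<forall>C :: 'a omega_cat. omega_category C \<longrightarrow>
      adc_comp (lam C) (counit_pi (lam C)) (lam_map C (nu (lam C)) (unit_eta C)) =
      adc_id (lam C)) \<and>
   (\<forall>K :: 'k adc_data. adc K \<longrightarrow>
      omega_comp (nu K) (nu_map (lam (nu K)) (counit_pi K)) (unit_eta (nu K)) =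
      omega_id (nu K)) \<and>

   \<comment> \<open>the adjunction restricts to an adjoint equivalence of the full subcategories\<close>
   (\<forall>C :: 'a omega_cat. omega_loop_free_atomic C \<longrightarrow>
      adc_loop_free_unital (lam C) \<and> omega_iso C (nu (lam C)) (unit_eta C)) \<and>
   (\<forall>K :: 'k adc_data. adc_loop_free_unital K \<longrightarrow>
      omega_loop_free_atomic (nu K) \<and> adc_iso (lam (nu K)) K (counit_pi K)) \<and>

   \<comment> \<open>under which the strongly loop-free objects, which lie in these subcategories, correspond\<close>
   (\<forall>C :: 'a omega_cat. omega_strongly_loop_free_atomic C \<longrightarrow> omega_loop_free_atomic C) \<and>
   (\<forall>K :: 'k adc_data. adc_strongly_loop_free_unital K \<longrightarrow> adc_loop_free_unital K) \<and>
   (\<forall>C :: 'a omega_cat. omega_loop_free_atomic C \<longrightarrow>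
      (omega_strongly_loop_free_atomic C \<longleftrightarrow> adc_strongly_loop_free_unital (lam C))) \<and>
   (\<forall>K :: 'k adc_data. adc_loop_free_unital K \<longrightarrow>
      (adc_strongly_loop_free_unital K \<longleftrightarrow> omega_strongly_loop_free_atomic (nu K)))"
  by (intro conjI allI impI; (elim conjE)?;
      rule omega_category.adc_lam lam_map_hom lam_map_id lam_map_comp
        adc.omega_category_nu nu_map_hom nu_map_id nu_map_comp
        omega_category.unit_eta_hom unit_eta_natural adc.counit_pi_hom counit_pi_natural
        triangle_lam triangle_nu
        loop_free_atomic_lam[THEN conjunct1] loop_free_atomic_lam[THEN conjunct2]
        loop_free_unital_nu[THEN conjunct1] loop_free_unital_nu[THEN conjunct2]
        strongly_imp_loop_free_omega strongly_imp_loop_free_adc strongly_lam_iff strongly_nu_iff;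
      assumption)

end
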